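(* Let $2\le r\le m\le n$ and $k\ge 1$. Let $Z_0\subseteq\mathcal Z^{m,n}_{r,k}$ be the union of the zero sets of those prime ideals of $S$ minimal over $\mathcal I^{m,n}_{r,k}$ that do not contain $x^{(0)}_{i,j}$ for some $(i,j)$, and let $Z_1\subseteq\mathcal Z^{m,n}_{r,k}$ be the subvariety where all $x^{(0)}_{i,j}$ ($1\le i\le m$, $1\le j\le n$) vanish. For each $(i,j)$ let $U_{i,j}$ be the open subset of $\mathcal Z^{m,n}_{r,k}$ where $x^{(0)}_{i,j}\ne0$, and let $U$ be the open subset where all $x^{(0)}_{i,j}\neq 0$. Then: (1) $\mathcal Z^{m,n}_{r,k}=Z_0\cup Z_1$. (2) $Z_0$ is nonempty and equals the Zariski closure of $U_{i,j}$ for every $(i,j)$, and also equals the closure of $U$. (3) The irreducible components of $Z_0$ are irreducible components of $\mathcal Z^{m,n}_{r,k}$ and are in bijection with the irreducible components of $\mathcal Z^{m-1,n-1}_{r-1,k}$, the bijection preserving codimension (in $\mathbf A^{mnk}$ and $\mathbf A^{(m-1)(n-1)k}$ respectively). (4) $Z_0$ is birational to $\mathcal Z^{m-1,n-1}_{r-1,k}\times\mathbf A^{(m+n-1)k}$. (5) $Z_1\cong\mathcal Z^{m,n}_{r,k-r}\times\mathbf A^{mn(r-1)}$ if $k>r$ and $Z_1\cong\mathbf A^{mn(k-1)}$ if $k\le r$. (6) $Z_1\subseteq Z_0$ if and only if no prime ideal minimal over $\mathcal I^{m,n}_{r,k}$ contains some $x^{(0)}_{i,j}$; the zero sets of the minimal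 primes containing some (equivalently all) $x^{(0)}_{i,j}$ are irreducible components of both $Z_1$ and $\mathcal Z^{m,n}_{r,k}$.
   Context: Let $F$ be an algebraically closed field. For integers $1\le r\le m\le n$ and $k\ge 1$, let $S=F[x^{(l)}_{i,j}:1\le i\le m,\ 1\le j\le n,\ 0\le l\le k-1]$, the coordinate ring of $\mathbf A^{mnk}_F$, and let $X(t)$ be the $m\times n$ matrix over $S[t]/(t^k)$ with $(i,j)$ entry $x_{i,j}(t)=\sum_{l=0}^{k-1}x^{(l)}_{i,j}t^l$. Every element of $S[t]/(t^k)$ is uniquely $\sum_{l=0}^{k-1}c_lt^l$ with $c_l\in S$ (its coefficient of $t^l$). $\mathcal I^{m,n}_{r,k}\subseteq S$ is the ideal generated by the coefficients of $t^l$, $0\le l\le k-1$, of all $r\times r$ minors of $X(t)$, and $\mathcal Z^{m,n}_{r,k}\subseteq\mathbf A^{mnk}_F$ is its zero set (with the same definition for other values of the indices, e.g. $\mathcal Z^{m-1,n-1}_{r-1,k}\subseteq\mathbf A^{(m-1)(n-1)k}$). *)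

theory Defs
  imports "HOL-Library.Poly_Mapping" "HOL-Computational_Algebra.Polynomial"
          "HOL-Combinatorics.Permutations" "HOL-Library.Extended_Nat"
begin

type_synonym ('v, 'a) mpoly = "('v \<Rightarrow>\<^sub>0 nat) \<Rightarrow>\<^sub>0 'a"

definition alg_closed :: "'a::field itself \<Rightarrow> bool" where
  "alg_closed _ \<longleftrightarrow> (\<forall>p :: 'a poly. degree p \<ge> 1 \<longrightarrow> (\<exists>x. poly p x = 0))"

definition mvar :: "'v \<Rightarrow> ('v, 'a::comm_ring_1) mpoly" where
  "mvar v = Poly_Mapping.single (Poly_Mapping.single v 1) 1"

definition mvars :: "('v, 'a::zero) mpoly \<Rightarrow> 'v set" where
  "mvars f = \<Union> (Poly_Mapping.keys ` Poly_Mapping.keys f)"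

definition polyring :: "'v set \<Rightarrow> ('v, 'a::comm_ring_1) mpoly set" where
  "polyring V = {f. mvars f \<subseteq> V}"

definition peval :: "('v \<Rightarrow> 'a::comm_ring_1) \<Rightarrow> ('v, 'a) mpoly \<Rightarrow> 'a" where
  "peval p f = (\<Sum>mn\<in>Poly_Mapping.keys f. Poly_Mapping.lookup f mn * (\<Prod>v\<in>Poly_Mapping.keys mn. p v ^ Poly_Mapping.lookup mn v))"

definition aff :: "'v set \<Rightarrow> ('v \<Rightarrow> 'a::zero) set" where
  "aff V = {p. \<forall>v. v \<notin> V \<longrightarrow> p v = 0}"

definition is_ideal :: "'v set \<Rightarrow> ('v, 'a::comm_ring_1) mpoly set \<Rightarrow> bool" where
  "is_ideal V I \<longleftrightarrow> I \<subseteq> polyring V \<and> 0 \<in> I \<and> (\<forall>f\<in>I. \<forall>g\<in>I. f + g \<in> I)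
     \<and> (\<forall>f\<in>I. \<forall>g\<in>polyring V. g * f \<in> I)"

definition ideal_gen :: "'v set \<Rightarrow> ('v, 'a::comm_ring_1) mpoly set \<Rightarrow> ('v, 'a) mpoly set" where
  "ideal_gen V G = \<Inter> {I. is_ideal V I \<and> G \<subseteq> I}"

definition is_prime_ideal :: "'v set \<Rightarrow> ('v, 'a::comm_ring_1) mpoly set \<Rightarrow> bool" where
  "is_prime_ideal V P \<longleftrightarrow> is_ideal V P \<and> 1 \<notin> P \<and>
     (\<forall>f\<in>polyring V. \<forall>g\<in>polyring V. f * g \<in> P \<longrightarrow> f \<in> P \<or> g \<in> P)"

definition minimal_prime :: "'v set \<Rightarrow> ('v, 'a::comm_ring_1) mpoly set \<Rightarrow> ('v, 'a) mpoly set \<Rightarrow> bool" where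
  "minimal_prime V I P \<longleftrightarrow> is_prime_ideal V P \<and> I \<subseteq> P \<and>
     \<not> (\<exists>Q. is_prime_ideal V Q \<and> I \<subseteq> Q \<and> Q \<subset> P)"

definition zeros :: "'v set \<Rightarrow> ('v, 'a::comm_ring_1) mpoly set \<Rightarrow> ('v \<Rightarrow> 'a) set" where
  "zeros V T = {p \<in> aff V. \<forall>f\<in>T. peval p f = 0}"

definition zclosed :: "'v set \<Rightarrow> ('v \<Rightarrow> 'a::comm_ring_1) set \<Rightarrow> bool" where
  "zclosed V X \<longleftrightarrow> (\<exists>T \<subseteq> polyring V. X = zeros V T)"

definition zopen_in :: "'v set \<Rightarrow> ('v \<Rightarrow> 'a::comm_ring_1) set \<Rightarrow> ('v \<Rightarrow> 'a) set \<Rightarrow> bool" where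
  "zopen_in V X Op \<longleftrightarrow> (\<exists>F. zclosed V F \<and> Op = X - F)"

definition zclosure :: "'v set \<Rightarrow> ('v \<Rightarrow> 'a::comm_ring_1) set \<Rightarrow> ('v \<Rightarrow> 'a) set" where
  "zclosure V Y = \<Inter> {F. zclosed V F \<and> Y \<subseteq> F}"

definition zirred :: "'v set \<Rightarrow> ('v \<Rightarrow> 'a::comm_ring_1) set \<Rightarrow> bool" where
  "zirred V C \<longleftrightarrow> zclosed V C \<and> C \<noteq> {} \<and>
     (\<forall>A B. zclosed V A \<longrightarrow> zclosed V B \<longrightarrow> C \<subseteq> A \<union> B \<longrightarrow> C \<subseteq> A \<or> C \<subseteq> B)"

definition irr_comp :: "'v set \<Rightarrow> ('v \<Rightarrow> 'a::comm_ring_1) set \<Rightarrow> ('v \<Rightarrow> 'a) set \<Rightarrow> bool" where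
  "irr_comp V X C \<longleftrightarrow> zirred V C \<and> C \<subseteq> X \<and> \<not> (\<exists>D. zirred V D \<and> D \<subseteq> X \<and> C \<subset> D)"

definition codim :: "'v set \<Rightarrow> ('v \<Rightarrow> 'a::comm_ring_1) set \<Rightarrow> enat" where
  "codim V C = Sup {enat n | n. \<exists>c. c 0 = C \<and> (\<forall>i<n. c i \<subset> c (Suc i)) \<and> (\<forall>i\<le>n. zirred V (c i))}"

definition regular_on :: "'v set \<Rightarrow> ('v \<Rightarrow> 'a::field) set \<Rightarrow> (('v \<Rightarrow> 'a) \<Rightarrow> 'a) \<Rightarrow> bool" where
  "regular_on V U h \<longleftrightarrow> (\<forall>p\<in>U. \<exists>Op f g. zopen_in V (aff V) Op \<and> p \<in> Op \<and>
      f \<in> polyring V \<and> g \<in> polyring V \<and>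
      (\<forall>q\<in>U \<inter> Op. peval q g \<noteq> 0 \<and> h q = peval q f / peval q g))"

definition morphism :: "'v set \<Rightarrow> ('v \<Rightarrow> 'a::field) set \<Rightarrow> 'w set \<Rightarrow> ('w \<Rightarrow> 'a) set
    \<Rightarrow> (('v \<Rightarrow> 'a) \<Rightarrow> ('w \<Rightarrow> 'a)) \<Rightarrow> bool" where
  "morphism V U W U' \<phi> \<longleftrightarrow> (\<forall>p\<in>U. \<phi> p \<in> U') \<and> (\<forall>w\<in>W. regular_on V U (\<lambda>p. \<phi> p w))"

definition var_iso :: "'v set \<Rightarrow> ('v \<Rightarrow> 'a::field) set \<Rightarrow> 'w set \<Rightarrow> ('w \<Rightarrow> 'a) set \<Rightarrow> bool" where
  "var_iso V U W U' \<longleftrightarrow> (\<exists>\<phi> \<psi>. morphism V U W U' \<phi> \<and> morphism W U' V U \<psi> \<and>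
      (\<forall>p\<in>U. \<psi> (\<phi> p) = p) \<and> (\<forall>q\<in>U'. \<phi> (\<psi> q) = q))"

definition birational :: "'v set \<Rightarrow> ('v \<Rightarrow> 'a::field) set \<Rightarrow> 'w set \<Rightarrow> ('w \<Rightarrow> 'a) set \<Rightarrow> bool" where
  "birational V X W Y \<longleftrightarrow> (\<exists>Op Op'. zopen_in V X Op \<and> zclosure V Op = zclosure V X \<and>
      zopen_in W Y Op' \<and> zclosure W Op' = zclosure W Y \<and> var_iso V Op W Op')"

definition prod_aff :: "('v \<Rightarrow> 'a::zero) set \<Rightarrow> nat \<Rightarrow> ('v + nat \<Rightarrow> 'a) set" where
  "prod_aff X d = {p. (\<lambda>v. p (Inl v)) \<in> X \<and> (\<forall>i. d \<le> i \<longrightarrow> p (Inr i) = 0)}"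

definition prod_vars :: "'v set \<Rightarrow> nat \<Rightarrow> ('v + nat) set" where
  "prod_vars V d = Inl ` V \<union> Inr ` {..<d}"

text \<open>Variable (i,j,l) stands for x^(l)_{i,j}; indices 1 \<le> i \<le> m, 1 \<le> j \<le> n, 0 \<le> l < k.\<close>
definition Idx :: "nat \<Rightarrow> nat \<Rightarrow> nat \<Rightarrow> (nat \<times> nat \<times> nat) set" where
  "Idx m n k = {(i, j, l). 1 \<le> i \<and> i \<le> m \<and> 1 \<le> j \<and> j \<le> n \<and> l < k}"

text \<open>x_{i,j}(t) as a polynomial in t over S (truncation mod t^k is handled by
  taking only coefficients of t^l for l < k, which commutes with reduction).\<close>
definition xentry :: "nat \<Rightarrow> nat \<Rightarrow> nat \<Rightarrow> (nat \<times> nat \<times> nat, 'a::comm_ring_1) mpoly poly" where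
  "xentry k i j = (\<Sum>l<k. monom (mvar (i, j, l)) l)"

definition minor :: "nat \<Rightarrow> nat set \<Rightarrow> nat set \<Rightarrow> (nat \<times> nat \<times> nat, 'a::comm_ring_1) mpoly poly" where
  "minor k R C = (let rs = sorted_list_of_set R; cs = sorted_list_of_set C; r = card R in
     (\<Sum>\<sigma>\<in>{\<sigma>. \<sigma> permutes {..<r}}. of_int (sign \<sigma>) * (\<Prod>a<r. xentry k (rs ! a) (cs ! \<sigma> a))))"

definition jet_gens :: "nat \<Rightarrow> nat \<Rightarrow> nat \<Rightarrow> nat \<Rightarrow> (nat \<times> nat \<times> nat, 'a::comm_ring_1) mpoly set" where
  "jet_gens m n r k = {coeff (minor k R C) l | R C l.
     R \<subseteq> {1..m} \<and> card R = r \<and> C \<subseteq> {1..n} \<and> card C = r \<and> l < k}"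

definition jetI :: "nat \<Rightarrow> nat \<Rightarrow> nat \<Rightarrow> nat \<Rightarrow> (nat \<times> nat \<times> nat, 'a::comm_ring_1) mpoly set" where
  "jetI m n r k = ideal_gen (Idx m n k) (jet_gens m n r k)"

definition jetZ :: "nat \<Rightarrow> nat \<Rightarrow> nat \<Rightarrow> nat \<Rightarrow> (nat \<times> nat \<times> nat \<Rightarrow> 'a::comm_ring_1) set" where
  "jetZ m n r k = zeros (Idx m n k) (jetI m n r k)"

end

theory Submission
  imports Defs "Jordan_Normal_Form.Determinant" "HOL-Computational_Algebra.Formal_Power_Series"
begin

text \<open>
  Where \<open>x\<^sub>1\<^sub>1\<close> is invertible, elimination with this pivot identifies the matrices all of whose \<open>r\<close>-minors
  vanish modulo \<open>t ^ k\<close> with the product of an open subset of an affine space (first row and column) and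
  the matrices of size \<open>(m - 1) \<times> (n - 1)\<close> all of whose \<open>(r - 1)\<close>-minors vanish modulo \<open>t ^ k\<close>. This gives the
  birational map and the bijection of components. Row and column operations move a point with one
  nonzero constant term to points with all constant terms nonzero, so the loci \<open>U\<^sub>i\<^sub>j\<close> and \<open>U\<close> have
  the same closure, and by the Nullstellensatz it is the union of the components not contained in \<open>Z\<^sub>1\<close>.
  On \<open>Z\<^sub>1\<close> the matrix is \<open>t\<close> times another one, whose minors have to vanish modulo \<open>t ^ (k - r)\<close> only.
  Codimensions agree because the codimension of an irreducible set is the number of variables minus
  the maximal number of algebraically independent functions on it.
\<close>

section \<open>Evaluation of multivariate polynomials\<close>

text \<open>Every existence claim about minimal primes comes from one principle: a multiplicative
  set disjoint from \<open>I\<close> is avoided by some minimal prime over \<open>I\<close>. Taking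
  products of powers of one coordinate with the functions nonzero at a point, or with the complement
  of a prime, expresses closures of basic open sets and their components through minimal primes. The
  ideal \<open>I\<close> is not known to be radical, so vanishing is turned into membership only for
  primes. Codimension is defined by chains, and two bounds have to meet. A maximal independent set
  \<open>B\<close> of coordinates on \<open>D\<close> yields a chain of length
  \<open>card V' - card B\<close> by releasing the other coordinates one at a time. On the lift of
  \<open>D\<close>, the coordinates in \<open>B\<close> and those of the first row and column are
  independent after elimination, which bounds chains by the same number. Divisibility by
  \<open>fps_X ^ k\<close> in power series over the field replaces calculation in the truncated
  ring, and the pivot becomes a true unit. Minors are taken along arbitrary index maps, so that
  bordering and row operations stay within one family.\<close>

abbreviation mconst :: "'a::comm_ring_1 \<Rightarrow> ('v, 'a) mpoly" where
  "mconst c \<equiv> Poly_Mapping.single 0 c"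

definition meval :: "('v \<Rightarrow> 'a::comm_ring_1) \<Rightarrow> ('v \<Rightarrow>\<^sub>0 nat) \<Rightarrow> 'a" where
  "meval p m = (\<Prod>v\<in>Poly_Mapping.keys m. p v ^ Poly_Mapping.lookup m v)"

lemma meval_superset:
  assumes "finite B" "Poly_Mapping.keys m \<subseteq> B"
  shows "meval p m = (\<Prod>v\<in>B. p v ^ Poly_Mapping.lookup m v)"
  unfolding meval_def using assms
  by (intro prod.mono_neutral_left) (auto simp: in_keys_iff)

lemma meval_add: "meval p (m + m') = meval p m * meval p m'"
proof -
  let ?B = "Poly_Mapping.keys m \<union> Poly_Mapping.keys m'"
  have "meval p (m + m') = (\<Prod>v\<in>?B. p v ^ Poly_Mapping.lookup (m + m') v)"
    by (rule meval_superset) (auto dest: subsetD[OF keys_add])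
  then show ?thesis
    by (simp add: meval_superset[of ?B] lookup_add power_add prod.distrib)
qed

lemma meval_0 [simp]: "meval p 0 = 1"
  by (simp add: meval_def)

lemma meval_single [simp]: "meval p (Poly_Mapping.single v e) = p v ^ e"
  by (cases "e = 0") (auto simp: meval_def)

lemma peval_superset:
  assumes "finite A" "Poly_Mapping.keys f \<subseteq> A"
  shows "peval p f = (\<Sum>m\<in>A. Poly_Mapping.lookup f m * meval p m)"
  unfolding peval_def meval_def[symmetric] using assms
  by (intro sum.mono_neutral_left) (auto simp: in_keys_iff)

lemma peval_0 [simp]: "peval p 0 = 0"
  by (simp add: peval_def)

lemma peval_single [simp]: "peval p (Poly_Mapping.single m c) = c * meval p m"
  by (cases "c = 0") (auto simp: peval_def meval_def)

lemma peval_1 [simp]: "peval p 1 = 1"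
  by (simp add: peval_def)

lemma peval_add [simp]: "peval p (f + g) = peval p f + peval p g"
proof -
  let ?A = "Poly_Mapping.keys f \<union> Poly_Mapping.keys g"
  have "peval p (f + g) = (\<Sum>m\<in>?A. Poly_Mapping.lookup (f + g) m * meval p m)"
    by (rule peval_superset) (auto dest: subsetD[OF keys_add])
  then show ?thesis
    by (simp add: peval_superset[of ?A] lookup_add distrib_right sum.distrib)
qed

lemma peval_sum [simp]: "peval p (\<Sum>i\<in>A. f i) = (\<Sum>i\<in>A. peval p (f i))"
  by (induction A rule: infinite_finite_induct) auto

lemma poly_mapping_sum_single:
  "f = (\<Sum>m\<in>Poly_Mapping.keys f. Poly_Mapping.single m (Poly_Mapping.lookup f m))"
proof (rule poly_mapping_eqI)
  fix k
  have "Poly_Mapping.lookup (\<Sum>m\<in>Poly_Mapping.keys f. Poly_Mapping.single m (Poly_Mapping.lookup f m)) k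
      = (\<Sum>m\<in>Poly_Mapping.keys f. if m = k then Poly_Mapping.lookup f m else 0)"
    unfolding lookup_sum by (intro sum.cong) (auto simp: lookup_single when_def)
  also have "\<dots> = Poly_Mapping.lookup f k"
    by (auto simp: in_keys_iff)
  finally show "Poly_Mapping.lookup f k = Poly_Mapping.lookup
    (\<Sum>m\<in>Poly_Mapping.keys f. Poly_Mapping.single m (Poly_Mapping.lookup f m)) k" by simp
qed

lemma peval_mult [simp]: "peval p (f * g) = peval p f * peval p g"
proof -
  let ?s = "\<lambda>f. \<Sum>m\<in>Poly_Mapping.keys f. Poly_Mapping.single m (Poly_Mapping.lookup f m)"
  have "peval p (f * g) = peval p (?s f * ?s g)"
    by (simp only: poly_mapping_sum_single[symmetric])
  also have "\<dots> = (\<Sum>m\<in>Poly_Mapping.keys f. \<Sum>m'\<in>Poly_Mapping.keys g.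
      (Poly_Mapping.lookup f m * meval p m) * (Poly_Mapping.lookup g m' * meval p m'))"
    by (simp add: sum_product mult_single meval_add mult_ac)
  also have "\<dots> = peval p f * peval p g"
    by (simp add: sum_product[symmetric] peval_superset[OF _ order.refl])
  finally show ?thesis .
qed

lemma peval_uminus [simp]: "peval p (- f) = - peval p f"
  using peval_add[of p "- f" f] by (simp add: eq_neg_iff_add_eq_0 del: peval_add)

lemma peval_diff [simp]: "peval p (f - g) = peval p f - peval p g"
  using peval_add[of p f "- g"] by simp

lemma peval_prod [simp]: "peval p (\<Prod>i\<in>A. f i) = (\<Prod>i\<in>A. peval p (f i))"
  by (induction A rule: infinite_finite_induct) auto

lemma peval_power [simp]: "peval p (f ^ e) = peval p f ^ e"
  by (induction e) auto

lemma peval_mvar [simp]: "peval p (mvar v) = p v"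
  by (simp add: mvar_def)

lemma peval_of_nat [simp]: "peval p (of_nat e) = of_nat e"
  by (induction e) auto

lemma peval_of_int [simp]: "peval p (of_int z) = of_int z"
  by (cases z) auto

lemma peval_poly: "peval p (poly q y) = poly (map_poly (peval p) q) (peval p y)"
  by (induction q) (auto simp: map_poly_pCons)

section \<open>Polynomials in a chosen set of variables\<close>

lemma polyring_0 [simp]: "0 \<in> polyring V"
  by (simp add: polyring_def mvars_def)

lemma polyring_const [simp]: "mconst c \<in> polyring V"
  by (simp add: polyring_def mvars_def)

lemma polyring_1 [simp]: "1 \<in> polyring V"
  by (simp add: polyring_def mvars_def)

lemma polyring_add [intro]: "f \<in> polyring V \<Longrightarrow> g \<in> polyring V \<Longrightarrow> f + g \<in> polyring V"
  unfolding polyring_def mvars_def using keys_add[of f g] by blast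

lemma polyring_mult [intro]:
  assumes "f \<in> polyring V" "g \<in> polyring V"
  shows "f * g \<in> polyring V"
proof -
  have "Poly_Mapping.keys m \<subseteq> V" if "m \<in> Poly_Mapping.keys (f * g)" for m
  proof -
    obtain a b where ab: "a \<in> Poly_Mapping.keys f" "b \<in> Poly_Mapping.keys g" "m = a + b"
      using subsetD[OF keys_mult \<open>m \<in> Poly_Mapping.keys (f * g)\<close>] by blast
    have "Poly_Mapping.keys a \<subseteq> V" "Poly_Mapping.keys b \<subseteq> V"
      using assms ab(1,2) unfolding polyring_def mvars_def by blast+
    then show ?thesis
      using subset_trans[OF keys_add[of a b]] ab(3) by simp
  qed
  then show ?thesis unfolding polyring_def mvars_def by blast
qed

lemma polyring_uminus [intro]: "f \<in> polyring V \<Longrightarrow> - f \<in> polyring V"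
  using polyring_mult[OF polyring_const[of "- 1"], of f]
  by (simp add: single_uminus)

lemma polyring_diff [intro]: "f \<in> polyring V \<Longrightarrow> g \<in> polyring V \<Longrightarrow> f - g \<in> polyring V"
  using polyring_add[OF _ polyring_uminus, of f V g] by simp

lemma polyring_sum [intro]: "(\<And>i. i \<in> A \<Longrightarrow> f i \<in> polyring V) \<Longrightarrow> (\<Sum>i\<in>A. f i) \<in> polyring V"
  by (induction A rule: infinite_finite_induct) auto

lemma polyring_prod [intro]: "(\<And>i. i \<in> A \<Longrightarrow> f i \<in> polyring V) \<Longrightarrow> (\<Prod>i\<in>A. f i) \<in> polyring V"
  by (induction A rule: infinite_finite_induct) auto

lemma polyring_power [intro]: "f \<in> polyring V \<Longrightarrow> f ^ e \<in> polyring V"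
  by (induction e) auto

lemma polyring_mvar [intro]: "v \<in> V \<Longrightarrow> mvar v \<in> polyring V"
  by (simp add: polyring_def mvars_def mvar_def)

lemma polyring_mono: "V \<subseteq> W \<Longrightarrow> f \<in> polyring V \<Longrightarrow> f \<in> polyring W"
  by (auto simp: polyring_def)

lemma single_eq_prod_mvar:
  "Poly_Mapping.single m (1::'a::comm_ring_1)
    = (\<Prod>v\<in>Poly_Mapping.keys m. mvar v ^ Poly_Mapping.lookup m v)"
proof -
  have pow: "mvar v ^ e = Poly_Mapping.single (Poly_Mapping.single v e) (1::'a)" for v :: 'b and e
    by (induction e) (auto simp: mvar_def mult_single simp flip: single_add)
  have "(\<Prod>v\<in>A. Poly_Mapping.single (h v) (1::'a)) = Poly_Mapping.single (\<Sum>v\<in>A. h v) 1"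
    for A and h :: "'b \<Rightarrow> 'b \<Rightarrow>\<^sub>0 nat"
    by (induction A rule: infinite_finite_induct) (auto simp: mult_single)
  then have "(\<Prod>v\<in>Poly_Mapping.keys m. mvar v ^ Poly_Mapping.lookup m v)
    = Poly_Mapping.single (\<Sum>v\<in>Poly_Mapping.keys m. Poly_Mapping.single v (Poly_Mapping.lookup m v)) (1::'a)"
    by (simp add: pow)
  then show ?thesis
    by (simp only: poly_mapping_sum_single[symmetric])
qed

lemma polyring_induct [consumes 1, case_names const mvar add mult]:
  assumes f: "f \<in> polyring V"
    and const: "\<And>c. P (mconst c)"
    and var: "\<And>v. v \<in> V \<Longrightarrow> P (mvar v)"
    and add: "\<And>f g. f \<in> polyring V \<Longrightarrow> g \<in> polyring V \<Longrightarrow> P f \<Longrightarrow> P g \<Longrightarrow> P (f + g)"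
    and mult: "\<And>f g. f \<in> polyring V \<Longrightarrow> g \<in> polyring V \<Longrightarrow> P f \<Longrightarrow> P g \<Longrightarrow> P (f * g)"
  shows "P f"
proof -
  have P1: "P 1" "P 0" using const[of 1] const[of 0] by auto
  have pow: "P (mvar v ^ e)" if "v \<in> V" for v e
    by (induction e) (auto intro!: P1 mult var that polyring_mvar)
  have prod: "P (\<Prod>v\<in>A. mvar v ^ h v)" if "A \<subseteq> V" for A and h :: "_ \<Rightarrow> nat"
    using that
    by (induction A rule: infinite_finite_induct) (auto intro!: P1 mult pow polyring_mvar)
  have monom_case: "P (Poly_Mapping.single m c) \<and> Poly_Mapping.single m c \<in> polyring V"
    if "Poly_Mapping.keys m \<subseteq> V" for m c
  proof -
    have "Poly_Mapping.single m c = mconst c * Poly_Mapping.single m 1"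
      by (simp add: mult_single)
    also have "\<dots> = mconst c * (\<Prod>v\<in>Poly_Mapping.keys m. mvar v ^ Poly_Mapping.lookup m v)"
      by (simp only: single_eq_prod_mvar)
    finally have eq: "Poly_Mapping.single m c
      = mconst c * (\<Prod>v\<in>Poly_Mapping.keys m. mvar v ^ Poly_Mapping.lookup m v)" .
    have mem: "(\<Prod>v\<in>Poly_Mapping.keys m. mvar v ^ Poly_Mapping.lookup m v) \<in> polyring V"
      using that by (intro polyring_prod polyring_power polyring_mvar) auto
    show ?thesis unfolding eq
      by (intro conjI mult const prod that mem polyring_mult polyring_const)
  qed
  have sub: "Poly_Mapping.keys m \<subseteq> V" if "m \<in> Poly_Mapping.keys f" for m
    using f that by (auto simp: polyring_def mvars_def)
  have sum: "P (\<Sum>m\<in>A. Poly_Mapping.single m (Poly_Mapping.lookup f m))"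
    if "A \<subseteq> Poly_Mapping.keys f" for A
    using that
  proof (induction A rule: infinite_finite_induct)
    case (insert m A)
    then show ?case
      using monom_case sub by (auto intro!: add polyring_sum)
  qed (use P1 in auto)
  show ?thesis
    using sum[OF order.refl] by (simp only: poly_mapping_sum_single[symmetric])
qed

text \<open>\<open>A\<close> is any class of functions of a parameter \<open>b\<close> closed under
  the ring operations. The instances are polynomial functions, polynomial curves in one parameter,
  and rational functions on a set.\<close>

lemma peval_in_algebra:
  assumes "f \<in> polyring V"
    and "\<And>c. (\<lambda>b. c) \<in> A"
    and "\<And>v. v \<in> V \<Longrightarrow> (\<lambda>b. h b v) \<in> A"
    and "\<And>x y. x \<in> A \<Longrightarrow> y \<in> A \<Longrightarrow> (\<lambda>b. x b + y b) \<in> A"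
    and "\<And>x y. x \<in> A \<Longrightarrow> y \<in> A \<Longrightarrow> (\<lambda>b. x b * y b) \<in> A"
  shows "(\<lambda>b. peval (h b) f) \<in> A"
  using assms(1) by (induction rule: polyring_induct) (use assms in auto)

lemma peval_cong:
  assumes "f \<in> polyring V" "\<And>v. v \<in> V \<Longrightarrow> p v = q v"
  shows "peval p f = peval q f"
  using assms(1) by (induction rule: polyring_induct) (use assms(2) in auto)

lemma coeff_polyring_add:
  "(\<And>i. coeff a i \<in> polyring V) \<Longrightarrow> (\<And>i. coeff b i \<in> polyring V) \<Longrightarrow> coeff (a + b) i \<in> polyring V"
  by auto

lemma coeff_polyring_mult:
  "(\<And>i. coeff a i \<in> polyring V) \<Longrightarrow> (\<And>i. coeff b i \<in> polyring V) \<Longrightarrow> coeff (a * b) i \<in> polyring V"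
  by (auto simp: coeff_mult)

lemma polyring_poly:
  assumes "\<And>i. coeff q i \<in> polyring V" "y \<in> polyring V"
  shows "poly q y \<in> polyring V"
  unfolding poly_altdef by (intro polyring_sum polyring_mult polyring_power assms)

text \<open>Reading a polynomial as univariate in \<open>v\<close> over the other variables is what
  the inductions on the set of variables rest on.\<close>

lemma polyring_insert_decomp:
  assumes "f \<in> polyring (insert v V)"
  shows "\<exists>q. (\<forall>i. coeff q i \<in> polyring V) \<and> f = poly q (mvar v)"
  using assms
proof (induction rule: polyring_induct)
  case (const c)
  then show ?case
    by (intro exI[of _ "[:mconst c:]"]) (auto simp: coeff_pCons split: nat.split)
next
  case (mvar w)
  show ?case
  proof (cases "w \<in> V")
    case True
    then show ?thesis
      by (intro exI[of _ "[:mvar w:]"]) (auto simp: coeff_pCons split: nat.split)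
  next
    case False
    with mvar have "w = v" by simp
    then show ?thesis
      by (intro exI[of _ "[:0, 1:]"]) (auto simp: coeff_pCons split: nat.split)
  qed
next
  case (add f g)
  then obtain a b where "\<forall>i. coeff a i \<in> polyring V" "f = poly a (mvar v)"
    "\<forall>i. coeff b i \<in> polyring V" "g = poly b (mvar v)" by blast
  then show ?case by (intro exI[of _ "a + b"]) (auto simp: coeff_polyring_add)
next
  case (mult f g)
  then obtain a b where "\<forall>i. coeff a i \<in> polyring V" "f = poly a (mvar v)"
    "\<forall>i. coeff b i \<in> polyring V" "g = poly b (mvar v)" by blast
  then show ?case by (intro exI[of _ "a * b"]) (auto simp: coeff_polyring_mult)
qed

lemma polyring_empty: "f \<in> polyring {} \<Longrightarrow> \<exists>c. f = mconst c"
  by (induction rule: polyring_induct)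
    (auto simp: single_add[symmetric] mult_single)

section \<open>Nonvanishing over infinite fields\<close>

lemma infinite_UNIV_alg_closed:
  assumes "alg_closed TYPE('a::field)"
  shows "infinite (UNIV :: 'a set)"
proof
  assume fin: "finite (UNIV :: 'a set)"
  \<comment> \<open>Over a finite field this product would vanish everywhere, so adding 1 would
    leave a polynomial of positive degree without roots.\<close>
  let ?q = "\<Prod>a\<in>(UNIV :: 'a set). [:- a, 1:]"
  have deg: "degree ?q = card (UNIV :: 'a set)"
    by (subst degree_prod_eq_sum_degree) auto
  then have "degree ?q \<ge> 1"
    using fin by (simp add: card_gt_0_iff Suc_le_eq)
  moreover have "degree (1 + ?q) = degree ?q"
    using \<open>degree ?q \<ge> 1\<close> by (intro degree_add_eq_right) auto
  ultimately obtain x where "poly (1 + ?q) x = 0"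
    using assms unfolding alg_closed_def by metis
  moreover have "poly ?q x = 0"
    using fin by (auto simp: poly_prod)
  ultimately show False by simp
qed

lemma poly_nonzero_value:
  assumes "infinite (UNIV :: 'a::field set)" "q \<noteq> 0" "finite A"
  shows "\<exists>x::'a. x \<notin> A \<and> poly q x \<noteq> 0"
proof -
  have "finite ({x. poly q x = 0} \<union> A)"
    using assms poly_roots_finite by blast
  then have "{x. poly q x = 0} \<union> A \<noteq> UNIV"
    using assms(1) by metis
  then show ?thesis by auto
qed

text \<open>Induction on the variables: a point where the leading coefficient in \<open>v\<close> is
  nonzero leaves a nonzero univariate polynomial, which has a non-root in an infinite field.\<close>

lemma peval_nonzero_value:
  fixes f :: "('v, 'a::field) mpoly"
  assumes inf: "infinite (UNIV :: 'a set)" and "finite V" "f \<in> polyring V" "f \<noteq> 0"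
  shows "\<exists>p. peval p f \<noteq> 0"
  using assms(2-)
proof (induction V arbitrary: f)
  case empty
  then show ?case using polyring_empty by fastforce
next
  case (insert v V)
  obtain q where q: "\<And>i. coeff q i \<in> polyring V" "f = poly q (mvar v)"
    using polyring_insert_decomp[OF insert.prems(1)] by blast
  then have "q \<noteq> 0" using insert.prems by auto
  then have "lead_coeff q \<noteq> 0" by simp
  then obtain p where p: "peval p (lead_coeff q) \<noteq> 0"
    using insert.IH q by blast
  then have "map_poly (peval p) q \<noteq> 0"
    by (metis coeff_0 coeff_map_poly peval_0)
  then obtain x where x: "poly (map_poly (peval p) q) x \<noteq> 0"
    using poly_nonzero_value[OF inf] by blast
  have "map_poly (peval (p(v := x))) q = map_poly (peval p) q"
  proof (rule poly_eqI)
    fix i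
    have "peval (p(v := x)) (coeff q i) = peval p (coeff q i)"
      by (rule peval_cong[OF q(1)]) (use insert.hyps in auto)
    then show "coeff (map_poly (peval (p(v := x))) q) i = coeff (map_poly (peval p) q) i"
      by (simp add: coeff_map_poly)
  qed
  then have "peval (p(v := x)) f \<noteq> 0"
    using x by (simp add: q(2) peval_poly)
  then show ?case by blast
qed

section \<open>Zariski topology\<close>

text \<open>The vanishing ideal of \<open>Y\<close> in the coordinate ring.\<close>

definition vid :: "'v set \<Rightarrow> ('v \<Rightarrow> 'a::comm_ring_1) set \<Rightarrow> ('v, 'a) mpoly set" where
  "vid V Y = {f \<in> polyring V. \<forall>y\<in>Y. peval y f = 0}"

text \<open>Irreducibility tested on functions. For closed sets this is \<open>zirred\<close>, but it also makes sense
  for sets that are not closed, such as basic open subsets and images.\<close>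
definition firr :: "'v set \<Rightarrow> ('v \<Rightarrow> 'a::comm_ring_1) set \<Rightarrow> bool" where
  "firr V Y \<longleftrightarrow> Y \<noteq> {} \<and> (\<forall>f\<in>polyring V. \<forall>g\<in>polyring V.
     (\<forall>y\<in>Y. peval y f * peval y g = 0) \<longrightarrow> (\<forall>y\<in>Y. peval y f = 0) \<or> (\<forall>y\<in>Y. peval y g = 0))"

lemma firrD:
  assumes "firr V Y" "f \<in> polyring V" "g \<in> polyring V" "\<And>y. y \<in> Y \<Longrightarrow> peval y f = 0 \<or> peval y g = 0"
  shows "(\<forall>y\<in>Y. peval y f = 0) \<or> (\<forall>y\<in>Y. peval y g = 0)"
  using assms unfolding firr_def by (metis mult_zero_left mult_zero_right)

lemma zeros_vid_closed: "zclosed V C \<Longrightarrow> zeros V (vid V C) = C"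
  unfolding zclosed_def zeros_def vid_def by blast

text \<open>Serves as a separation principle: a point outside a closed set is detected by a
  polynomial vanishing on the set.\<close>

lemma zclosed_iff:
  "zclosed V C \<longleftrightarrow> C \<subseteq> aff V \<and>
    (\<forall>p\<in>aff V. (\<forall>f\<in>polyring V. (\<forall>y\<in>C. peval y f = 0) \<longrightarrow> peval p f = 0) \<longrightarrow> p \<in> C)"
  (is "_ \<longleftrightarrow> ?R")
proof
  assume "zclosed V C"
  then show ?R unfolding zclosed_def zeros_def by blast
next
  assume R: ?R
  then have "C = zeros V (vid V C)"
    unfolding zeros_def vid_def by blast
  moreover have "vid V C \<subseteq> polyring V" by (auto simp: vid_def)
  ultimately show "zclosed V C" unfolding zclosed_def by blast
qed

lemma zclosed_zeros [intro]: "T \<subseteq> polyring V \<Longrightarrow> zclosed V (zeros V T)"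
  unfolding zclosed_def by blast

lemma zclosure_eq:
  assumes "Y \<subseteq> aff V"
  shows "zclosure V Y = zeros V (vid V Y)"
proof
  have "Y \<subseteq> zeros V (vid V Y)" using assms by (auto simp: zeros_def vid_def)
  moreover have "zclosed V (zeros V (vid V Y))" by (rule zclosed_zeros) (auto simp: vid_def)
  ultimately show "zclosure V Y \<subseteq> zeros V (vid V Y)" unfolding zclosure_def by blast
next
  have "zeros V (vid V Y) \<subseteq> zeros V T" if "T \<subseteq> polyring V" "Y \<subseteq> zeros V T" for T
    using that unfolding zeros_def vid_def by blast
  then show "zeros V (vid V Y) \<subseteq> zclosure V Y"
    unfolding zclosure_def zclosed_def by blast
qed

lemma zclosed_zclosure: "Y \<subseteq> aff V \<Longrightarrow> zclosed V (zclosure V Y)"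
  by (auto simp: zclosure_eq vid_def intro!: zclosed_zeros)

lemma zclosure_superset: "Y \<subseteq> zclosure V Y"
  by (auto simp: zclosure_def)

lemma zclosure_subset: "zclosed V C \<Longrightarrow> Y \<subseteq> C \<Longrightarrow> zclosure V Y \<subseteq> C"
  by (auto simp: zclosure_def)

lemma zclosure_closed: "zclosed V C \<Longrightarrow> zclosure V C = C"
  using zclosure_subset[of V C C] zclosure_superset[of C V] by auto

lemma zclosure_subset_aff: "Y \<subseteq> aff V \<Longrightarrow> zclosure V Y \<subseteq> aff V"
  by (auto simp: zclosure_eq zeros_def)

lemma mem_zclosure_iff:
  "Y \<subseteq> aff V \<Longrightarrow> p \<in> zclosure V Y \<longleftrightarrow>
    p \<in> aff V \<and> (\<forall>f\<in>polyring V. (\<forall>y\<in>Y. peval y f = 0) \<longrightarrow> peval p f = 0)"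
  by (auto simp: zclosure_eq zeros_def vid_def)

lemma zclosed_subset_aff: "zclosed V C \<Longrightarrow> C \<subseteq> aff V"
  by (auto simp: zclosed_iff)

lemma zclosure_vanish:
  "Y \<subseteq> aff V \<Longrightarrow> f \<in> polyring V \<Longrightarrow> \<forall>y\<in>Y. peval y f = 0 \<Longrightarrow> p \<in> zclosure V Y \<Longrightarrow> peval p f = 0"
  by (auto simp: mem_zclosure_iff)

lemma zclosure_subset_zclosure:
  assumes "Y \<subseteq> zclosure V W" "W \<subseteq> aff V"
  shows "zclosure V Y \<subseteq> zclosure V W"
  by (rule zclosure_subset[OF zclosed_zclosure[OF assms(2)] assms(1)])

text \<open>A factor \<open>f\<close> of a vanishing product cuts out the closed set
  \<open>zeros V {f}\<close>. Conversely, closed sets \<open>A\<close> and \<open>B\<close> that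
  each miss a point of \<open>C\<close> give separating polynomials whose product vanishes on
  \<open>C\<close>.\<close>

lemma zirred_iff:
  fixes C :: "('v \<Rightarrow> 'a::field) set"
  shows "zirred V C \<longleftrightarrow> zclosed V C \<and> firr V C"
proof
  assume C: "zirred V C"
  then have cl: "zclosed V C" "C \<noteq> {}"
    and ir: "\<And>A B. zclosed V A \<Longrightarrow> zclosed V B \<Longrightarrow> C \<subseteq> A \<union> B \<Longrightarrow> C \<subseteq> A \<or> C \<subseteq> B"
    by (simp_all add: zirred_def)
  have aff: "C \<subseteq> aff V" by (rule zclosed_subset_aff[OF cl(1)])
  have "(\<forall>y\<in>C. peval y f = 0) \<or> (\<forall>y\<in>C. peval y g = 0)"
    if fg: "f \<in> polyring V" "g \<in> polyring V" "\<forall>y\<in>C. peval y f * peval y g = 0" for f g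
  proof -
    have "C \<subseteq> zeros V {f} \<union> zeros V {g}"
      using aff fg(3) by (auto simp: zeros_def)
    moreover have "zclosed V (zeros V {f})" "zclosed V (zeros V {g})"
      using fg(1,2) by (simp_all add: zclosed_zeros)
    ultimately have "C \<subseteq> zeros V {f} \<or> C \<subseteq> zeros V {g}"
      by (intro ir)
    then show ?thesis by (auto simp: zeros_def)
  qed
  then show "zclosed V C \<and> firr V C"
    using cl by (simp add: firr_def)
next
  assume C: "zclosed V C \<and> firr V C"
  have "C \<subseteq> A \<or> C \<subseteq> B" if AB: "zclosed V A" "zclosed V B" "C \<subseteq> A \<union> B" for A B
  proof (rule ccontr)
    assume "\<not> ?thesis"
    then obtain a b where ab: "a \<in> C" "a \<notin> A" "b \<in> C" "b \<notin> B" by blast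
    have aff: "a \<in> aff V" "b \<in> aff V" using zclosed_subset_aff[of V C] C ab by auto
    obtain f where f: "f \<in> polyring V" "\<forall>y\<in>A. peval y f = 0" "peval a f \<noteq> 0"
      using AB(1) ab(2) aff(1) unfolding zclosed_iff by blast
    obtain g where g: "g \<in> polyring V" "\<forall>y\<in>B. peval y g = 0" "peval b g \<noteq> 0"
      using AB(2) ab(4) aff(2) unfolding zclosed_iff by blast
    have "(\<forall>y\<in>C. peval y f = 0) \<or> (\<forall>y\<in>C. peval y g = 0)"
      by (rule firrD[OF conjunct2[OF C] f(1) g(1)]) (use f g AB(3) in blast)
    then show False using f(3) g(3) ab(1,3) by blast
  qed
  then show "zirred V C" using C by (simp add: zirred_def firr_def)
qed

lemma zirred_zclosure:
  fixes Y :: "('v \<Rightarrow> 'a::field) set"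
  assumes "Y \<subseteq> aff V" "firr V Y"
  shows "zirred V (zclosure V Y)"
proof -
  have "firr V (zclosure V Y)"
    unfolding firr_def
  proof (intro conjI ballI impI)
    show "zclosure V Y \<noteq> {}" using assms(2) zclosure_superset[of Y V] by (auto simp: firr_def)
  next
    fix f g :: "('v, 'a) mpoly"
    assume fg: "f \<in> polyring V" "g \<in> polyring V" and
      "\<forall>y\<in>zclosure V Y. peval y f * peval y g = 0"
    then have "(\<forall>y\<in>Y. peval y f = 0) \<or> (\<forall>y\<in>Y. peval y g = 0)"
      using zclosure_superset[of Y V] by (intro firrD[OF assms(2)]) auto
    then show "(\<forall>y\<in>zclosure V Y. peval y f = 0) \<or> (\<forall>y\<in>zclosure V Y. peval y g = 0)"
      using zclosure_vanish[OF assms(1) fg(1)] zclosure_vanish[OF assms(1) fg(2)] by blast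
  qed
  then show ?thesis using assms(1) by (simp add: zirred_iff zclosed_zclosure)
qed

text \<open>Multiplying \<open>f\<close> and \<open>g\<close> by \<open>x\<close> extends the
  vanishing of their product from the open part to all of \<open>Y\<close>.\<close>

lemma firr_basic_open:
  fixes Y :: "('v \<Rightarrow> 'a::field) set"
  assumes "firr V Y" "x \<in> polyring V" "y \<in> Y" "peval y x \<noteq> 0"
  shows "firr V {y \<in> Y. peval y x \<noteq> 0}"
  unfolding firr_def
proof (intro conjI ballI impI)
  show "{y \<in> Y. peval y x \<noteq> 0} \<noteq> {}" using assms by auto
next
  fix f g :: "('v, 'a) mpoly"
  assume fg: "f \<in> polyring V" "g \<in> polyring V"
    "\<forall>y\<in>{y \<in> Y. peval y x \<noteq> 0}. peval y f * peval y g = 0"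
  have "(\<forall>y\<in>Y. peval y (f * x) = 0) \<or> (\<forall>y\<in>Y. peval y (g * x) = 0)"
    by (rule firrD[OF assms(1)]) (use fg assms(2) in auto)
  then show "(\<forall>y\<in>{y \<in> Y. peval y x \<noteq> 0}. peval y f = 0) \<or> (\<forall>y\<in>{y \<in> Y. peval y x \<noteq> 0}. peval y g = 0)"
    by auto
qed

text \<open>If \<open>f\<close> vanishes on the open part then \<open>f * x\<close> vanishes on
  \<open>C\<close>, and \<open>x\<close> is not zero on \<open>C\<close>.\<close>

lemma zirred_eq_closure_basic_open:
  fixes C :: "('v \<Rightarrow> 'a::field) set"
  assumes "zirred V C" "x \<in> polyring V" "y \<in> C" "peval y x \<noteq> 0"
  shows "zclosure V {y \<in> C. peval y x \<noteq> 0} = C"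
proof
  have cl: "zclosed V C" "firr V C" using assms(1) by (auto simp: zirred_iff)
  show "zclosure V {y \<in> C. peval y x \<noteq> 0} \<subseteq> C"
    by (rule zclosure_subset) (use cl in auto)
  show "C \<subseteq> zclosure V {y \<in> C. peval y x \<noteq> 0}"
  proof
    fix p assume "p \<in> C"
    have "peval p f = 0" if "f \<in> polyring V" "\<forall>y\<in>{y \<in> C. peval y x \<noteq> 0}. peval y f = 0" for f
    proof -
      have "(\<forall>y\<in>C. peval y f = 0) \<or> (\<forall>y\<in>C. peval y x = 0)"
        by (rule firrD[OF cl(2)]) (use that assms in auto)
      then show ?thesis using \<open>p \<in> C\<close> assms(3,4) by auto
    qed
    moreover have "{y \<in> C. peval y x \<noteq> 0} \<subseteq> aff V" using zclosed_subset_aff[OF cl(1)] by auto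
    ultimately show "p \<in> zclosure V {y \<in> C. peval y x \<noteq> 0}"
      using \<open>p \<in> C\<close> zclosed_subset_aff[OF cl(1)] by (auto simp: mem_zclosure_iff)
  qed
qed

lemma vid_ideal: "is_ideal V (vid V C)"
  unfolding is_ideal_def vid_def by (simp add: polyring_add polyring_mult subset_iff)

lemma vid_prime:
  fixes C :: "('v \<Rightarrow> 'a::field) set"
  assumes "firr V C"
  shows "is_prime_ideal V (vid V C)"
  unfolding is_prime_ideal_def
proof (intro conjI ballI impI vid_ideal)
  show "1 \<notin> vid V C" using assms by (simp add: vid_def firr_def ex_in_conv)
next
  fix f g assume fg: "f \<in> polyring V" "g \<in> polyring V" "f * g \<in> vid V C"
  then have "peval y f = 0 \<or> peval y g = 0" if "y \<in> C" for y
    using that by (simp add: vid_def)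
  then show "f \<in> vid V C \<or> g \<in> vid V C"
    using firrD[OF assms fg(1,2)] fg(1,2) by (simp add: vid_def)
qed

section \<open>Minimal primes and the Nullstellensatz\<close>

lemma ideal_subset: "is_ideal V I \<Longrightarrow> f \<in> I \<Longrightarrow> f \<in> polyring V"
  by (auto simp: is_ideal_def)

lemma ideal_0: "is_ideal V I \<Longrightarrow> 0 \<in> I"
  by (simp add: is_ideal_def)

lemma ideal_add: "is_ideal V I \<Longrightarrow> f \<in> I \<Longrightarrow> g \<in> I \<Longrightarrow> f + g \<in> I"
  by (simp add: is_ideal_def)

lemma ideal_mult: "is_ideal V I \<Longrightarrow> f \<in> I \<Longrightarrow> g \<in> polyring V \<Longrightarrow> g * f \<in> I"
  by (simp add: is_ideal_def)

lemma ideal_mult_right: "is_ideal V I \<Longrightarrow> f \<in> I \<Longrightarrow> g \<in> polyring V \<Longrightarrow> f * g \<in> I"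
  using ideal_mult[of V I f g] by (simp add: mult.commute)

lemma ideal_diff:
  assumes "is_ideal V I" "f \<in> I" "g \<in> I"
  shows "f - g \<in> I"
proof -
  have "(- 1) * g \<in> I"
    by (rule ideal_mult[OF assms(1,3)]) (rule polyring_uminus[OF polyring_1])
  then show ?thesis using ideal_add[OF assms(1,2), of "- g"] by simp
qed

lemma ideal_sum: "is_ideal V I \<Longrightarrow> (\<And>i. i \<in> A \<Longrightarrow> f i \<in> I) \<Longrightarrow> (\<Sum>i\<in>A. f i) \<in> I"
  by (induction A rule: infinite_finite_induct) (auto simp: ideal_0 ideal_add)

lemma prime_ideal: "is_prime_ideal V P \<Longrightarrow> is_ideal V P"
  by (simp add: is_prime_ideal_def)

lemma prime_mult:
  "is_prime_ideal V P \<Longrightarrow> f \<in> polyring V \<Longrightarrow> g \<in> polyring V \<Longrightarrow> f * g \<in> P \<Longrightarrow> f \<in> P \<or> g \<in> P"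
  by (simp add: is_prime_ideal_def)

lemma prime_power:
  assumes "is_prime_ideal V P" "f \<in> polyring V" "f ^ e \<in> P"
  shows "f \<in> P"
  using assms(3)
proof (induction e)
  case 0
  then show ?case using assms(1) by (simp add: is_prime_ideal_def)
next
  case (Suc e)
  then show ?case using prime_mult[OF assms(1,2) polyring_power[OF assms(2)], of e] by auto
qed

text \<open>The complement of a maximal multiplicative set disjoint from \<open>I\<close> is a minimal prime over \<open>I\<close>.\<close>
lemma minimal_prime_avoiding:
  assumes I: "is_ideal V I"
    and S: "S \<subseteq> polyring V" "1 \<in> S" "\<And>a b. a \<in> S \<Longrightarrow> b \<in> S \<Longrightarrow> a * b \<in> S" "S \<inter> I = {}"
  shows "\<exists>P. minimal_prime V I P \<and> P \<inter> S = {}"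
proof -
  define F where "F = {M. S \<subseteq> M \<and> M \<subseteq> polyring V \<and> (\<forall>a\<in>M. \<forall>b\<in>M. a * b \<in> M) \<and> M \<inter> I = {}}"
  have "\<exists>M\<in>F. \<forall>X\<in>F. M \<subseteq> X \<longrightarrow> X = M"
  proof (rule subset_Zorn_nonempty)
    have "S \<in> F" using S by (simp add: F_def)
    then show "F \<noteq> {}" by blast
  next
    fix C assume C: "C \<noteq> {}" "subset.chain F C"
    have CF: "M \<in> F" if "M \<in> C" for M
      using C(2) that by (auto simp: subset.chain_def)
    have tot: "M \<subseteq> N \<or> N \<subseteq> M" if "M \<in> C" "N \<in> C" for M N
      using C(2) that by (auto simp: subset.chain_def)
    have "a * b \<in> \<Union>C" if ab: "a \<in> \<Union>C" "b \<in> \<Union>C" for a b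
    proof -
      obtain M N where MN: "M \<in> C" "a \<in> M" "N \<in> C" "b \<in> N" using ab by blast
      obtain K where K: "K \<in> C" "a \<in> K" "b \<in> K" using tot[OF MN(1,3)] MN by blast
      then have "a * b \<in> K" using CF[OF K(1)] by (simp add: F_def)
      then show ?thesis using K(1) by blast
    qed
    moreover have "S \<subseteq> \<Union>C" using C(1) CF by (fastforce simp: F_def)
    moreover have "\<Union>C \<subseteq> polyring V" "\<Union>C \<inter> I = {}" using CF by (fastforce simp: F_def)+
    ultimately show "\<Union>C \<in> F" by (simp add: F_def)
  qed
  then obtain M where M: "M \<in> F" and max: "\<And>X. X \<in> F \<Longrightarrow> M \<subseteq> X \<Longrightarrow> X = M" by blast
  have MV: "a \<in> polyring V" if "a \<in> M" for a using M that by (auto simp: F_def)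
  have Mm: "a * b \<in> M" if "a \<in> M" "b \<in> M" for a b using M that by (simp add: F_def)
  have MS: "S \<subseteq> M" and MI: "M \<inter> I = {}" using M by (simp_all add: F_def)
  have M1: "1 \<in> M" using MS S(2) by blast
  have Mp: "a ^ e \<in> M" if "a \<in> M" for a and e :: nat
    by (induction e) (auto simp: M1 Mm that)
  \<comment> \<open>Adjoining the powers of \<open>f\<close> to the maximal \<open>M\<close> would
    give a larger multiplicative set, so it must meet \<open>I\<close>. This nilpotency of
    \<open>f\<close> after inverting \<open>M\<close> makes \<open>P\<close> closed under
    addition.\<close>
  have ann: "\<exists>s\<in>M. \<exists>e. s * f ^ e \<in> I" if f: "f \<in> polyring V" "f \<notin> M" for f
  proof (rule ccontr)
    assume neg: "\<not> ?thesis"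
    define M' where "M' = {s * f ^ e | s e. s \<in> M}"
    have in1: "s * f ^ e \<in> M'" if "s \<in> M" for s and e :: nat using that by (auto simp: M'_def)
    have "M \<subseteq> M'" using in1[of _ 0] by auto
    moreover have "M' \<subseteq> polyring V" using MV f(1) by (auto simp: M'_def)
    moreover have "M' \<inter> I = {}" using neg by (auto simp: M'_def)
    moreover have "a * b \<in> M'" if ab: "a \<in> M'" "b \<in> M'" for a b
    proof -
      obtain s d t e where "a = s * f ^ d" "b = t * f ^ e" "s \<in> M" "t \<in> M"
        using ab by (auto simp: M'_def)
      then have "a * b = (s * t) * f ^ (d + e)" "s * t \<in> M"
        by (simp_all add: power_add algebra_simps Mm)
      then show ?thesis using in1 by simp
    qed
    ultimately have "M' \<in> F" using MS by (auto simp: F_def)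
    then have "M' = M" using max \<open>M \<subseteq> M'\<close> by blast
    then show False using in1[OF M1, of 1] f(2) by simp
  qed
  define P where "P = polyring V - M"
  have PI: "f \<in> P \<Longrightarrow> f \<in> polyring V \<and> (\<exists>s\<in>M. \<exists>e. s * f ^ e \<in> I)" for f
    using ann by (simp add: P_def)
  have "f + g \<in> P" if fg: "f \<in> P" "g \<in> P" for f g
  proof -
    obtain s d t e where st: "s \<in> M" "s * f ^ d \<in> I" "t \<in> M" "t * g ^ e \<in> I"
      and V: "f \<in> polyring V" "g \<in> polyring V"
      using PI fg by blast
    have "(s * t) * (f + g) ^ (d + e) \<in> I"
      \<comment> \<open>Every term of the expansion contains \<open>f ^ d\<close> or
        \<open>g ^ e\<close>.\<close>
      unfolding binomial_ring sum_distrib_left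
    proof (rule ideal_sum[OF I])
      fix i assume "i \<in> {..d + e}"
      have cV: "of_nat (d + e choose i) \<in> polyring V"
        by (metis polyring_const single_of_nat)
      show "s * t * (of_nat (d + e choose i) * f ^ i * g ^ (d + e - i)) \<in> I"
      proof (cases "d \<le> i")
        case True
        have "(t * of_nat (d + e choose i) * f ^ (i - d) * g ^ (d + e - i)) * (s * f ^ d) \<in> I"
          by (rule ideal_mult[OF I st(2)]) (use V MV st cV in auto)
        moreover have "f ^ i = f ^ (i - d) * f ^ d" using True by (simp flip: power_add)
        ultimately show ?thesis by (simp add: algebra_simps)
      next
        case False
        have "(s * of_nat (d + e choose i) * f ^ i * g ^ (d - i)) * (t * g ^ e) \<in> I"
          by (rule ideal_mult[OF I st(4)]) (use V MV st cV in auto)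
        moreover have "g ^ (d + e - i) = g ^ (d - i) * g ^ e" using False by (simp flip: power_add)
        ultimately show ?thesis by (simp add: algebra_simps)
      qed
    qed
    then have "f + g \<notin> M" using Mm[OF Mm[OF st(1,3)] Mp] MI by blast
    then show ?thesis using V by (auto simp: P_def)
  qed
  moreover have "g * f \<in> P" if fg: "f \<in> P" "g \<in> polyring V" for f g
  proof -
    obtain s d where st: "s \<in> M" "s * f ^ d \<in> I" and V: "f \<in> polyring V"
      using PI fg by blast
    have "g ^ d * (s * f ^ d) \<in> I" using fg(2) by (intro ideal_mult[OF I st(2)]) auto
    then have "s * (g * f) ^ d \<in> I" by (simp add: power_mult_distrib algebra_simps)
    then have "g * f \<notin> M" using Mm[OF st(1) Mp] MI by blast
    then show ?thesis using V fg(2) by (auto simp: P_def)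
  qed
  moreover have "0 \<in> P" using MI ideal_0[OF I] by (auto simp: P_def)
  ultimately have "is_ideal V P" by (simp add: is_ideal_def) (simp add: P_def)
  then have prime: "is_prime_ideal V P"
    using M1 Mm by (auto simp: is_prime_ideal_def P_def)
  have IP: "I \<subseteq> P" using MI ideal_subset[OF I] by (auto simp: P_def)
  have "\<not> Q \<subset> P" if Q: "is_prime_ideal V Q" "I \<subseteq> Q" for Q
  proof
    \<comment> \<open>A prime properly inside \<open>P\<close> would have as complement a larger
      multiplicative set, against maximality.\<close>
    assume QP: "Q \<subset> P"
    have QV: "Q \<subseteq> polyring V" using Q(1) by (simp add: is_prime_ideal_def is_ideal_def)
    have MQ: "M \<subseteq> polyring V - Q" using QP MV by (auto simp: P_def)
    have "a * b \<in> polyring V - Q" if "a \<in> polyring V - Q" "b \<in> polyring V - Q" for a b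
      using that prime_mult[OF Q(1), of a b] by blast
    then have "polyring V - Q \<in> F"
      using MQ MS Q by (auto simp: F_def)
    then have "polyring V - Q = M" using max MQ by blast
    then show False using QP QV by (auto simp: P_def)
  qed
  then have "minimal_prime V I P" using prime IP by (auto simp: minimal_prime_def)
  moreover have "P \<inter> S = {}" using MS by (auto simp: P_def)
  ultimately show ?thesis by blast
qed

section \<open>The Nullstellensatz for prime ideals\<close>

lemma alg_closed_dvd_power:
  fixes h f :: "'a::field poly"
  assumes F: "alg_closed TYPE('a)"
  shows "h \<noteq> 0 \<Longrightarrow> (\<And>c. poly h c = 0 \<Longrightarrow> poly f c = 0) \<Longrightarrow> h dvd f ^ degree h"
proof (induction "degree h" arbitrary: h)
  case 0
  then show ?case by (metis degree_eq_zeroE is_unit_const_poly_iff one_neq_zero pCons_0_0 dvd_field_iff unit_imp_dvd)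
next
  case (Suc d)
  then obtain c where c: "poly h c = 0"
    using F unfolding alg_closed_def by (metis One_nat_def Suc_le_mono le0)
  \<comment> \<open>Each root of \<open>h\<close> is a root of \<open>f\<close>, so a linear factor
    is split off both; the exponent \<open>degree h\<close> allows for multiplicities.\<close>
  then obtain h1 where h1: "h = [:- c, 1:] * h1"
    unfolding poly_eq_0_iff_dvd by (rule dvdE)
  obtain f1 where f1: "f = [:- c, 1:] * f1"
    using Suc.prems(2)[OF c] unfolding poly_eq_0_iff_dvd by (rule dvdE)
  have h10: "h1 \<noteq> 0" using Suc.prems(1) h1 by auto
  then have "degree h = Suc (degree h1)" unfolding h1 by (subst degree_mult_eq) auto
  then have d: "d = degree h1" using Suc.hyps(2) by simp
  have "h1 dvd f ^ degree h1"
    by (rule Suc.hyps(1)[OF d h10]) (use Suc.prems(2) h1 in auto)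
  then have "[:- c, 1:] * h1 dvd f * f ^ degree h1"
    using f1 by (intro mult_dvd_mono) (metis dvd_triv_left)+
  then show ?case using \<open>degree h = Suc (degree h1)\<close> h1 by simp
qed

text \<open>Long division over coefficients without inverses: each step multiplies \<open>u\<close>
  by the leading coefficient of \<open>h\<close>, so that the top terms cancel and the coefficients
  stay in \<open>polyring V\<close>.\<close>

lemma pseudo_division:
  fixes h :: "('v, 'a::comm_ring_1) mpoly poly"
  assumes h: "\<And>i. coeff h i \<in> polyring V" and d: "degree h \<ge> 1"
  shows "(\<And>i. coeff u i \<in> polyring V) \<Longrightarrow>
    \<exists>N q r. (\<forall>i. coeff q i \<in> polyring V) \<and> (\<forall>i. coeff r i \<in> polyring V) \<and>
      Polynomial.smult (lead_coeff h ^ N) u = q * h + r \<and> degree r < degree h"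
proof (induction "degree u" arbitrary: u rule: less_induct)
  case less
  show ?case
  proof (cases "degree u < degree h")
    case True
    then show ?thesis using less.prems
      by (intro exI[of _ 0] exI[of _ 0] exI[of _ u]) auto
  next
    case False
    define e where "e = degree u - degree h"
    define m where "m = Polynomial.monom (lead_coeff u) e"
    define u' where "u' = Polynomial.smult (lead_coeff h) u - m * h"
    have mV: "coeff m i \<in> polyring V" for i using less.prems by (simp add: m_def)
    have u'V: "coeff u' i \<in> polyring V" for i
      unfolding u'_def coeff_diff coeff_smult
      by (intro polyring_diff polyring_mult coeff_polyring_mult h mV less.prems)
    have eu: "e + degree h = degree u" using False by (simp add: e_def)
    have "degree u' \<le> degree u"
      unfolding u'_def
    proof (rule degree_diff_le)
      show "degree (Polynomial.smult (lead_coeff h) u) \<le> degree u" by (rule degree_smult_le)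
      have "degree (m * h) \<le> degree m + degree h" by (rule degree_mult_le)
      also have "\<dots> \<le> e + degree h" by (simp add: m_def degree_monom_le)
      finally show "degree (m * h) \<le> degree u" using eu by simp
    qed
    moreover have "coeff u' (degree u) = 0"
      using coeff_monom_mult[of "lead_coeff u" e h "degree u"] eu
      by (simp add: u'_def m_def e_def)
    ultimately have deg: "degree u' < degree u"
    proof -
      have "degree u' \<noteq> degree u"
      proof
        assume eq: "degree u' = degree u"
        then have "lead_coeff u' = 0" using \<open>coeff u' (degree u) = 0\<close> by simp
        then have "u' = 0" by (simp only: leading_coeff_0_iff)
        then show False using eq False d by simp
      qed
      then show ?thesis using \<open>degree u' \<le> degree u\<close> by simp
    qed
    obtain N q r where qr: "\<forall>i. coeff q i \<in> polyring V" "\<forall>i. coeff r i \<in> polyring V"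
      "Polynomial.smult (lead_coeff h ^ N) u' = q * h + r" "degree r < degree h"
      using less.hyps[OF deg u'V] by blast
    have "Polynomial.smult (lead_coeff h ^ Suc N) u = Polynomial.smult (lead_coeff h ^ N) (u' + m * h)"
      by (simp add: u'_def mult.commute)
    also have "\<dots> = (q + Polynomial.smult (lead_coeff h ^ N) m) * h + r"
      using qr(3) by (simp add: smult_add_right distrib_right)
    finally have "Polynomial.smult (lead_coeff h ^ Suc N) u = (q + Polynomial.smult (lead_coeff h ^ N) m) * h + r" .
    moreover have "coeff (q + Polynomial.smult (lead_coeff h ^ N) m) i \<in> polyring V" for i
      unfolding coeff_add coeff_smult
      by (intro polyring_add polyring_mult polyring_power h mV) (use qr(1) in blast)
    ultimately show ?thesis using qr(2,4) by blast
  qed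
qed

abbreviation evp :: "('v \<Rightarrow> 'a::comm_ring_1) \<Rightarrow> ('v, 'a) mpoly poly \<Rightarrow> 'a poly" where
  "evp p \<equiv> map_poly (peval p)"

lemma evp_add: "evp p (a + b) = evp p a + evp p b"
  by (rule poly_eqI) (simp add: coeff_map_poly)

lemma evp_mult: "evp p (a * b) = evp p a * evp p b"
  by (rule poly_eqI) (simp add: coeff_map_poly coeff_mult)

lemma evp_smult: "evp p (Polynomial.smult c b) = Polynomial.smult (peval p c) (evp p b)"
  by (rule poly_eqI) (simp add: coeff_map_poly)

lemma evp_power: "evp p (a ^ e) = evp p a ^ e"
  by (induction e) (simp_all add: evp_mult map_poly_1)

lemma peval_fun_upd_poly:
  assumes "\<And>i. coeff q i \<in> polyring V" "v \<notin> V"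
  shows "peval (p(v := c)) (poly q (mvar v)) = poly (evp p q) c"
proof -
  have "evp (p(v := c)) q = evp p q"
  proof (rule poly_eqI)
    fix i
    have "peval (p(v := c)) (coeff q i) = peval p (coeff q i)"
      by (rule peval_cong[OF assms(1)]) (use assms(2) in auto)
    then show "coeff (evp (p(v := c)) q) i = coeff (evp p q) i"
      by (simp add: coeff_map_poly)
  qed
  then show ?thesis by (simp add: peval_poly)
qed

text \<open>If \<open>P\<close> involves the new variable, take \<open>h\<close> in \<open>P\<close> of least degree in it whose leading coefficient is
  not in \<open>P\<close>. By pseudo-division every root of \<open>h\<close> over a point with nonzero leading coefficient is a
  zero of \<open>P\<close>. If \<open>f\<close> vanished at all these roots, \<open>h\<close> would divide \<open>f ^ degree h\<close>, contradicting the
  nonzero remainder of that power.\<close>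
lemma prime_extension_point:
  fixes P :: "('v, 'a::field) mpoly set"
  assumes F: "alg_closed TYPE('a)" and v: "v \<notin> V"
    and P: "is_prime_ideal (insert v V) P"
    and f: "f \<in> polyring (insert v V)" "f \<notin> P"
  shows "\<exists>g\<in>polyring V. g \<notin> P \<and> (\<forall>p. (\<forall>u\<in>P \<inter> polyring V. peval p u = 0) \<longrightarrow> peval p g \<noteq> 0 \<longrightarrow>
    (\<exists>c. (\<forall>u\<in>P. peval (p(v := c)) u = 0) \<and> peval (p(v := c)) f \<noteq> 0))"
proof -
  let ?W = "insert v V"
  let ?R = "\<lambda>q. \<forall>i. coeff q i \<in> polyring V"
  let ?x = "mvar v :: ('v, 'a) mpoly"
  have inf: "infinite (UNIV :: 'a set)" by (rule infinite_UNIV_alg_closed[OF F])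
  have Pi: "is_ideal ?W P" by (rule prime_ideal[OF P])
  have VW: "u \<in> polyring ?W" if "u \<in> polyring V" for u :: "('v, 'a) mpoly"
    using polyring_mono[of V ?W] that by blast
  have xW: "?x \<in> polyring ?W" by auto
  have RW: "poly q ?x \<in> polyring ?W" if "?R q" for q
    using that VW by (intro polyring_poly xW) auto
  have allP: "poly q ?x \<in> P" if "\<And>i. coeff q i \<in> P" for q
    unfolding poly_altdef by (intro ideal_sum[OF Pi] ideal_mult_right[OF Pi that]) auto
  have decomp: "\<exists>q. ?R q \<and> u = poly q ?x" if "u \<in> polyring ?W" for u
    using polyring_insert_decomp[OF that] .
  obtain qf where qf: "?R qf" "f = poly qf ?x" using decomp[OF f(1)] by blast
  have ev: "peval (p(v := c)) (poly q ?x) = poly (evp p q) c" if "?R q" for p c q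
    using peval_fun_upd_poly[OF _ v] that by blast
  \<comment> \<open>Polynomials whose value lies in \<open>P\<close> although not all coefficients
    do: the genuine relations for \<open>v\<close> modulo the contracted prime.\<close>
  define B where "B q \<longleftrightarrow> ?R q \<and> poly q ?x \<in> P \<and> (\<exists>i. coeff q i \<notin> P)" for q
  show ?thesis
  proof (cases "\<exists>q. B q")
    \<comment> \<open>Elements of \<open>P\<close> then have all coefficients in \<open>P\<close>,
      so every value of \<open>v\<close> gives a zero of \<open>P\<close>; only the roots of
      \<open>qf\<close> have to be avoided.\<close>
    case False
    obtain i where i: "coeff qf i \<notin> P" using allP[of qf] f(2) qf(2) by blast
    show ?thesis
    proof (intro bexI[of _ "coeff qf i"] conjI allI impI i)
      show "coeff qf i \<in> polyring V" using qf(1) by blast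
      fix p assume p: "\<forall>u\<in>P \<inter> polyring V. peval p u = 0" "peval p (coeff qf i) \<noteq> 0"
      have "evp p qf \<noteq> 0" using p(2) by (metis coeff_0 coeff_map_poly peval_0)
      then obtain c where c: "poly (evp p qf) c \<noteq> 0"
        using poly_nonzero_value[OF inf] by blast
      have "peval (p(v := c)) u = 0" if u: "u \<in> P" for u
      proof -
        obtain q where q: "?R q" "u = poly q ?x" using decomp[OF ideal_subset[OF Pi u]] by blast
        have "coeff q i \<in> P \<inter> polyring V" for i using False q u by (auto simp: B_def)
        then have "evp p q = 0" using p(1) by (intro poly_eqI) (simp add: coeff_map_poly)
        then show ?thesis using ev[OF q(1)] q(2) by simp
      qed
      moreover have "peval (p(v := c)) f \<noteq> 0" using c ev[OF qf(1)] qf(2) by simp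
      ultimately show "\<exists>c. (\<forall>u\<in>P. peval (p(v := c)) u = 0) \<and> peval (p(v := c)) f \<noteq> 0" by blast
    qed
  next
    case True
    then obtain h where h: "B h" and hmin: "\<And>q. B q \<Longrightarrow> degree h \<le> degree q"
      using ex_has_least_nat[of B _ degree] by blast
    define a where "a = lead_coeff h"
    define d where "d = degree h"
    have hR: "\<And>i. coeff h i \<in> polyring V" and hP: "poly h ?x \<in> P" using h by (auto simp: B_def)
    have aV: "a \<in> polyring V" by (simp add: a_def hR)
    have d1: "degree h \<noteq> 0"
    proof
      assume "degree h = 0"
      then obtain b where b: "h = [:b:]" by (rule degree_eq_zeroE)
      then have "b \<in> P" using hP by simp
      then have "coeff h i \<in> P" for i using b ideal_0[OF Pi] by (simp add: coeff_pCons split: nat.split)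
      then show False using h by (auto simp: B_def)
    qed
    have aP: "a \<notin> P"
    proof
      \<comment> \<open>Removing the leading term would leave a relation in \<open>B\<close> of
        smaller degree.\<close>
      assume aP: "a \<in> P"
      define h' where "h' = h - Polynomial.monom a (degree h)"
      have "degree h' \<le> degree h" unfolding h'_def
        by (intro degree_diff_le) (auto simp: degree_monom_le)
      moreover have c0: "coeff h' (degree h) = 0" by (simp add: h'_def a_def)
      ultimately have "degree h' < degree h"
        using d1 by (metis degree_0 leading_coeff_0_iff le_neq_implies_less)
      moreover have "B h'"
        unfolding B_def
      proof (intro conjI allI)
        show "coeff h' i \<in> polyring V" for i using hR aV by (auto simp: h'_def)
        have "?x ^ degree h * a \<in> P" using xW by (intro ideal_mult[OF Pi aP]) auto
        then show "poly h' ?x \<in> P" using ideal_diff[OF Pi hP] by (simp add: h'_def poly_monom mult.commute)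
        obtain i where "coeff h i \<notin> P" using h by (auto simp: B_def)
        moreover have "i \<noteq> degree h" using calculation aP by (auto simp: a_def)
        ultimately show "\<exists>i. coeff h' i \<notin> P" by (intro exI[of _ i]) (simp add: h'_def)
      qed
      ultimately show False using hmin[of h'] by simp
    qed
    have low: "coeff r i \<in> P" if "?R r" "poly r ?x \<in> P" "degree r < degree h" for r i
      using hmin[of r] that by (auto simp: B_def)
    have div: "\<exists>N q r. ?R q \<and> ?R r \<and> Polynomial.smult (a ^ N) u = q * h + r \<and> degree r < degree h"
      if "?R u" for u
      unfolding a_def by (rule pseudo_division) (use hR d1 that in auto)
    have qfd: "?R (qf ^ d)"
    proof (induction d)
      case (Suc d)
      then show ?case using qf(1) coeff_polyring_mult[of qf V "qf ^ d"] by simp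
    qed (simp add: coeff_1)
    obtain N q r where fdiv: "?R q" "?R r" "Polynomial.smult (a ^ N) (qf ^ d) = q * h + r" "degree r < degree h"
      using div[OF qfd] by blast
    have "poly r ?x \<notin> P"
    proof
      assume rP: "poly r ?x \<in> P"
      have "poly (Polynomial.smult (a ^ N) (qf ^ d)) ?x = poly (q * h + r) ?x" using fdiv(3) by simp
      then have "a ^ N * f ^ d = poly q ?x * poly h ?x + poly r ?x"
        by (simp add: qf(2) poly_power)
      then have "a ^ N * f ^ d \<in> P"
        using ideal_add[OF Pi ideal_mult[OF Pi hP RW[OF fdiv(1)]] rP] by simp
      then have "a ^ N \<in> P \<or> f ^ d \<in> P"
        using VW[OF aV] f(1) by (intro prime_mult[OF P]) auto
      then show False using prime_power[OF P VW[OF aV]] prime_power[OF P f(1)] aP f(2) by blast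
    qed
    then obtain i where i: "coeff r i \<notin> P" using allP by blast
    define b where "b = coeff r i"
    have bV: "b \<in> polyring V" using fdiv(2) by (simp add: b_def)
    show ?thesis
    \<comment> \<open>The factor \<open>a\<close> preserves the degree of \<open>h\<close> under
      evaluation at \<open>p\<close>, and \<open>b\<close> keeps the remainder nonzero.\<close>
    proof (intro bexI[of _ "a * b"] conjI allI impI)
      show "a * b \<in> polyring V" using aV bV by auto
      show "a * b \<notin> P" using prime_mult[OF P VW[OF aV] VW[OF bV]] aP i by (auto simp: b_def)
      fix p assume p: "\<forall>u\<in>P \<inter> polyring V. peval p u = 0" "peval p (a * b) \<noteq> 0"
      have ap: "peval p a \<noteq> 0" and bp: "peval p b \<noteq> 0" using p(2) by auto
      have deg: "degree (evp p h) = degree h"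
        using ap by (intro map_poly_degree_eq) (simp add: a_def)
      have h0: "evp p h \<noteq> 0" using deg d1 by auto
      have root: "peval (p(v := c)) u = 0" if c: "poly (evp p h) c = 0" and u: "u \<in> P" for c u
      proof -
        obtain qu where qu: "?R qu" "u = poly qu ?x" using decomp[OF ideal_subset[OF Pi u]] by blast
        obtain N q r where ud: "?R q" "?R r" "Polynomial.smult (a ^ N) qu = q * h + r" "degree r < degree h"
          using div[OF qu(1)] by blast
        have "poly (Polynomial.smult (a ^ N) qu) ?x = poly (q * h + r) ?x" using ud(3) by simp
        then have "poly r ?x = a ^ N * u - poly q ?x * poly h ?x" by (simp add: qu(2))
        moreover have "a ^ N \<in> polyring ?W" using VW[OF aV] by auto
        ultimately have "poly r ?x \<in> P"
          using ideal_diff[OF Pi ideal_mult[OF Pi u] ideal_mult[OF Pi hP RW[OF ud(1)]]] by simp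
        then have "coeff r i \<in> P \<inter> polyring V" for i using low[OF ud(2) _ ud(4)] ud(2) by blast
        then have r0: "evp p r = 0" using p(1) by (intro poly_eqI) (simp add: coeff_map_poly)
        have "poly (evp p (Polynomial.smult (a ^ N) qu)) c = poly (evp p (q * h + r)) c" using ud(3) by simp
        then have "peval p a ^ N * poly (evp p qu) c = 0"
          using c r0 by (simp add: evp_smult evp_add evp_mult)
        then show ?thesis using ap ev[OF qu(1)] qu(2) by simp
      qed
      show "\<exists>c. (\<forall>u\<in>P. peval (p(v := c)) u = 0) \<and> peval (p(v := c)) f \<noteq> 0"
      proof (rule ccontr)
        assume neg: "\<not> ?thesis"
        have "poly (evp p qf) c = 0" if "poly (evp p h) c = 0" for c
        proof -
          have "peval (p(v := c)) f = 0" using neg root[OF that] by blast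
          then show ?thesis using ev[OF qf(1)] qf(2) by simp
        qed
        then have dvd: "evp p h dvd evp p qf ^ d"
          using alg_closed_dvd_power[OF F h0] deg by (simp add: d_def)
        have "evp p (Polynomial.smult (a ^ N) (qf ^ d)) = evp p (q * h + r)" using fdiv(3) by simp
        then have "evp p r = Polynomial.smult (peval p a ^ N) (evp p qf ^ d) - evp p q * evp p h"
          by (simp add: evp_smult evp_add evp_mult evp_power)
        then have "evp p h dvd evp p r" using dvd by (simp add: dvd_smult)
        moreover have "evp p r \<noteq> 0" using bp by (metis b_def coeff_0 coeff_map_poly peval_0)
        ultimately have "degree (evp p h) \<le> degree (evp p r)" by (rule dvd_imp_degree_le)
        also have "\<dots> \<le> degree r" by (rule degree_le) (simp add: coeff_map_poly coeff_eq_0)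
        finally show False using fdiv(4) deg by simp
      qed
    qed
  qed
qed

text \<open>Induction on the variables through the contraction of \<open>P\<close>: the polynomial
  \<open>g\<close> from the extension step marks the points of the contracted zero set over which a
  suitable value of \<open>v\<close> exists.\<close>

theorem nullstellensatz_prime:
  fixes P :: "('v, 'a::field) mpoly set"
  assumes F: "alg_closed TYPE('a)" and "finite V" "is_prime_ideal V P" "f \<in> polyring V" "f \<notin> P"
  shows "\<exists>p\<in>zeros V P. peval p f \<noteq> 0"
  using assms(2-)
proof (induction V arbitrary: P f)
  case empty
  have Pi: "is_ideal {} P" by (rule prime_ideal[OF empty(1)])
  have u0: "u = 0" if u: "u \<in> P" for u
  proof (rule ccontr)
    assume "u \<noteq> 0"
    obtain c where c: "u = mconst c" using polyring_empty[OF ideal_subset[OF Pi u]] by blast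
    then have "c \<noteq> 0" using \<open>u \<noteq> 0\<close> by auto
    have "mconst (inverse c) * u \<in> P" by (rule ideal_mult[OF Pi u]) simp
    then have "1 \<in> P" using c \<open>c \<noteq> 0\<close> by (simp add: mult_single)
    then show False using empty(1) by (simp add: is_prime_ideal_def)
  qed
  obtain c where c: "f = mconst c" using polyring_empty[OF empty(2)] by blast
  have "c \<noteq> 0" using empty(3) ideal_0[OF Pi] c by auto
  then have "peval (\<lambda>_. 0) f \<noteq> 0" using c by simp
  moreover have "(\<lambda>_. 0) \<in> zeros {} P"
    unfolding zeros_def aff_def using u0 peval_0 by blast
  ultimately show ?case by blast
next
  case (insert v V)
  let ?P0 = "P \<inter> polyring V"
  obtain g where g: "g \<in> polyring V" "g \<notin> P"
    and ext: "\<And>p. (\<forall>u\<in>?P0. peval p u = 0) \<Longrightarrow> peval p g \<noteq> 0 \<Longrightarrow>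
      \<exists>c. (\<forall>u\<in>P. peval (p(v := c)) u = 0) \<and> peval (p(v := c)) f \<noteq> 0"
    using prime_extension_point[OF F insert.hyps(2) insert.prems] by blast
  have VW: "polyring V \<subseteq> polyring (insert v V)" using polyring_mono[of V "insert v V"] by blast
  note Pp = insert.prems(1)
  have Pi: "is_ideal (insert v V) P" by (rule prime_ideal[OF Pp])
  have "is_ideal V ?P0"
    unfolding is_ideal_def
  proof (intro conjI ballI)
    fix f g :: "('v, 'a) mpoly" assume "f \<in> ?P0" "g \<in> polyring V"
    then show "g * f \<in> ?P0" using ideal_mult[OF Pi, of f g] VW by auto
  qed (use ideal_0[OF Pi] ideal_add[OF Pi] in auto)
  moreover have "1 \<notin> ?P0" using Pp by (simp add: is_prime_ideal_def)
  moreover have "f \<in> ?P0 \<or> g \<in> ?P0"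
    if "f \<in> polyring V" "g \<in> polyring V" "f * g \<in> ?P0" for f g
    using prime_mult[OF Pp, of f g] that VW by blast
  ultimately have "is_prime_ideal V ?P0"
    by (simp add: is_prime_ideal_def)
  then obtain p where p: "p \<in> zeros V ?P0" "peval p g \<noteq> 0"
    using insert.IH g by blast
  then obtain c where c: "\<forall>u\<in>P. peval (p(v := c)) u = 0" "peval (p(v := c)) f \<noteq> 0"
    using ext[of p] by (auto simp: zeros_def)
  have "p(v := c) \<in> aff (insert v V)" using p(1) by (auto simp: zeros_def aff_def)
  then show ?case using c by (auto simp: zeros_def)
qed

lemma is_ideal_ideal_gen:
  assumes "G \<subseteq> polyring V"
  shows "is_ideal V (ideal_gen V G)"
proof -
  have "is_ideal V (polyring V :: ('a, 'b) mpoly set)"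
    by (simp add: is_ideal_def polyring_add polyring_mult)
  then have sub: "ideal_gen V G \<subseteq> polyring V" using assms by (auto simp: ideal_gen_def)
  show ?thesis
    unfolding is_ideal_def
  proof (intro conjI ballI sub)
    show "0 \<in> ideal_gen V G" by (auto simp: ideal_gen_def ideal_0)
    show "f + g \<in> ideal_gen V G" if "f \<in> ideal_gen V G" "g \<in> ideal_gen V G" for f g
      using that ideal_add unfolding ideal_gen_def by blast
    show "g * f \<in> ideal_gen V G" if "f \<in> ideal_gen V G" "g \<in> polyring V" for f g
      using that ideal_mult unfolding ideal_gen_def by blast
  qed
qed

lemma zeros_ideal_gen:
  assumes "G \<subseteq> polyring V"
  shows "zeros V (ideal_gen V G) = zeros V G"
proof
  have "G \<subseteq> ideal_gen V G" by (auto simp: ideal_gen_def)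
  then show "zeros V (ideal_gen V G) \<subseteq> zeros V G" by (auto simp: zeros_def)
  show "zeros V G \<subseteq> zeros V (ideal_gen V G)"
  proof
    fix p assume p: "p \<in> zeros V G"
    then have "G \<subseteq> vid V {p}" using assms by (auto simp: vid_def zeros_def)
    then have "ideal_gen V G \<subseteq> vid V {p}" using vid_ideal[of V "{p}"] by (auto simp: ideal_gen_def)
    then show "p \<in> zeros V (ideal_gen V G)" using p by (auto simp: vid_def zeros_def)
  qed
qed

section \<open>Irreducible components and minimal primes\<close>

lemma minimal_primeD:
  assumes "minimal_prime V I P"
  shows "is_prime_ideal V P" "I \<subseteq> P" "is_prime_ideal V Q \<Longrightarrow> I \<subseteq> Q \<Longrightarrow> Q \<subseteq> P \<Longrightarrow> Q = P"
  using assms by (auto simp: minimal_prime_def)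

lemma zeros_mono: "S \<subseteq> T \<Longrightarrow> zeros V T \<subseteq> zeros V S"
  by (auto simp: zeros_def)

text \<open>The polynomials not vanishing at \<open>p\<close> form a multiplicative set disjoint
  from \<open>I\<close>; a minimal prime avoiding it consists of functions vanishing at
  \<open>p\<close>.\<close>

lemma zeros_covered_by_minimal_primes:
  fixes I :: "('v, 'a::field) mpoly set"
  assumes I: "is_ideal V I" and p: "p \<in> zeros V I"
  shows "\<exists>P. minimal_prime V I P \<and> p \<in> zeros V P"
proof -
  have "\<exists>P. minimal_prime V I P \<and> P \<inter> {f \<in> polyring V. peval p f \<noteq> 0} = {}"
    by (rule minimal_prime_avoiding[OF I]) (use p in \<open>auto simp: zeros_def\<close>)
  then obtain P where P: "minimal_prime V I P" "P \<inter> {f \<in> polyring V. peval p f \<noteq> 0} = {}" by blast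
  have "P \<subseteq> polyring V" using ideal_subset[OF prime_ideal[OF minimal_primeD(1)[OF P(1)]]] by blast
  then have "p \<in> zeros V P" using P(2) p by (auto simp: zeros_def)
  then show ?thesis using P(1) by blast
qed

lemma vid_zeros_prime:
  fixes P :: "('v, 'a::field) mpoly set"
  assumes "alg_closed TYPE('a)" "finite V" "is_prime_ideal V P"
  shows "vid V (zeros V P) = P"
proof
  show "vid V (zeros V P) \<subseteq> P"
    using nullstellensatz_prime[OF assms] by (fastforce simp: vid_def)
  show "P \<subseteq> vid V (zeros V P)"
    using ideal_subset[OF prime_ideal[OF assms(3)]] by (auto simp: vid_def zeros_def)
qed

lemma zirred_zeros_prime:
  fixes P :: "('v, 'a::field) mpoly set"
  assumes "alg_closed TYPE('a)" "finite V" "is_prime_ideal V P"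
  shows "zirred V (zeros V P)"
proof -
  have PV: "P \<subseteq> polyring V" using ideal_subset[OF prime_ideal[OF assms(3)]] by blast
  have vid: "f \<in> P" if "f \<in> polyring V" "\<forall>y\<in>zeros V P. peval y f = 0" for f
  proof -
    have "f \<in> vid V (zeros V P)" using that by (simp add: vid_def)
    then show ?thesis by (simp only: vid_zeros_prime[OF assms])
  qed
  have P0: "peval y f = 0" if "f \<in> P" "y \<in> zeros V P" for f y using that by (simp add: zeros_def)
  have "firr V (zeros V P)"
    unfolding firr_def
  proof (intro conjI ballI impI)
    have "1 \<notin> P" using assms(3) by (simp add: is_prime_ideal_def)
    then show "zeros V P \<noteq> {}" using vid[of 1] by auto
    fix f g :: "('v, 'a) mpoly"
    assume fg: "f \<in> polyring V" "g \<in> polyring V" "\<forall>y\<in>zeros V P. peval y f * peval y g = 0"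
    then have "f * g \<in> P" by (intro vid) auto
    then show "(\<forall>y\<in>zeros V P. peval y f = 0) \<or> (\<forall>y\<in>zeros V P. peval y g = 0)"
      using prime_mult[OF assms(3) fg(1,2)] P0 by blast
  qed
  then show ?thesis using zclosed_zeros[OF PV] by (simp add: zirred_iff)
qed

text \<open>Avoiding the products of \<open>G\<close> with powers of \<open>x\<close> amounts to
  finding a minimal prime after inverting \<open>x\<close>. The uses take for \<open>G\<close> the
  functions not vanishing at a point, or the complement of a prime.\<close>

lemma basic_open_mult_set:
  fixes I :: "('v, 'a::field) mpoly set"
  assumes I: "is_ideal V I" and x: "x \<in> polyring V"
    and G: "G \<subseteq> polyring V" "1 \<in> G" "\<And>a b. a \<in> G \<Longrightarrow> b \<in> G \<Longrightarrow> a * b \<in> G"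
    and disj: "\<And>g e. g \<in> G \<Longrightarrow> g * x ^ e \<in> I \<Longrightarrow> False"
  shows "\<exists>P. minimal_prime V I P \<and> x \<notin> P \<and> P \<inter> G = {}"
proof -
  define S where "S = {g * x ^ e | g e. g \<in> G}"
  have S: "g * x ^ e \<in> S" if "g \<in> G" for g and e :: nat using that by (auto simp: S_def)
  have "\<exists>P. minimal_prime V I P \<and> P \<inter> S = {}"
  proof (rule minimal_prime_avoiding[OF I])
    show "S \<subseteq> polyring V" using x G(1) by (auto simp: S_def)
    show "1 \<in> S" using S[OF G(2), of 0] by simp
    show "S \<inter> I = {}" using disj by (auto simp: S_def)
    fix a b assume "a \<in> S" "b \<in> S"
    then obtain g d h e where "a = g * x ^ d" "b = h * x ^ e" "g \<in> G" "h \<in> G" by (auto simp: S_def)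
    then have "a * b = (g * h) * x ^ (d + e)" "g * h \<in> G" by (simp_all add: power_add mult_ac G(3))
    then show "a * b \<in> S" using S by simp
  qed
  moreover have "x \<in> S" using S[OF G(2), of 1] by simp
  moreover have "G \<subseteq> S" using S[of _ 0] by auto
  ultimately show ?thesis by blast
qed

text \<open>If \<open>g * x ^ e\<close> lies in \<open>I\<close> then \<open>g\<close> vanishes on
  the open set, hence on its closure; so some minimal prime omits \<open>x\<close> and every
  function nonzero at \<open>p\<close>. Conversely, the Nullstellensatz for \<open>P\<close> allows
  the factor \<open>x\<close> to be removed.\<close>

lemma mem_zclosure_basic_open_iff:
  fixes I :: "('v, 'a::field) mpoly set"
  assumes F: "alg_closed TYPE('a)" "finite V" and I: "is_ideal V I" and x: "x \<in> polyring V"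
  shows "p \<in> zclosure V {q \<in> zeros V I. peval q x \<noteq> 0} \<longleftrightarrow>
    (\<exists>P. minimal_prime V I P \<and> x \<notin> P \<and> p \<in> zeros V P)" (is "_ \<in> zclosure V ?Y \<longleftrightarrow> _")
proof
  have Y: "?Y \<subseteq> aff V" by (auto simp: zeros_def)
  {
    assume p: "p \<in> zclosure V ?Y"
    have "\<exists>P. minimal_prime V I P \<and> x \<notin> P \<and> P \<inter> {g \<in> polyring V. peval p g \<noteq> 0} = {}"
    proof (rule basic_open_mult_set[OF I x])
      fix g e assume g: "g \<in> {g \<in> polyring V. peval p g \<noteq> 0}" "g * x ^ e \<in> I"
      then have "\<forall>q\<in>?Y. peval q g = 0" by (auto simp: zeros_def)
      then show False using zclosure_vanish[OF Y _ _ p] g by blast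
    qed auto
    then obtain P where P: "minimal_prime V I P" "x \<notin> P"
      "P \<inter> {g \<in> polyring V. peval p g \<noteq> 0} = {}" by blast
    moreover have "P \<subseteq> polyring V"
      using ideal_subset[OF prime_ideal[OF minimal_primeD(1)[OF P(1)]]] by blast
    moreover have "p \<in> aff V" using p Y zclosure_subset_aff by blast
    ultimately show "\<exists>P. minimal_prime V I P \<and> x \<notin> P \<and> p \<in> zeros V P"
      by (intro exI[of _ P]) (auto simp: zeros_def)
  next
    assume "\<exists>P. minimal_prime V I P \<and> x \<notin> P \<and> p \<in> zeros V P"
    then obtain P where P: "minimal_prime V I P" "x \<notin> P" "p \<in> zeros V P" by blast
    note prime = minimal_primeD(1)[OF P(1)]
    have sub: "zeros V P \<subseteq> zeros V I" by (rule zeros_mono[OF minimal_primeD(2)[OF P(1)]])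
    have "peval p f = 0" if f: "f \<in> polyring V" "\<forall>q\<in>?Y. peval q f = 0" for f
    proof -
      have "\<forall>q\<in>zeros V P. peval q (f * x) = 0" using f(2) sub by auto
      then have "f * x \<in> vid V (zeros V P)" using f(1) x by (auto simp: vid_def)
      then have "f * x \<in> P" using vid_zeros_prime[OF F prime] by simp
      then have "f \<in> P" using prime_mult[OF prime f(1) x] P(2) by blast
      then show ?thesis using P(3) by (simp add: zeros_def)
    qed
    moreover have "p \<in> aff V" using P(3) by (simp add: zeros_def)
    ultimately show "p \<in> zclosure V ?Y" using mem_zclosure_iff[OF Y] by blast
  }
qed

text \<open>An irreducible set in \<open>Y\<close> containing \<open>zeros V P\<close> has a
  vanishing ideal that is prime and lies between \<open>I\<close> and \<open>P\<close>. Admitting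
  any intermediate \<open>Y\<close> gives components of the whole jet variety and of its two parts
  alike.\<close>

lemma irr_comp_zeros_minimal_prime:
  fixes I :: "('v, 'a::field) mpoly set"
  assumes F: "alg_closed TYPE('a)" "finite V"
    and P: "minimal_prime V I P" and Y: "zeros V P \<subseteq> Y" "Y \<subseteq> zeros V I"
  shows "irr_comp V Y (zeros V P)"
proof -
  note prime = minimal_primeD(1)[OF P]
  have IV: "I \<subseteq> polyring V"
    using minimal_primeD(2)[OF P] ideal_subset[OF prime_ideal[OF prime]] by blast
  have "\<not> zeros V P \<subset> D" if D: "zirred V D" "D \<subseteq> Y" for D
  proof
    assume PD: "zeros V P \<subset> D"
    have cl: "zclosed V D" "firr V D" using D(1) by (simp_all add: zirred_iff)
    have "I \<subseteq> vid V D" using IV D(2) Y(2) by (auto simp: vid_def zeros_def)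
    moreover have "vid V D \<subseteq> vid V (zeros V P)" using PD by (auto simp: vid_def)
    then have "vid V D \<subseteq> P" by (simp only: vid_zeros_prime[OF F prime])
    ultimately have "vid V D = P" by (intro minimal_primeD(3)[OF P] vid_prime[OF cl(2)])
    then show False using zeros_vid_closed[OF cl(1)] PD by simp
  qed
  then show ?thesis using zirred_zeros_prime[OF F prime] Y(1) by (auto simp: irr_comp_def)
qed

text \<open>Some \<open>g * x ^ e\<close> with \<open>g\<close> outside \<open>P\<close> lies in
  \<open>I\<close>; otherwise a minimal prime inside \<open>P\<close> would omit \<open>x\<close>,
  and minimality would make it \<open>P\<close> itself. This is nilpotency of \<open>x\<close>
  modulo \<open>I\<close> in the localization at \<open>P\<close>.\<close>

lemma minimal_prime_generically_nilpotent:
  fixes I :: "('v, 'a::field) mpoly set"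
  assumes I: "is_ideal V I" and P: "minimal_prime V I P" and x: "x \<in> P"
  shows "\<exists>g\<in>polyring V. g \<notin> P \<and> (\<forall>p\<in>zeros V I. peval p x \<noteq> 0 \<longrightarrow> peval p g = 0)"
proof (rule ccontr)
  assume neg: "\<not> ?thesis"
  note prime = minimal_primeD(1)[OF P]
  have PV: "f \<in> polyring V" if "f \<in> P" for f using ideal_subset[OF prime_ideal[OF prime] that] .
  have "\<exists>Q. minimal_prime V I Q \<and> x \<notin> Q \<and> Q \<inter> (polyring V - P) = {}"
  proof (rule basic_open_mult_set[OF I PV[OF x]])
    show "1 \<in> polyring V - P" using prime by (simp add: is_prime_ideal_def)
    show "a * b \<in> polyring V - P" if "a \<in> polyring V - P" "b \<in> polyring V - P" for a b
      using that prime_mult[OF prime, of a b] by blast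
    fix g e assume g: "g \<in> polyring V - P" "g * x ^ e \<in> I"
    have "peval p g = 0" if "p \<in> zeros V I" "peval p x \<noteq> 0" for p
    proof -
      have "peval p (g * x ^ e) = 0" using that(1) g(2) by (simp only: zeros_def mem_Collect_eq)
      then show ?thesis using that(2) by simp
    qed
    then show False using neg g(1) by blast
  qed auto
  then obtain Q where Q: "minimal_prime V I Q" "x \<notin> Q" "Q \<inter> (polyring V - P) = {}" by blast
  have "Q \<subseteq> P" using Q(3) ideal_subset[OF prime_ideal[OF minimal_primeD(1)[OF Q(1)]]] by blast
  then have "Q = P" using minimal_primeD[OF Q(1)] minimal_primeD(3)[OF P] by blast
  then show False using x Q(2) by blast
qed

text \<open>With the complement of the prime of \<open>C\<close> as multiplicative set, a minimal
  prime inside that prime is found that omits \<open>x\<close>; maximality of \<open>C\<close>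
  forces equality.\<close>

lemma irr_comp_zclosure_basic_open:
  fixes I :: "('v, 'a::field) mpoly set"
  assumes F: "alg_closed TYPE('a)" "finite V" and I: "is_ideal V I" and x: "x \<in> polyring V"
    and C: "irr_comp V (zclosure V {q \<in> zeros V I. peval q x \<noteq> 0}) C"
  shows "\<exists>P. minimal_prime V I P \<and> x \<notin> P \<and> C = zeros V P"
proof -
  let ?Y = "{q \<in> zeros V I. peval q x \<noteq> 0}"
  have Y: "?Y \<subseteq> aff V" by (auto simp: zeros_def)
  have CY: "C \<subseteq> zclosure V ?Y" and cl: "zclosed V C" "firr V C"
    using C by (simp_all add: irr_comp_def zirred_iff)
  have prime: "is_prime_ideal V (vid V C)" by (rule vid_prime[OF cl(2)])
  have "\<exists>P. minimal_prime V I P \<and> x \<notin> P \<and> P \<inter> (polyring V - vid V C) = {}"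
  proof (rule basic_open_mult_set[OF I x])
    show "1 \<in> polyring V - vid V C" using prime by (simp add: is_prime_ideal_def)
    show "a * b \<in> polyring V - vid V C" if "a \<in> polyring V - vid V C" "b \<in> polyring V - vid V C" for a b
      using that prime_mult[OF prime, of a b] by blast
    fix g e assume g: "g \<in> polyring V - vid V C" "g * x ^ e \<in> I"
    have "peval q g = 0" if "q \<in> ?Y" for q
    proof -
      have "peval q (g * x ^ e) = 0" using that g(2) by (simp only: zeros_def mem_Collect_eq)
      then show ?thesis using that by simp
    qed
    then have "peval p g = 0" if "p \<in> C" for p
      using zclosure_vanish[OF Y] g(1) that CY by blast
    then show False using g(1) by (simp add: vid_def)
  qed auto
  then obtain P where P: "minimal_prime V I P" "x \<notin> P" "P \<inter> (polyring V - vid V C) = {}" by blast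
  have "P \<subseteq> vid V C" using P(3) ideal_subset[OF prime_ideal[OF minimal_primeD(1)[OF P(1)]]] by blast
  then have "C \<subseteq> zeros V P" using zeros_vid_closed[OF cl(1)] zeros_mono by blast
  moreover have "zeros V P \<subseteq> zclosure V ?Y"
    using mem_zclosure_basic_open_iff[OF F I x] P(1,2) by blast
  moreover have "zirred V (zeros V P)" by (rule zirred_zeros_prime[OF F minimal_primeD(1)[OF P(1)]])
  ultimately have "C = zeros V P" using C by (auto simp: irr_comp_def)
  then show ?thesis using P by blast
qed

section \<open>Polynomial functions\<close>

definition polyfun :: "'v set \<Rightarrow> (('v \<Rightarrow> 'a::comm_ring_1) \<Rightarrow> 'a) \<Rightarrow> bool" where
  "polyfun V h \<longleftrightarrow> (\<exists>f\<in>polyring V. \<forall>p. h p = peval p f)"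

lemma polyfun_peval: "f \<in> polyring V \<Longrightarrow> polyfun V (\<lambda>p. peval p f)"
  by (auto simp: polyfun_def)

lemma polyfun_const [intro, simp]: "polyfun V (\<lambda>p. c)"
  unfolding polyfun_def by (rule bexI[of _ "mconst c"]) simp_all

lemma polyfun_var [intro]: "v \<in> V \<Longrightarrow> polyfun V (\<lambda>p. p v)"
  unfolding polyfun_def by (rule bexI[of _ "mvar v"]) auto

lemma polyfun_add [intro]: "polyfun V f \<Longrightarrow> polyfun V g \<Longrightarrow> polyfun V (\<lambda>p. f p + g p)"
  unfolding polyfun_def by (metis peval_add polyring_add)

lemma polyfun_mult [intro]: "polyfun V f \<Longrightarrow> polyfun V g \<Longrightarrow> polyfun V (\<lambda>p. f p * g p)"
  unfolding polyfun_def by (metis peval_mult polyring_mult)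

lemma polyfun_diff [intro]: "polyfun V f \<Longrightarrow> polyfun V g \<Longrightarrow> polyfun V (\<lambda>p. f p - g p)"
  unfolding polyfun_def by (metis peval_diff polyring_diff)

lemma polyfun_sum [intro]: "(\<And>i. i \<in> A \<Longrightarrow> polyfun V (f i)) \<Longrightarrow> polyfun V (\<lambda>p. \<Sum>i\<in>A. f i p)"
  by (induction A rule: infinite_finite_induct) auto

lemma polyfun_comp:
  assumes "f \<in> polyring V" "\<And>v. v \<in> V \<Longrightarrow> polyfun W (\<lambda>b. h b v)"
  shows "polyfun W (\<lambda>b. peval (h b) f)"
  using peval_in_algebra[OF assms(1), of "Collect (polyfun W)" h] assms(2) by auto

lemma peval_curve:
  assumes "f \<in> polyring V" "\<And>v. v \<in> V \<Longrightarrow> \<exists>q. \<forall>s. c s v = poly q s"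
  shows "\<exists>q. \<forall>s. peval (c s) f = poly q s"
proof -
  let ?A = "{h. \<exists>q. \<forall>s. h s = poly q s}"
  have "(\<lambda>s. peval (c s) f) \<in> ?A"
  proof (rule peval_in_algebra[OF assms(1)])
    show "(\<lambda>b. d) \<in> ?A" for d by (auto intro!: exI[of _ "[:d:]"])
    show "(\<lambda>s. c s v) \<in> ?A" if "v \<in> V" for v using assms(2)[OF that] by auto
    show "(\<lambda>b. x b + y b) \<in> ?A" if "x \<in> ?A" "y \<in> ?A" for x y
      using that by (auto simp flip: poly_add)
    show "(\<lambda>b. x b * y b) \<in> ?A" if "x \<in> ?A" "y \<in> ?A" for x y
      using that by (auto simp flip: poly_mult)
  qed
  then show ?thesis by simp
qed

text \<open>On the line through \<open>a\<close> and \<open>b\<close> both functions become nonzero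
  univariate polynomials, so some parameter avoids the roots of both.\<close>

lemma polyfun_common_nonzero:
  fixes f g :: "('v \<Rightarrow> 'a::field) \<Rightarrow> 'a"
  assumes inf: "infinite (UNIV :: 'a set)"
    and f: "polyfun V f" "f a \<noteq> 0" and g: "polyfun V g" "g b \<noteq> 0"
  shows "\<exists>c. f c \<noteq> 0 \<and> g c \<noteq> 0"
proof -
  define l where "l s = (\<lambda>v. a v + s * (b v - a v))" for s
  have "\<exists>q. \<forall>s. l s v = poly q s" for v
    by (rule exI[of _ "[:a v, b v - a v:]"]) (simp add: l_def)
  then have "\<exists>q. \<forall>s. h (l s) = poly q s" if "polyfun V h" for h
    using that peval_curve[of _ V l] unfolding polyfun_def by metis
  then obtain qf qg where q: "\<And>s. f (l s) = poly qf s" "\<And>s. g (l s) = poly qg s"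
    using f(1) g(1) by metis
  have "l 0 = a" "l 1 = b" by (auto simp: l_def)
  then have "qf \<noteq> 0" "qg \<noteq> 0" using q f(2) g(2) by (metis poly_0)+
  then have "qf * qg \<noteq> 0" by simp
  then obtain s where "poly (qf * qg) s \<noteq> 0" using poly_nonzero_value[OF inf] by blast
  then show ?thesis using q by (intro exI[of _ "l s"]) auto
qed

text \<open>A product of an irreducible set with an affine space is irreducible, and so is its image
  under a polynomial map.\<close>
lemma firr_image_product:
  fixes D :: "('w \<Rightarrow> 'a::field) set" and \<mu> :: "('w \<Rightarrow> 'a) \<Rightarrow> ('u \<Rightarrow> 'a) \<Rightarrow> ('v \<Rightarrow> 'a)"
  assumes inf: "infinite (UNIV :: 'a set)" and D: "firr W D"
    and poly1: "\<And>a v. v \<in> V \<Longrightarrow> polyfun W (\<lambda>d. \<mu> d a v)"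
    and poly2: "\<And>d v. v \<in> V \<Longrightarrow> polyfun T (\<lambda>a. \<mu> d a v)"
    and into: "\<And>d a. d \<in> D \<Longrightarrow> \<mu> d a \<in> Y"
    and onto: "\<And>y. y \<in> Y \<Longrightarrow> \<exists>d\<in>D. \<exists>a. y = \<mu> d a"
  shows "firr V Y"
  unfolding firr_def
proof (intro conjI ballI impI)
  show "Y \<noteq> {}" using D into unfolding firr_def by blast
next
  fix f g :: "('v, 'a) mpoly"
  assume fg: "f \<in> polyring V" "g \<in> polyring V" "\<forall>y\<in>Y. peval y f * peval y g = 0"
  show "(\<forall>y\<in>Y. peval y f = 0) \<or> (\<forall>y\<in>Y. peval y g = 0)"
  proof (rule ccontr)
    assume "\<not> ?thesis"
    then obtain d a d' a' where 1: "d \<in> D" "peval (\<mu> d a) f \<noteq> 0" "d' \<in> D" "peval (\<mu> d' a') g \<noteq> 0"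
      using onto by metis
    obtain u where u: "u \<in> polyring W" "\<And>d. peval (\<mu> d a) f = peval d u"
      using polyfun_comp[OF fg(1), of W "\<lambda>d. \<mu> d a"] poly1 unfolding polyfun_def by metis
    obtain u' where u': "u' \<in> polyring W" "\<And>d. peval (\<mu> d a') g = peval d u'"
      using polyfun_comp[OF fg(2), of W "\<lambda>d. \<mu> d a'"] poly1 unfolding polyfun_def by metis
    \<comment> \<open>First a common \<open>e\<close> in \<open>D\<close> is found with
      \<open>a\<close> and \<open>a'\<close> fixed; then \<open>a\<close> and \<open>a'\<close> are
      replaced by a common \<open>c\<close> with \<open>e\<close> fixed.\<close>
    have "\<exists>e\<in>D. peval e u \<noteq> 0 \<and> peval e u' \<noteq> 0"
      using firrD[OF D u(1) u'(1)] 1 u(2) u'(2) by metis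
    then obtain e where e: "e \<in> D" "peval (\<mu> e a) f \<noteq> 0" "peval (\<mu> e a') g \<noteq> 0"
      using u(2) u'(2) by metis
    have "polyfun T (\<lambda>a. peval (\<mu> e a) f)" and "polyfun T (\<lambda>a. peval (\<mu> e a) g)"
      using polyfun_comp[OF fg(1), of T "\<lambda>a. \<mu> e a"] polyfun_comp[OF fg(2), of T "\<lambda>a. \<mu> e a"] poly2
      by blast+
    then obtain c where "peval (\<mu> e c) f \<noteq> 0" "peval (\<mu> e c) g \<noteq> 0"
      using polyfun_common_nonzero[OF inf, where f = "\<lambda>a. peval (\<mu> e a) f"
          and g = "\<lambda>a. peval (\<mu> e a) g", of T a a'] e(2,3) by blast
    then show False using fg(3) into[OF e(1)] by (metis mult_eq_0_iff)
  qed
qed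

section \<open>Codimension and algebraic independence\<close>

lemma nontrivial_solution:
  fixes A :: "'s \<Rightarrow> 't \<Rightarrow> 'a::field"
  assumes "finite T" "finite S" "card T < card S"
  shows "\<exists>c. (\<exists>s\<in>S. c s \<noteq> 0) \<and> (\<forall>t\<in>T. (\<Sum>s\<in>S. c s * A s t) = 0)"
  using assms
proof (induction T arbitrary: S A)
  case empty
  then obtain s where "s \<in> S" by fastforce
  then show ?case by (intro exI[of _ "\<lambda>_. 1"]) auto
next
  case (insert t T)
  show ?case
  proof (cases "\<forall>s\<in>S. A s t = 0")
    case True
    have "card T < card S" using insert by simp
    then obtain c where "\<exists>s\<in>S. c s \<noteq> 0" "\<forall>t\<in>T. (\<Sum>s\<in>S. c s * A s t) = 0"
      using insert.IH[OF insert.prems(1)] by metis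
    then show ?thesis using True by (intro exI[of _ c]) auto
  next
    case False
    then obtain s0 where s0: "s0 \<in> S" "A s0 t \<noteq> 0" by blast
    define S' where "S' = S - {s0}"
    \<comment> \<open>Equation \<open>t\<close> is solved for the unknown \<open>s0\<close>, and
      \<open>A'\<close> is the system left for the others.\<close>
    define A' where "A' s u = A s u - A s t / A s0 t * A s0 u" for s u
    have fin: "finite S'" and SS: "S = insert s0 S'" "s0 \<notin> S'"
      using insert.prems(1) s0(1) by (auto simp: S'_def)
    then have "card T < card S'" using insert.prems(2) insert.hyps by simp
    then obtain c where c: "\<exists>s\<in>S'. c s \<noteq> 0" "\<forall>u\<in>T. (\<Sum>s\<in>S'. c s * A' s u) = 0"
      using insert.IH[OF fin] by metis
    define c' where "c' s = (if s = s0 then - (\<Sum>s\<in>S'. c s * A s t) / A s0 t else c s)" for s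
    have sum: "(\<Sum>s\<in>S. c' s * A s u) = c' s0 * A s0 u + (\<Sum>s\<in>S'. c s * A s u)" for u
    proof -
      have "(\<Sum>s\<in>S'. c' s * A s u) = (\<Sum>s\<in>S'. c s * A s u)"
        using SS(2) by (intro sum.cong) (auto simp: c'_def)
      then show ?thesis unfolding SS(1) using fin SS(2) by simp
    qed
    have "(\<Sum>s\<in>S. c' s * A s t) = 0"
      unfolding sum using s0(2) by (simp add: c'_def)
    moreover have "(\<Sum>s\<in>S. c' s * A s u) = 0" if "u \<in> T" for u
    proof -
      have "(\<Sum>s\<in>S'. c s * A' s u) = (\<Sum>s\<in>S'. c s * A s u) - (\<Sum>s\<in>S'. c s * A s t) * (A s0 u / A s0 t)"
        unfolding A'_def sum_distrib_right sum_subtractf[symmetric]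
        by (intro sum.cong) (auto simp: algebra_simps)
      then show ?thesis unfolding sum using c(2) that by (simp add: c'_def)
    qed
    moreover have "\<exists>s\<in>S. c' s \<noteq> 0" using c(1) SS by (auto simp: c'_def)
    ultimately show ?thesis by (intro exI[of _ c']) auto
  qed
qed

text \<open>Bounding each exponent separately, not the total degree, makes the number of monomials
  an exact power.\<close>

definition bounded_monoms :: "'v set \<Rightarrow> nat \<Rightarrow> ('v \<Rightarrow>\<^sub>0 nat) set" where
  "bounded_monoms V e = {m. Poly_Mapping.keys m \<subseteq> V \<and> (\<forall>v. Poly_Mapping.lookup m v \<le> e)}"

lemma bounded_monoms_card:
  assumes "finite V"
  shows "finite (bounded_monoms V e)" "card (bounded_monoms V e) = (e + 1) ^ card V"
proof -
  let ?E = "PiE V (\<lambda>_. {..e})"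
  have bij: "bij_betw (\<lambda>m. restrict (Poly_Mapping.lookup m) V) (bounded_monoms V e) ?E"
  proof (rule bij_betw_imageI)
    show "inj_on (\<lambda>m. restrict (Poly_Mapping.lookup m) V) (bounded_monoms V e)"
    proof (rule inj_onI, rule poly_mapping_eqI)
      fix m m' v
      assume m: "m \<in> bounded_monoms V e" "m' \<in> bounded_monoms V e"
        and eq: "restrict (Poly_Mapping.lookup m) V = restrict (Poly_Mapping.lookup m') V"
      show "Poly_Mapping.lookup m v = Poly_Mapping.lookup m' v"
      proof (cases "v \<in> V")
        case True
        then show ?thesis using fun_cong[OF eq, of v] by simp
      next
        case False
        then have "v \<notin> Poly_Mapping.keys m" "v \<notin> Poly_Mapping.keys m'"
          using m by (auto simp: bounded_monoms_def)
        then show ?thesis by (simp add: in_keys_iff)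
      qed
    qed
    show "(\<lambda>m. restrict (Poly_Mapping.lookup m) V) ` bounded_monoms V e = ?E"
    proof
      show "(\<lambda>m. restrict (Poly_Mapping.lookup m) V) ` bounded_monoms V e \<subseteq> ?E"
        by (auto simp: bounded_monoms_def)
      show "?E \<subseteq> (\<lambda>m. restrict (Poly_Mapping.lookup m) V) ` bounded_monoms V e"
      proof
        fix h assume h: "h \<in> ?E"
        define g where "g v = (if v \<in> V then h v else 0)" for v
        have "finite {v. g v \<noteq> 0}" by (rule finite_subset[OF _ assms]) (auto simp: g_def)
        then have lk: "Poly_Mapping.lookup (Abs_poly_mapping g) = g" by simp
        have "Abs_poly_mapping g \<in> bounded_monoms V e"
          using h by (auto simp: bounded_monoms_def lk in_keys_iff g_def split: if_splits)
        moreover have "restrict (Poly_Mapping.lookup (Abs_poly_mapping g)) V = h"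
          using h unfolding lk by (auto simp: g_def fun_eq_iff restrict_def PiE_def extensional_def)
        ultimately show "h \<in> (\<lambda>m. restrict (Poly_Mapping.lookup m) V) ` bounded_monoms V e" by blast
      qed
    qed
  qed
  show "finite (bounded_monoms V e)"
    using bij_betw_finite[OF bij] finite_PiE[OF assms, of "\<lambda>_. {..e}"] by simp
  show "card (bounded_monoms V e) = (e + 1) ^ card V"
    using bij_betw_same_card[OF bij] card_PiE[OF assms, of "\<lambda>_. {..e}"] by simp
qed

definition bounded_polys :: "'v set \<Rightarrow> nat \<Rightarrow> ('v, 'a::comm_ring_1) mpoly set" where
  "bounded_polys V e = {f. Poly_Mapping.keys f \<subseteq> bounded_monoms V e}"

lemma bounded_polys_mult:
  assumes "f \<in> bounded_polys V d" "g \<in> bounded_polys V e"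
  shows "f * g \<in> bounded_polys V (d + e)"
proof -
  have "m \<in> bounded_monoms V (d + e)" if m: "m \<in> Poly_Mapping.keys (f * g)" for m
  proof -
    obtain a b where ab: "a \<in> Poly_Mapping.keys f" "b \<in> Poly_Mapping.keys g" "m = a + b"
      using subsetD[OF keys_mult m] by blast
    then have "a \<in> bounded_monoms V d" "b \<in> bounded_monoms V e"
      using assms by (auto simp: bounded_polys_def)
    then show ?thesis
      unfolding ab(3) bounded_monoms_def using keys_add[of a b]
      by (auto simp: lookup_add add_mono)
  qed
  then show ?thesis by (auto simp: bounded_polys_def)
qed

lemma bounded_polys_1: "1 \<in> bounded_polys V e"
  by (auto simp: bounded_polys_def bounded_monoms_def)

lemma bounded_polys_mono: "d \<le> e \<Longrightarrow> bounded_polys V d \<subseteq> bounded_polys V e"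
proof -
  assume "d \<le> e"
  then have "bounded_monoms V d \<subseteq> bounded_monoms V e"
    unfolding bounded_monoms_def using order.trans by blast
  then show ?thesis by (auto simp: bounded_polys_def)
qed

lemma bounded_polys_power:
  "f \<in> bounded_polys V d \<Longrightarrow> f ^ e \<in> bounded_polys V (e * d)"
  by (induction e) (auto simp: bounded_polys_1 bounded_polys_mult)

lemma bounded_polys_prod:
  "finite J \<Longrightarrow> (\<And>j. j \<in> J \<Longrightarrow> f j \<in> bounded_polys V d) \<Longrightarrow> (\<Prod>j\<in>J. f j) \<in> bounded_polys V (card J * d)"
  by (induction J rule: finite_induct) (auto simp: bounded_polys_1 bounded_polys_mult)

lemma bounded_polys_exists:
  assumes "f \<in> polyring V"
  shows "\<exists>d. f \<in> bounded_polys V d"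
proof -
  define d where "d = (\<Sum>m\<in>Poly_Mapping.keys f. \<Sum>v\<in>Poly_Mapping.keys m. Poly_Mapping.lookup m v)"
  have "Poly_Mapping.lookup m v \<le> d" if m: "m \<in> Poly_Mapping.keys f" for m v
  proof (cases "v \<in> Poly_Mapping.keys m")
    case True
    have "Poly_Mapping.lookup m v \<le> (\<Sum>v\<in>Poly_Mapping.keys m. Poly_Mapping.lookup m v)"
      by (rule member_le_sum) (use True in auto)
    also have "\<dots> \<le> d" unfolding d_def
      by (rule member_le_sum[where f = "\<lambda>m. \<Sum>v\<in>Poly_Mapping.keys m. Poly_Mapping.lookup m v"]) (use m in auto)
    finally show ?thesis .
  qed (simp add: in_keys_iff)
  then have "f \<in> bounded_polys V d"
    using assms by (auto simp: bounded_polys_def bounded_monoms_def polyring_def mvars_def)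
  then show ?thesis ..
qed

text \<open>The functions \<open>F\<close>, indexed by \<open>J\<close>, are algebraically independent on \<open>C\<close>; over an infinite
  field it does no harm to replace the zero polynomial by polynomials without nonzero value.\<close>
definition fun_indep :: "('v \<Rightarrow> 'a::comm_ring_1) set \<Rightarrow> 'j set \<Rightarrow> (('v \<Rightarrow> 'a) \<Rightarrow> ('j \<Rightarrow> 'a)) \<Rightarrow> bool" where
  "fun_indep C J F \<longleftrightarrow> (\<forall>G\<in>polyring J. (\<forall>p\<in>C. peval (F p) G = 0) \<longrightarrow> (\<forall>a. peval a G = 0))"

text \<open>Monomials of degree at most \<open>d\<close> in each of the functions span a space whose dimension would grow
  like a power of \<open>d\<close> with exponent \<open>card J\<close>, inside a space growing with exponent \<open>card V\<close>.\<close>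
lemma fun_indep_card_le:
  fixes F :: "('v \<Rightarrow> 'a::field) \<Rightarrow> ('j \<Rightarrow> 'a)"
  assumes inf: "infinite (UNIV :: 'a set)" and V: "finite V" and J: "finite J"
    and F: "\<And>j. j \<in> J \<Longrightarrow> polyfun V (\<lambda>p. F p j)" and indep: "fun_indep C J F"
  shows "card J \<le> card V"
proof (rule ccontr)
  assume "\<not> ?thesis"
  then have big: "card V + 1 \<le> card J" by simp
  have "\<forall>j\<in>J. \<exists>f\<in>polyring V. \<forall>p. F p j = peval p f" using F by (simp add: polyfun_def)
  then obtain f where f: "\<And>j. j \<in> J \<Longrightarrow> f j \<in> polyring V" "\<And>j p. j \<in> J \<Longrightarrow> F p j = peval p (f j)"
    by metis
  obtain D where D: "\<And>j. j \<in> J \<Longrightarrow> f j \<in> bounded_polys V (D j)"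
    using bounded_polys_exists[OF f(1)] by metis
  define \<delta> where "\<delta> = (\<Sum>j\<in>J. D j)"
  have f\<delta>: "f j \<in> bounded_polys V \<delta>" if "j \<in> J" for j
    using D[OF that] bounded_polys_mono[of "D j" \<delta>] member_le_sum[of j J D] that J
    by (auto simp: \<delta>_def)
  \<comment> \<open>Products of the functions with exponents at most \<open>d\<close> are
    polynomials with exponents at most \<open>card J * (d * \<delta>)\<close>, thus at most
    \<open>c * d\<close>. The choice \<open>d = c ^ card V\<close> makes
    \<open>(c * d + 1) ^ card V\<close> smaller than \<open>(d + 1) ^ (card V + 1)\<close>.\<close>
  define c where "c = card J * \<delta> + 1"
  define d where "d = c ^ card V"
  define mon where "mon s = (\<Prod>j\<in>J. f j ^ Poly_Mapping.lookup s j)" for s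
  have mon: "mon s \<in> bounded_polys V (c * d)" if s: "s \<in> bounded_monoms J d" for s
  proof -
    have "f j ^ Poly_Mapping.lookup s j \<in> bounded_polys V (d * \<delta>)" if "j \<in> J" for j
    proof -
      have "Poly_Mapping.lookup s j * \<delta> \<le> d * \<delta>" using s by (simp add: bounded_monoms_def)
      then show ?thesis
        using bounded_polys_power[OF f\<delta>[OF that], of "Poly_Mapping.lookup s j"]
          bounded_polys_mono by blast
    qed
    then have "mon s \<in> bounded_polys V (card J * (d * \<delta>))"
      unfolding mon_def by (rule bounded_polys_prod[OF J])
    moreover have "card J * (d * \<delta>) \<le> c * d" by (simp add: c_def algebra_simps)
    ultimately show ?thesis using bounded_polys_mono by blast
  qed
  have "card (bounded_monoms V (c * d)) = (c * d + 1) ^ card V"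
    by (rule bounded_monoms_card(2)[OF V])
  also have "\<dots> \<le> (c * (d + 1)) ^ card V"
    by (rule power_mono) (auto simp: c_def)
  also have "\<dots> = d * (d + 1) ^ card V" by (simp only: power_mult_distrib d_def)
  also have "\<dots> < (d + 1) ^ (card V + 1)" by simp
  also have "\<dots> \<le> (d + 1) ^ card J" using big by (intro power_increasing) auto
  also have "\<dots> = card (bounded_monoms J d)" by (rule bounded_monoms_card(2)[OF J, symmetric])
  finally have "card (bounded_monoms V (c * d)) < card (bounded_monoms J d)" .
  then obtain e where e: "\<exists>s\<in>bounded_monoms J d. e s \<noteq> 0"
    "\<forall>m\<in>bounded_monoms V (c * d). (\<Sum>s\<in>bounded_monoms J d. e s * Poly_Mapping.lookup (mon s) m) = 0"
    using nontrivial_solution[OF bounded_monoms_card(1)[OF V] bounded_monoms_card(1)[OF J],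
      of "c * d" d "\<lambda>s. Poly_Mapping.lookup (mon s)"] by blast
  let ?B = "bounded_monoms J d"
  have finB: "finite ?B" by (rule bounded_monoms_card(1)[OF J])
  \<comment> \<open>The linear dependence between the products \<open>mon s\<close>, read as a
    polynomial in the functions.\<close>
  define G where "G = (\<Sum>s\<in>?B. Poly_Mapping.single s (e s))"
  have rel: "(\<Sum>s\<in>?B. mconst (e s) * mon s) = 0"
  proof (rule poly_mapping_eqI)
    fix m
    have "Poly_Mapping.lookup (\<Sum>s\<in>?B. mconst (e s) * mon s) m
      = (\<Sum>s\<in>?B. e s * Poly_Mapping.lookup (mon s) m)"
      by (simp add: lookup_sum mult_map_scale_conv_mult[symmetric] Poly_Mapping.map.rep_eq when_def)
        (intro sum.cong, auto)
    also have "\<dots> = 0"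
    proof (cases "m \<in> bounded_monoms V (c * d)")
      case False
      then have "Poly_Mapping.lookup (mon s) m = 0" if "s \<in> ?B" for s
        using mon[OF that] by (auto simp: bounded_polys_def in_keys_iff)
      then show ?thesis by simp
    qed (use e(2) in blast)
    finally show "Poly_Mapping.lookup (\<Sum>s\<in>?B. mconst (e s) * mon s) m = Poly_Mapping.lookup 0 m" by simp
  qed
  have GJ: "G \<in> polyring J"
    unfolding G_def
  proof (rule polyring_sum)
    fix s assume "s \<in> ?B"
    then show "Poly_Mapping.single s (e s) \<in> polyring J"
      by (auto simp: polyring_def mvars_def bounded_monoms_def)
  qed
  have "peval (F p) G = 0" for p
  proof -
    have "meval (F p) s = peval p (mon s)" if "s \<in> ?B" for s
    proof -
      have "meval (F p) s = (\<Prod>j\<in>J. F p j ^ Poly_Mapping.lookup s j)"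
        by (rule meval_superset[OF J]) (use that in \<open>simp add: bounded_monoms_def\<close>)
      then show ?thesis by (simp add: mon_def f(2))
    qed
    then have "peval (F p) G = peval p (\<Sum>s\<in>?B. mconst (e s) * mon s)"
      by (simp add: G_def)
    then show ?thesis by (simp only: rel peval_0)
  qed
  then have "\<forall>a. peval a G = 0" using indep GJ by (simp add: fun_indep_def)
  then have "G = 0" using peval_nonzero_value[OF inf J GJ] by blast
  obtain s where s: "s \<in> ?B" "e s \<noteq> 0" using e(1) by blast
  have "Poly_Mapping.lookup G s = (\<Sum>t\<in>?B. if t = s then e t else 0)"
    unfolding G_def lookup_sum by (intro sum.cong) (auto simp: lookup_single when_def)
  also have "\<dots> = e s" using finB s(1) by simp
  finally show False using \<open>G = 0\<close> s(2) by simp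
qed

text \<open>Each step of a chain of irreducible sets contributes one more independent function: a relation
  involving the new function \<open>f\<close> can be divided by \<open>f\<close> once its constant term is seen to vanish on \<open>C\<close>.\<close>
lemma fun_indep_insert:
  fixes F :: "('v \<Rightarrow> 'a::field) \<Rightarrow> ('j \<Rightarrow> 'a)"
  assumes indep: "fun_indep C J F" and F: "\<And>j. j \<in> J \<Longrightarrow> polyfun V (\<lambda>p. F p j)"
    and j: "j \<notin> J" and CC: "C \<subseteq> C'" and C': "firr V C'"
    and f: "f \<in> polyring V" "\<forall>p\<in>C. peval p f = 0" "p' \<in> C'" "peval p' f \<noteq> 0"
  shows "fun_indep C' (insert j J) (\<lambda>p. (F p)(j := peval p f))"
  unfolding fun_indep_def
proof (intro ballI impI allI)
  \<comment> \<open>Induction on the polynomial in the new function; the coefficients have to vanish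
    at every point \<open>a\<close>, not merely at the values taken on \<open>C'\<close>.\<close>
  have *: "(\<forall>i. coeff q i \<in> polyring J) \<Longrightarrow> (\<forall>p\<in>C'. poly (evp (F p) q) (peval p f) = 0)
    \<Longrightarrow> peval a (coeff q i) = 0" for q i a
  proof (induction q arbitrary: i)
    case 0
    then show ?case by simp
  next
    case (pCons c q)
    have cJ: "c \<in> polyring J" using spec[OF pCons.prems(1), of 0] by simp
    have qJ: "\<forall>i. coeff q i \<in> polyring J"
      using pCons.prems(1) by (metis coeff_pCons_Suc)
    have ev: "evp (F p) (pCons c q) = pCons (peval (F p) c) (evp (F p) q)" for p
      by (simp add: map_poly_pCons)
    have "peval (F p) c = 0" if "p \<in> C" for p
    proof -
      have "poly (evp (F p) (pCons c q)) (peval p f) = 0" using pCons.prems(2) that CC by blast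
      then show ?thesis using f(2) that unfolding ev by simp
    qed
    then have c0: "peval a c = 0" for a using indep cJ by (simp add: fun_indep_def)
    let ?g = "poly q (mvar j)"
    have gJ: "?g \<in> polyring (insert j J)"
      by (rule polyring_poly) (use qJ polyring_mono[of J "insert j J"] in auto)
    have "polyfun V (\<lambda>p. ((F p)(j := peval p f)) i)" if "i \<in> insert j J" for i
      using that F j by (cases "i = j") (auto intro: polyfun_peval[OF f(1)])
    then obtain h where h: "h \<in> polyring V" "\<And>p. peval ((F p)(j := peval p f)) ?g = peval p h"
      using polyfun_comp[OF gJ, of V "\<lambda>p. (F p)(j := peval p f)"] unfolding polyfun_def by metis
    have hq: "peval p h = poly (evp (F p) q) (peval p f)" for p
      unfolding h(2)[symmetric] by (rule peval_fun_upd_poly[OF _ j]) (use qJ in blast)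
    have "(\<forall>y\<in>C'. peval y f = 0) \<or> (\<forall>y\<in>C'. peval y h = 0)"
    proof (rule firrD[OF C' f(1) h(1)])
      fix p assume "p \<in> C'"
      then have "poly (evp (F p) (pCons c q)) (peval p f) = 0" using pCons.prems(2) by blast
      then show "peval p f = 0 \<or> peval p h = 0" unfolding ev hq using c0 by simp
    qed
    then have "\<forall>y\<in>C'. peval y h = 0" using f(3,4) by blast
    then have q0: "peval a (coeff q i) = 0" for i
      by (intro pCons.IH qJ) (simp add: hq)
    show ?case using c0 q0 by (simp add: coeff_pCons split: nat.split)
  qed
  fix G a
  assume G: "G \<in> polyring (insert j J)" "\<forall>p\<in>C'. peval ((F p)(j := peval p f)) G = 0"
  obtain q where q: "\<forall>i. coeff q i \<in> polyring J" "G = poly q (mvar j)"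
    using polyring_insert_decomp[OF G(1)] by blast
  have "peval ((F p)(j := peval p f)) G = poly (evp (F p) q) (peval p f)" for p
    unfolding q(2) by (rule peval_fun_upd_poly[OF _ j]) (use q(1) in blast)
  then have "peval a (coeff q i) = 0" for i using *[OF q(1)] G(2) by simp
  then have "evp a q = 0" by (intro poly_eqI) (simp add: coeff_map_poly)
  then show "peval a G = 0" by (simp add: q(2) peval_poly)
qed

text \<open>A polynomial vanishing on \<open>c 0\<close> but not on \<open>c 1\<close> is the new
  independent function; the infinite index type always supplies a fresh index for it.\<close>

lemma irr_chain_length_le:
  fixes F :: "('v \<Rightarrow> 'a::field) \<Rightarrow> ('j \<Rightarrow> 'a)"
  assumes inf: "infinite (UNIV :: 'a set)" "infinite (UNIV :: 'j set)" and V: "finite V"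
  shows "finite J \<Longrightarrow> (\<And>j. j \<in> J \<Longrightarrow> polyfun V (\<lambda>p. F p j)) \<Longrightarrow> fun_indep (c 0) J F \<Longrightarrow>
    (\<And>i. i < n \<Longrightarrow> c i \<subset> c (Suc i)) \<Longrightarrow> (\<And>i. i \<le> n \<Longrightarrow> zirred V (c i)) \<Longrightarrow> card J + n \<le> card V"
proof (induction n arbitrary: c J F)
  case 0
  then show ?case using fun_indep_card_le[OF inf(1) V, of J F "c 0"] by simp
next
  case (Suc n)
  have cl: "zclosed V (c 0)" "firr V (c 1)" "zclosed V (c 1)" and sub: "c 0 \<subset> c 1"
    using Suc.prems(4)[of 0] Suc.prems(5)[of 0] Suc.prems(5)[of 1] by (simp_all add: zirred_iff)
  obtain p' where p': "p' \<in> c 1" "p' \<notin> c 0" using sub by blast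
  have "p' \<in> aff V" using p'(1) zclosed_subset_aff[OF cl(3)] by blast
  then obtain f where f: "f \<in> polyring V" "\<forall>p\<in>c 0. peval p f = 0" "peval p' f \<noteq> 0"
    using cl(1) p'(2) unfolding zclosed_iff by blast
  obtain j where j: "j \<notin> J" using ex_new_if_finite[OF inf(2) Suc.prems(1)] by blast
  have "card (insert j J) + n \<le> card V"
  proof (rule Suc.IH[where c = "\<lambda>i. c (Suc i)" and F = "\<lambda>p. (F p)(j := peval p f)"])
    show "polyfun V (\<lambda>p. ((F p)(j := peval p f)) i)" if "i \<in> insert j J" for i
      using that Suc.prems(2) by (cases "i = j") (auto intro: polyfun_peval[OF f(1)])
    show "fun_indep (c (Suc 0)) (insert j J) (\<lambda>p. (F p)(j := peval p f))"
      using fun_indep_insert[OF Suc.prems(3,2) j _ cl(2) f(1,2) p'(1) f(3)] sub by simp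
  qed (use Suc.prems in auto)
  then show ?case using j Suc.prems(1) by simp
qed

section \<open>Codimension bounds by independent functions\<close>

lemma codim_le_if_fun_indep:
  fixes F :: "('v \<Rightarrow> 'a::field) \<Rightarrow> ('j \<Rightarrow> 'a)"
  assumes inf: "infinite (UNIV :: 'a set)" "infinite (UNIV :: 'j set)" and V: "finite V"
    and J: "finite J" "\<And>j. j \<in> J \<Longrightarrow> polyfun V (\<lambda>p. F p j)" "fun_indep C J F"
  shows "codim V C \<le> enat (card V - card J)"
  unfolding codim_def
proof (rule Sup_least)
  fix x assume "x \<in> {enat n |n. \<exists>c. c 0 = C \<and> (\<forall>i<n. c i \<subset> c (Suc i)) \<and> (\<forall>i\<le>n. zirred V (c i))}"
  then obtain n c where n: "x = enat n" "c 0 = C" "\<forall>i<n. c i \<subset> c (Suc i)" "\<forall>i\<le>n. zirred V (c i)"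
    by blast
  have "card J + n \<le> card V"
    by (rule irr_chain_length_le[OF inf V J(1,2), where c = c]) (use n J(3) in auto)
  then show "x \<le> enat (card V - card J)" using n(1) by simp
qed

lemma codim_ge_chain:
  assumes "c 0 = C" "\<And>i. i < n \<Longrightarrow> c i \<subset> c (Suc i)" "\<And>i. i \<le> n \<Longrightarrow> zirred V (c i)"
  shows "enat n \<le> codim V C"
  unfolding codim_def using assms by (intro Sup_upper) blast

text \<open>For a maximal independent set \<open>B\<close> of coordinates, releasing the remaining
  ones in turn leads from \<open>D\<close> through a chain of irreducible sets. Each step is strict
  because the released coordinate is algebraic over \<open>B\<close> on \<open>D\<close>.\<close>

lemma codim_ge_independent_coordinates:
  fixes D :: "('v \<Rightarrow> 'a::field) set"
  assumes inf: "infinite (UNIV :: 'a set)" and V: "finite V" and D: "zirred V D"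
  shows "\<exists>B\<subseteq>V. fun_indep D B (\<lambda>p. p) \<and> enat (card V - card B) \<le> codim V D"
proof -
  have cl: "zclosed V D" "firr V D" using D by (simp_all add: zirred_iff)
  obtain d0 where d0: "d0 \<in> D" using cl(2) by (auto simp: firr_def)
  define \<B> where "\<B> = {B. B \<subseteq> V \<and> fun_indep D B (\<lambda>p. p)}"
  have "fun_indep D {} (\<lambda>p. p)"
    unfolding fun_indep_def
  proof (intro ballI impI allI)
    fix G :: "('v, 'a) mpoly" and a
    assume G: "G \<in> polyring {}" "\<forall>p\<in>D. peval p G = 0"
    then show "peval a G = 0" using polyring_empty[OF G(1)] d0 by auto
  qed
  then have ne: "\<B> \<noteq> {}" by (auto simp: \<B>_def)
  have "finite \<B>" by (rule finite_subset[of _ "Pow V"]) (use V in \<open>auto simp: \<B>_def\<close>)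
  from finite_has_maximal[OF this ne] obtain B where
    B: "B \<subseteq> V" "fun_indep D B (\<lambda>p. p)" and max: "\<And>B'. B' \<in> \<B> \<Longrightarrow> B \<subseteq> B' \<Longrightarrow> B = B'"
    by (auto simp: \<B>_def)
  \<comment> \<open>The cylinder over the projection of \<open>D\<close> to the coordinates in
    \<open>T\<close>; \<open>T = V\<close> gives \<open>D\<close>, and smaller \<open>T\<close> give
    larger sets.\<close>
  define Y where "Y T = {p \<in> aff V. \<exists>d\<in>D. \<forall>v\<in>T. p v = d v}" for T
  define C where "C T = zclosure V (Y T)" for T
  have Yaff: "Y T \<subseteq> aff V" for T by (auto simp: Y_def)
  have irr: "zirred V (C T)" if T: "T \<subseteq> V" for T
    unfolding C_def
  proof (rule zirred_zclosure[OF Yaff])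
    let ?\<mu> = "\<lambda>d a v. if v \<in> T then d v else if v \<in> V then a v else (0::'a)"
    show "firr V (Y T)"
    proof (rule firr_image_product[OF inf cl(2), where \<mu> = ?\<mu> and T = V])
      show "polyfun V (\<lambda>d. ?\<mu> d a v)" if "v \<in> V" for a v
        using that by (cases "v \<in> T") (auto intro: polyfun_var)
      show "polyfun V (\<lambda>a. ?\<mu> d a v)" if "v \<in> V" for d v
        using that by (cases "v \<in> T") (auto intro: polyfun_var)
      show "?\<mu> d a \<in> Y T" if "d \<in> D" for d a
        using that T by (auto simp: Y_def aff_def)
      show "\<exists>d\<in>D. \<exists>a. y = ?\<mu> d a" if y: "y \<in> Y T" for y
      proof -
        obtain d where "d \<in> D" "\<forall>v\<in>T. y v = d v" using y by (auto simp: Y_def)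
        moreover have "y v = 0" if "v \<notin> V" for v using y that by (auto simp: Y_def aff_def)
        ultimately show ?thesis by (intro bexI[of _ d] exI[of _ y]) (auto simp: fun_eq_iff)
      qed
    qed
  qed
  have step: "C (insert v T) \<subset> C T" if T: "B \<subseteq> T" "v \<in> V" "v \<notin> T" for v T
  proof
    show "C (insert v T) \<subseteq> C T"
      unfolding C_def
      by (rule zclosure_subset[OF zclosed_zclosure[OF Yaff]])
        (use zclosure_superset in \<open>force simp: Y_def\<close>)
    have vB: "v \<notin> B" using T by blast
    have "insert v B \<notin> \<B>" using max[of "insert v B"] vB by blast
    \<comment> \<open>A relation on \<open>D\<close> that involves \<open>v\<close>; it persists on
      the closure for \<open>insert v T\<close> and is violated once \<open>v\<close> moves
      freely.\<close>
    then obtain g a where g: "g \<in> polyring (insert v B)" "\<forall>p\<in>D. peval p g = 0" "peval a g \<noteq> 0"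
      using B(1) T(2) by (auto simp: \<B>_def fun_indep_def)
    have gV: "g \<in> polyring V" using polyring_mono[OF _ g(1)] B(1) T(2) by blast
    have "peval p g = 0" if p: "p \<in> Y (insert v T)" for p
    proof -
      obtain d where d: "d \<in> D" "\<forall>w\<in>insert v T. p w = d w" using p by (auto simp: Y_def)
      have "peval p g = peval d g" by (rule peval_cong[OF g(1)]) (use d(2) T(1) in auto)
      then show ?thesis using g(2) d(1) by simp
    qed
    then have van: "peval p g = 0" if "p \<in> C (insert v T)" for p
      using zclosure_vanish[OF Yaff gV] that unfolding C_def by blast
    obtain q where q: "\<forall>i. coeff q i \<in> polyring B" "g = poly q (mvar v)"
      using polyring_insert_decomp[OF g(1)] by blast
    have "\<exists>p\<in>Y T. peval p g \<noteq> 0"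
    proof (rule ccontr)
      assume neg: "\<not> ?thesis"
      \<comment> \<open>Letting \<open>v\<close> vary over the infinite field kills all coefficients
        of the relation on \<open>D\<close>, and then everywhere by independence of
        \<open>B\<close>.\<close>
      have "evp d q = 0" if d: "d \<in> D" for d
      proof (rule ccontr)
        assume "evp d q \<noteq> 0"
        then obtain c where c: "poly (evp d q) c \<noteq> 0" using poly_nonzero_value[OF inf] by blast
        have "d(v := c) \<in> Y T"
          using d T zclosed_subset_aff[OF cl(1)] by (force simp: Y_def aff_def)
        then have "peval (d(v := c)) g = 0" using neg by blast
        moreover have "peval (d(v := c)) g = poly (evp d q) c"
          unfolding q(2) by (rule peval_fun_upd_poly[OF _ vB]) (use q(1) in blast)
        ultimately show False using c by simp
      qed
      then have "\<forall>d\<in>D. peval d (coeff q i) = 0" for i by (metis coeff_0 coeff_map_poly peval_0)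
      then have "peval a (coeff q i) = 0" for i using B(2) q(1) by (auto simp: fun_indep_def)
      then have "evp a q = 0" by (intro poly_eqI) (simp add: coeff_map_poly)
      then show False using g(3) by (simp add: q(2) peval_poly)
    qed
    then show "C (insert v T) \<noteq> C T"
      using van zclosure_superset[of "Y T" V] unfolding C_def by blast
  qed
  have CV: "C V = D"
  proof -
    have "Y V = D"
    proof
      show "Y V \<subseteq> D"
      proof
        fix p assume "p \<in> Y V"
        then obtain d where d: "p \<in> aff V" "d \<in> D" "\<forall>v\<in>V. p v = d v" by (auto simp: Y_def)
        moreover have "d \<in> aff V" using d(2) zclosed_subset_aff[OF cl(1)] by blast
        ultimately have "p = d" unfolding aff_def fun_eq_iff by fastforce
        then show "p \<in> D" using d(2) by simp
      qed
      show "D \<subseteq> Y V" using zclosed_subset_aff[OF cl(1)] by (auto simp: Y_def)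
    qed
    then show ?thesis using zclosure_closed[OF cl(1)] by (simp add: C_def)
  qed
  define n where "n = card (V - B)"
  obtain e where e: "bij_betw e {..<n} (V - B)"
    using ex_bij_betw_nat_finite[of "V - B"] V by (auto simp: n_def atLeast0LessThan)
  have "enat n \<le> codim V D"
  \<comment> \<open>Member \<open>i\<close> of the chain has released the first \<open>i\<close>
    coordinates in the enumeration \<open>e\<close> of \<open>V - B\<close>.\<close>
  proof (rule codim_ge_chain[where c = "\<lambda>i. C (V - e ` {..<i})"])
    show "C (V - e ` {..<0}) = D" using CV by simp
    show "zirred V (C (V - e ` {..<i}))" for i by (rule irr) auto
    fix i assume i: "i < n"
    have im: "e ` {..<Suc i} \<subseteq> V - B" using e i by (auto simp: bij_betw_def)
    have ni: "e i \<notin> e ` {..<i}" using e i by (force simp: bij_betw_def inj_on_def)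
    have eV: "e i \<in> V" using im by auto
    have "V - e ` {..<i} = insert (e i) (V - e ` {..<Suc i})"
      using ni eV by (auto simp: lessThan_Suc)
    moreover have "C (insert (e i) (V - e ` {..<Suc i})) \<subset> C (V - e ` {..<Suc i})"
      by (rule step) (use im B(1) eV in auto)
    ultimately show "C (V - e ` {..<i}) \<subset> C (V - e ` {..<Suc i})" by simp
  qed
  moreover have "n = card V - card B" using B(1) V by (simp add: n_def card_Diff_subset finite_subset)
  ultimately show ?thesis using B by blast
qed

section \<open>Determinants and minors\<close>

abbreviation fdet :: "nat \<Rightarrow> (nat \<Rightarrow> nat \<Rightarrow> 'a::comm_ring_1) \<Rightarrow> 'a" where
  "fdet n X \<equiv> det (mat n n (\<lambda>(i, j). X i j))"

lemma fdet_cong: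
  assumes "\<And>i j. i < n \<Longrightarrow> j < n \<Longrightarrow> X i j = Y i j"
  shows "fdet n X = fdet n Y"
  by (rule arg_cong[where f = det]) (auto simp: assms)

lemma fdet_leibniz:
  "fdet n X = (\<Sum>\<sigma> | \<sigma> permutes {..<n}. of_int (sign \<sigma>) * (\<Prod>i<n. X i (\<sigma> i)))"
proof -
  have "fdet n X = (\<Sum>\<sigma> | \<sigma> permutes {0..<n}. of_int (sign \<sigma>) *
      (\<Prod>i = 0..<n. mat n n (\<lambda>(i, j). X i j) $$ (i, \<sigma> i)))"
    by (rule det_def') simp
  also have "\<dots> = (\<Sum>\<sigma> | \<sigma> permutes {0..<n}. of_int (sign \<sigma>) * (\<Prod>i = 0..<n. X i (\<sigma> i)))"
  proof (intro sum.cong prod.cong refl arg_cong2[where f = "(*)"])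
    fix \<sigma> i assume "\<sigma> \<in> {\<sigma>. \<sigma> permutes {0..<n}}" "i \<in> {0..<n}"
    then show "mat n n (\<lambda>(i, j). X i j) $$ (i, \<sigma> i) = X i (\<sigma> i)"
      using permutes_in_image[of \<sigma> "{0..<n}" i] by simp
  qed
  finally show ?thesis by (simp add: atLeast0LessThan)
qed

lemma fdet_transpose: "fdet n (\<lambda>i j. X j i) = fdet n X"
proof -
  have "mat n n (\<lambda>(i, j). X j i) = transpose_mat (mat n n (\<lambda>(i, j). X i j))" by auto
  then show ?thesis by (simp add: det_transpose[of _ n])
qed

lemma fdet_scale: "fdet n (\<lambda>i j. c * X i j) = c ^ n * fdet n X"
proof -
  have "mat n n (\<lambda>(i, j). c * X i j) = c \<cdot>\<^sub>m mat n n (\<lambda>(i, j). X i j)" by auto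
  then show ?thesis by simp
qed

lemma fdet_identical_rows:
  assumes "i < n" "j < n" "i \<noteq> j" "\<And>b. X i b = X j b"
  shows "fdet n X = 0"
  by (rule det_identical_rows[of _ n i j]) (use assms in \<open>auto intro!: eq_vecI\<close>)

lemma fdet_permute_rows:
  assumes "p permutes {..<n}"
  shows "fdet n (\<lambda>i. X (p i)) = of_int (sign p) * fdet n X"
proof -
  have p: "p permutes {0..<n}" using assms by (simp add: atLeast0LessThan)
  have "fdet n (\<lambda>i. X (p i)) = fdet n (\<lambda>i j. mat n n (\<lambda>(i, j). X i j) $$ (p i, j))"
    by (rule fdet_cong) (use permutes_in_image[OF p] in auto)
  also have "\<dots> = of_int (sign p) * fdet n X"
    by (rule det_permute_rows[OF _ p]) simp
  finally show ?thesis .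
qed

text \<open>Deleting row or column \<open>k\<close> becomes composition with an index map, so minors
  of minors keep the form \<open>X (f a) (g b)\<close>.\<close>

definition skip_index :: "nat \<Rightarrow> nat \<Rightarrow> nat" where
  "skip_index k a = (if a < k then a else Suc a)"

lemma skip_index_less: "a < n \<Longrightarrow> skip_index k a < Suc n"
  by (simp add: skip_index_def)

lemma skip_index_0 [simp]: "skip_index 0 = Suc"
  by (simp add: skip_index_def fun_eq_iff)

lemma skip_index_neq [simp]: "skip_index k a \<noteq> k"
  by (simp add: skip_index_def)

lemma skip_index_Suc_0 [simp]: "skip_index (Suc k) 0 = 0"
  by (simp add: skip_index_def)

lemma skip_index_Suc_Suc [simp]: "skip_index (Suc k) (Suc a) = Suc (skip_index k a)"
  by (simp add: skip_index_def)

lemma fdet_expand_row: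
  assumes "k < Suc n"
  shows "fdet (Suc n) X = (\<Sum>j<Suc n. X k j * ((-1) ^ (k + j) *
    fdet n (\<lambda>a b. X (skip_index k a) (skip_index j b))))"
proof -
  let ?A = "mat (Suc n) (Suc n) (\<lambda>(i, j). X i j)"
  have "det ?A = (\<Sum>j<Suc n. ?A $$ (k, j) * cofactor ?A k j)"
    by (rule laplace_expansion_row[OF _ assms]) simp
  also have "\<dots> = (\<Sum>j<Suc n. X k j * ((-1) ^ (k + j) *
    fdet n (\<lambda>a b. X (skip_index k a) (skip_index j b))))"
  proof (rule sum.cong[OF refl])
    fix j assume j: "j \<in> {..<Suc n}"
    have "mat_delete ?A k j = mat n n (\<lambda>(a, b). X (skip_index k a) (skip_index j b))"
      by (rule eq_matI) (auto simp: mat_delete_def skip_index_def)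
    then show "?A $$ (k, j) * cofactor ?A k j = X k j * ((-1) ^ (k + j) *
      fdet n (\<lambda>a b. X (skip_index k a) (skip_index j b)))"
      using assms j by (simp add: cofactor_def)
  qed
  finally show ?thesis .
qed

lemma fdet_expand_column:
  assumes "k < Suc n"
  shows "fdet (Suc n) X = (\<Sum>i<Suc n. X i k * ((-1) ^ (k + i) *
    fdet n (\<lambda>a b. X (skip_index i a) (skip_index k b))))"
proof -
  have "fdet (Suc n) X = fdet (Suc n) (\<lambda>i j. X j i)"
    by (rule fdet_transpose[symmetric])
  also have "\<dots> = (\<Sum>i<Suc n. X i k * ((-1) ^ (k + i) *
    fdet n (\<lambda>a b. X (skip_index i b) (skip_index k a))))"
    by (rule fdet_expand_row[OF assms])
  finally show ?thesis
    unfolding fdet_transpose[of n "\<lambda>a b. X (skip_index _ a) (skip_index _ b)"] .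
qed

lemma fdet_first_row_zero:
  assumes "\<And>j. j < n \<Longrightarrow> X 0 (Suc j) = 0"
  shows "fdet (Suc n) X = X 0 0 * fdet n (\<lambda>i j. X (Suc i) (Suc j))"
  unfolding fdet_expand_row[OF zero_less_Suc, of n X] sum.lessThan_Suc_shift
  using assms by simp

lemma fdet_first_column_zero:
  assumes "\<And>i. i < n \<Longrightarrow> X (Suc i) 0 = 0"
  shows "fdet (Suc n) X = X 0 0 * fdet n (\<lambda>i j. X (Suc i) (Suc j))"
  unfolding fdet_expand_column[OF zero_less_Suc, of n X] sum.lessThan_Suc_shift
  using assms by simp

lemma fdet_zero_row:
  assumes "k < n" "\<And>j. j < n \<Longrightarrow> X k j = 0"
  shows "fdet n X = 0"
proof -
  obtain n' where n': "n = Suc n'" using assms(1) by (cases n) auto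
  show ?thesis unfolding n' fdet_expand_row[OF assms(1)[unfolded n'], of X]
    using assms(2) n' by simp
qed

lemma fdet_mult: "fdet n X * fdet n Y = fdet n (\<lambda>i j. \<Sum>k<n. X i k * Y k j)"
proof -
  have "mat n n (\<lambda>(i, j). X i j) * mat n n (\<lambda>(i, j). Y i j) = mat n n (\<lambda>(i, j). \<Sum>k<n. X i k * Y k j)"
    by (rule eq_matI) (auto simp: scalar_prod_def atLeast0LessThan)
  then show ?thesis using det_mult[of "mat n n (\<lambda>(i, j). X i j)" n "mat n n (\<lambda>(i, j). Y i j)"] by simp
qed

lemma fdet_diagonal: "fdet n (\<lambda>i j. if i = j then c else 0) = c ^ n"
proof -
  have "mat n n (\<lambda>(i, j). if i = j then c else 0) = c \<cdot>\<^sub>m 1\<^sub>m n" by (rule eq_matI) auto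
  then show ?thesis by simp
qed

text \<open>Chio's condensation: right multiplication by \<open>R\<close> replaces each later column
  by the pivot times it minus a multiple of the first column, which clears the first row. Powers of
  \<open>X 0 0\<close> are not cancelled because it may be a zero divisor.\<close>

lemma fdet_border_eliminate:
  "fdet (Suc n) X * X 0 0 ^ n
    = X 0 0 * fdet n (\<lambda>i j. X 0 0 * X (Suc i) (Suc j) - X (Suc i) 0 * X 0 (Suc j))"
proof -
  define R where "R i j = (case (i, j) of (0, 0) \<Rightarrow> 1 | (0, Suc j) \<Rightarrow> - X 0 (Suc j)
    | (Suc i, 0) \<Rightarrow> 0 | (Suc i, Suc j) \<Rightarrow> if i = j then X 0 0 else 0)" for i j
  have "fdet (Suc n) R = X 0 0 ^ n"
    by (subst fdet_first_column_zero) (simp_all add: R_def fdet_diagonal)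
  moreover have "fdet (Suc n) (\<lambda>i j. \<Sum>k<Suc n. X i k * R k j)
    = X 0 0 * fdet n (\<lambda>i j. X 0 0 * X (Suc i) (Suc j) - X (Suc i) 0 * X 0 (Suc j))"
  proof (subst fdet_first_row_zero)
    have sum: "(\<Sum>k<Suc n. X i k * R k (Suc j)) = X 0 0 * X i (Suc j) - X i 0 * X 0 (Suc j)"
      if "j < n" for i j
    proof -
      have "(\<Sum>k<n. X i (Suc k) * R (Suc k) (Suc j)) = (\<Sum>k<n. if k = j then X i (Suc j) * X 0 0 else 0)"
        by (rule sum.cong) (auto simp: R_def)
      then show ?thesis unfolding sum.lessThan_Suc_shift using that by (simp add: R_def)
    qed
    show "(\<Sum>k<Suc n. X 0 k * R k (Suc j)) = 0" if "j < n" for j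
      using sum[OF that, of 0] by simp
    have "(\<Sum>k<Suc n. X 0 k * R k 0) = X 0 0"
      unfolding sum.lessThan_Suc_shift by (simp add: R_def)
    moreover have "fdet n (\<lambda>i j. \<Sum>k<Suc n. X (Suc i) k * R k (Suc j))
      = fdet n (\<lambda>i j. X 0 0 * X (Suc i) (Suc j) - X (Suc i) 0 * X 0 (Suc j))"
      by (rule fdet_cong) (rule sum)
    ultimately show "(\<Sum>k<Suc n. X 0 k * R k 0) * fdet n (\<lambda>i j. \<Sum>k<Suc n. X (Suc i) k * R k (Suc j))
      = X 0 0 * fdet n (\<lambda>i j. X 0 0 * X (Suc i) (Suc j) - X (Suc i) 0 * X 0 (Suc j))" by simp
  qed
  ultimately show ?thesis using fdet_mult[of "Suc n" X R] by simp
qed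

text \<open>In the bordered matrix, adding \<open>v j\<close> times the border column to the column
  of \<open>Y\<close> with index \<open>j\<close> clears the first row; this unipotent operation is
  right multiplication by \<open>R\<close>.\<close>

lemma fdet_rank_one_update:
  "fdet n (\<lambda>i j. Y i j + u i * v j) = fdet (Suc n) (\<lambda>i j. case (i, j) of (0, 0) \<Rightarrow> 1
    | (0, Suc j) \<Rightarrow> - v j | (Suc i, 0) \<Rightarrow> u i | (Suc i, Suc j) \<Rightarrow> Y i j)"
proof -
  define N where "N i j = (case (i, j) of (0, 0) \<Rightarrow> 1
    | (0, Suc j) \<Rightarrow> - v j | (Suc i, 0) \<Rightarrow> u i | (Suc i, Suc j) \<Rightarrow> Y i j)" for i j
  define R where "R i j = (case (i, j) of (0, 0) \<Rightarrow> 1 | (0, Suc j) \<Rightarrow> v j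
    | (Suc i, 0) \<Rightarrow> 0 | (Suc i, Suc j) \<Rightarrow> if i = j then 1 else (0::'a))" for i j
  have "fdet (Suc n) R = 1"
    by (subst fdet_first_column_zero) (simp_all add: R_def fdet_diagonal)
  moreover have "fdet (Suc n) (\<lambda>i j. \<Sum>k<Suc n. N i k * R k j) = fdet n (\<lambda>i j. Y i j + u i * v j)"
  proof (subst fdet_first_row_zero)
    have sum: "(\<Sum>k<Suc n. N i k * R k (Suc j)) = N i 0 * v j + N i (Suc j)"
      if "j < n" for i j
    proof -
      have "(\<Sum>k<n. N i (Suc k) * R (Suc k) (Suc j)) = (\<Sum>k<n. if k = j then N i (Suc j) else 0)"
        by (rule sum.cong) (auto simp: R_def)
      then show ?thesis unfolding sum.lessThan_Suc_shift using that by (simp add: R_def)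
    qed
    show "(\<Sum>k<Suc n. N 0 k * R k (Suc j)) = 0" if "j < n" for j
      using sum[OF that, of 0] by (simp add: N_def)
    have "(\<Sum>k<Suc n. N 0 k * R k 0) = 1"
      unfolding sum.lessThan_Suc_shift by (simp add: R_def N_def)
    moreover have "fdet n (\<lambda>i j. \<Sum>k<Suc n. N (Suc i) k * R k (Suc j))
      = fdet n (\<lambda>i j. Y i j + u i * v j)"
      by (rule fdet_cong) (simp only: sum, simp add: N_def)
    ultimately show "(\<Sum>k<Suc n. N 0 k * R k 0) * fdet n (\<lambda>i j. \<Sum>k<Suc n. N (Suc i) k * R k (Suc j))
      = fdet n (\<lambda>i j. Y i j + u i * v j)" by simp
  qed
  ultimately show ?thesis using fdet_mult[of "Suc n" N R] by (simp add: N_def)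
qed

lemma fdet_row_add_multiple:
  assumes "k < n"
  shows "fdet n (\<lambda>i j. if i = k then A j + c * B j else X i j)
    = fdet n (\<lambda>i j. if i = k then A j else X i j) + c * fdet n (\<lambda>i j. if i = k then B j else X i j)"
proof -
  obtain n' where n': "n = Suc n'" using assms by (cases n) auto
  have k: "k < Suc n'" using assms n' by simp
  show ?thesis
    unfolding n' fdet_expand_row[OF k] sum_distrib_left
    by (simp add: sum.distrib distrib_right distrib_left mult.assoc del: sum.lessThan_Suc)
qed

section \<open>Divisibility of all minors of a fixed size\<close>

lemma dvd_prod_diff:
  fixes x y :: "'i \<Rightarrow> 'a::comm_ring_1"
  assumes "\<And>i. i \<in> A \<Longrightarrow> t dvd x i - y i"
  shows "t dvd (\<Prod>i\<in>A. x i) - (\<Prod>i\<in>A. y i)"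
  using assms
proof (induction A rule: infinite_finite_induct)
  case (insert a A)
  have "x a * prod x A - y a * prod y A = (x a - y a) * prod x A + y a * (prod x A - prod y A)"
    by (simp add: algebra_simps)
  moreover have "t dvd x a - y a" "t dvd prod x A - prod y A" using insert by auto
  ultimately show ?case using insert.hyps by (simp add: dvd_add dvd_mult dvd_mult2)
qed auto

lemma dvd_fdet_diff:
  assumes "\<And>i j. i < n \<Longrightarrow> j < n \<Longrightarrow> t dvd X i j - Y i j"
  shows "t dvd fdet n X - fdet n Y"
  unfolding fdet_leibniz sum_subtractf[symmetric] right_diff_distrib[symmetric]
proof (intro dvd_sum dvd_mult dvd_prod_diff)
  fix \<sigma> i assume "\<sigma> \<in> {\<sigma>. \<sigma> permutes {..<n}}" "i \<in> {..<n}"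
  then show "t dvd X i (\<sigma> i) - Y i (\<sigma> i)"
    using permutes_in_image[of \<sigma> "{..<n}" i] by (intro assms) auto
qed

text \<open>Rows and columns are chosen by arbitrary maps: repeated indices only contribute zero
  minors, and the family is stable under bordering and replacement of a row. With
  \<open>fps_X ^ k\<close> for \<open>t\<close> it expresses vanishing of the minors in the
  truncated ring.\<close>

definition minors_dvd :: "'a::comm_ring_1 \<Rightarrow> nat set \<Rightarrow> nat set \<Rightarrow> nat \<Rightarrow> (nat \<Rightarrow> nat \<Rightarrow> 'a) \<Rightarrow> bool" where
  "minors_dvd t A B r X \<longleftrightarrow> (\<forall>f g. (\<forall>a<r. f a \<in> A) \<longrightarrow> (\<forall>b<r. g b \<in> B) \<longrightarrow>
    t dvd fdet r (\<lambda>a b. X (f a) (g b)))"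

lemma minors_dvdD:
  "minors_dvd t A B r X \<Longrightarrow> (\<And>a. a < r \<Longrightarrow> f a \<in> A) \<Longrightarrow> (\<And>b. b < r \<Longrightarrow> g b \<in> B) \<Longrightarrow>
    t dvd fdet r (\<lambda>a b. X (f a) (g b))"
  by (simp add: minors_dvd_def)

lemma minors_dvdI:
  "(\<And>f g. (\<And>a. a < r \<Longrightarrow> f a \<in> A) \<Longrightarrow> (\<And>b. b < r \<Longrightarrow> g b \<in> B) \<Longrightarrow>
    t dvd fdet r (\<lambda>a b. X (f a) (g b))) \<Longrightarrow> minors_dvd t A B r X"
  by (simp add: minors_dvd_def)

lemma minors_dvd_transpose:
  assumes "minors_dvd t A B r X"
  shows "minors_dvd t B A r (\<lambda>i j. X j i)"
proof (rule minors_dvdI)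
  fix f g assume "\<And>a. a < r \<Longrightarrow> f a \<in> B" "\<And>b. b < r \<Longrightarrow> g b \<in> A"
  then have "t dvd fdet r (\<lambda>a b. X (g a) (f b))" by (intro minors_dvdD[OF assms])
  then show "t dvd fdet r (\<lambda>a b. X (g b) (f a))"
    using fdet_transpose[of r "\<lambda>a b. X (g a) (f b)"] by simp
qed

lemma dvd_diff_cong_iff: "t dvd x - y \<Longrightarrow> t dvd x \<longleftrightarrow> t dvd (y::'a::comm_ring_1)"
  using dvd_add_right_iff[of t "x - y" y] by simp

lemma minors_dvd_cong:
  assumes "\<And>i j. i \<in> A \<Longrightarrow> j \<in> B \<Longrightarrow> t dvd X i j - Y i j"
  shows "minors_dvd t A B r X \<longleftrightarrow> minors_dvd t A B r Y"
proof -
  have "t dvd fdet r (\<lambda>a b. X (f a) (g b)) - fdet r (\<lambda>a b. Y (f a) (g b))"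
    if "\<forall>a<r. f a \<in> A" "\<forall>b<r. g b \<in> B" for f g
    by (rule dvd_fdet_diff) (use assms that in auto)
  then show ?thesis unfolding minors_dvd_def using dvd_diff_cong_iff by blast
qed

text \<open>The determinant is linear in row \<open>i0\<close>, and the additional term is the minor
  with \<open>i0\<close> replaced by \<open>a0\<close>. Index maps that repeat a row are treated
  first, since \<open>i0\<close> could occur twice in them.\<close>

lemma minors_dvd_add_row:
  assumes X: "minors_dvd t A B r X" and i0: "a0 \<in> A"
  shows "minors_dvd t A B r (\<lambda>i j. if i = i0 then X i0 j + c * X a0 j else X i j)" (is "minors_dvd t A B r ?Y")
proof (rule minors_dvdI)
  fix f g assume f: "\<And>a. a < r \<Longrightarrow> f a \<in> A" and g: "\<And>b. b < r \<Longrightarrow> g b \<in> B"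
  show "t dvd fdet r (\<lambda>a b. ?Y (f a) (g b))"
  proof (cases "inj_on f {..<r}")
    case False
    then obtain a b where "a < r" "b < r" "a \<noteq> b" "f a = f b" by (auto simp: inj_on_def)
    then have "fdet r (\<lambda>a b. ?Y (f a) (g b)) = 0" by (intro fdet_identical_rows[of a r b]) auto
    then show ?thesis by simp
  next
    case inj: True
    show ?thesis
    proof (cases "\<exists>k<r. f k = i0")
      case False
      then have "fdet r (\<lambda>a b. ?Y (f a) (g b)) = fdet r (\<lambda>a b. X (f a) (g b))"
        by (intro fdet_cong) auto
      then show ?thesis using minors_dvdD[OF X f g] by simp
    next
      case True
      then obtain k where k: "k < r" "f k = i0" by blast
      have fk: "f a = i0 \<longleftrightarrow> a = k" if "a < r" for a
        using inj k that by (auto simp: inj_on_def)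
      have "fdet r (\<lambda>a b. ?Y (f a) (g b))
        = fdet r (\<lambda>a b. if a = k then X i0 (g b) + c * X a0 (g b) else X (f a) (g b))"
        by (rule fdet_cong) (simp add: fk)
      also have "\<dots> = fdet r (\<lambda>a b. if a = k then X i0 (g b) else X (f a) (g b))
        + c * fdet r (\<lambda>a b. if a = k then X a0 (g b) else X (f a) (g b))"
        by (rule fdet_row_add_multiple[OF k(1)])
      also have "fdet r (\<lambda>a b. if a = k then X i0 (g b) else X (f a) (g b))
        = fdet r (\<lambda>a b. X (f a) (g b))"
        by (rule fdet_cong) (simp add: k(2))
      also have "fdet r (\<lambda>a b. if a = k then X a0 (g b) else X (f a) (g b))
        = fdet r (\<lambda>a b. X ((f(k := a0)) a) (g b))"
        by (rule fdet_cong) simp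
      finally show ?thesis
        using minors_dvdD[OF X f g] minors_dvdD[OF X, of "f(k := a0)" g] f g i0 by simp
    qed
  qed
qed

lemma minors_dvd_Suc:
  assumes "minors_dvd t A B r X"
  shows "minors_dvd t A B (Suc r) X"
proof (rule minors_dvdI)
  fix f g assume f: "\<And>a. a < Suc r \<Longrightarrow> f a \<in> A" and g: "\<And>b. b < Suc r \<Longrightarrow> g b \<in> B"
  show "t dvd fdet (Suc r) (\<lambda>a b. X (f a) (g b))"
    unfolding fdet_expand_row[OF zero_less_Suc]
    by (intro dvd_sum dvd_mult minors_dvdD[OF assms, of "\<lambda>a. f (skip_index 0 a)" "\<lambda>b. g (skip_index _ b)"]
      f g skip_index_less)
qed

text \<open>A rank one summand raises the rank by at most one: expanding the bordered determinant
  along its first row, and then along the border column, leaves only minors of \<open>Y\<close> of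
  size \<open>r\<close> or \<open>Suc r\<close>.\<close>

lemma minors_dvd_rank_one_update:
  assumes Y: "minors_dvd t A B r Y"
  shows "minors_dvd t A B (Suc r) (\<lambda>i j. Y i j + u i * v j)"
proof (rule minors_dvdI)
  fix f g assume f: "\<And>a. a < Suc r \<Longrightarrow> f a \<in> A" and g: "\<And>b. b < Suc r \<Longrightarrow> g b \<in> B"
  define N where "N i j = (case (i, j) of (0, 0) \<Rightarrow> 1 | (0, Suc j) \<Rightarrow> - v (g j)
    | (Suc i, 0) \<Rightarrow> u (f i) | (Suc i, Suc j) \<Rightarrow> Y (f i) (g j))" for i j
  have "t dvd fdet (Suc r) (\<lambda>a b. N (Suc a) (skip_index j b))" if j: "j < Suc (Suc r)" for j
  proof (cases j)
    case 0
    have "t dvd fdet (Suc r) (\<lambda>a b. Y (f a) (g b))"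
      by (rule minors_dvdD[OF minors_dvd_Suc[OF Y] f g])
    then show ?thesis using 0 by (simp add: N_def)
  next
    case (Suc j')
    have "t dvd fdet r (\<lambda>a b. Y (f (skip_index i a)) (g (skip_index j' b)))" for i
      by (intro minors_dvdD[OF Y, of "\<lambda>a. f (skip_index i a)" "\<lambda>b. g (skip_index j' b)"] f g skip_index_less)
    then show ?thesis
      unfolding Suc fdet_expand_column[OF zero_less_Suc]
      by (intro dvd_sum dvd_mult) (simp add: N_def)
  qed
  then have "t dvd fdet (Suc (Suc r)) N"
    unfolding fdet_expand_row[OF zero_less_Suc, of "Suc r" N] skip_index_0
    by (intro dvd_sum dvd_mult) simp
  then show "t dvd fdet (Suc r) (\<lambda>a b. Y (f a) (g b) + u (f a) * v (g b))"
    unfolding fdet_rank_one_update N_def .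
qed

text \<open>\<open>unit\<close> says that the pivot can be cancelled modulo \<open>t\<close>. One
  direction borders a minor by the pivot row and column; in the other, the pivot times
  \<open>X\<close> is the eliminated matrix plus the product of a column and a row, so the rank one
  bound applies.\<close>

theorem minors_dvd_eliminate:
  fixes X :: "nat \<Rightarrow> nat \<Rightarrow> 'a::comm_ring_1"
  assumes i0: "i0 \<in> A" and j0: "j0 \<in> B"
    and unit: "\<And>x. t dvd X i0 j0 * x \<Longrightarrow> t dvd x"
  shows "minors_dvd t A B (Suc r) X \<longleftrightarrow>
    minors_dvd t A B r (\<lambda>i j. X i0 j0 * X i j - X i j0 * X i0 j)"
proof -
  let ?a = "X i0 j0" and ?Y = "\<lambda>i j. X i0 j0 * X i j - X i j0 * X i0 j"
  have unit_pow: "t dvd ?a ^ e * x \<Longrightarrow> t dvd x" for e x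
  proof (induction e)
    case (Suc e)
    then have "t dvd ?a * (?a ^ e * x)" by (simp add: mult.assoc)
    then show ?case using unit Suc.IH by blast
  qed simp
  show ?thesis
  proof
    assume X: "minors_dvd t A B (Suc r) X"
    show "minors_dvd t A B r ?Y"
    proof (rule minors_dvdI)
      fix f g assume f: "\<And>a. a < r \<Longrightarrow> f a \<in> A" and g: "\<And>b. b < r \<Longrightarrow> g b \<in> B"
      define f' where "f' a = (case a of 0 \<Rightarrow> i0 | Suc a \<Rightarrow> f a)" for a
      define g' where "g' b = (case b of 0 \<Rightarrow> j0 | Suc b \<Rightarrow> g b)" for b
      have "t dvd fdet (Suc r) (\<lambda>a b. X (f' a) (g' b))"
        by (rule minors_dvdD[OF X]) (auto simp: f'_def g'_def f g i0 j0 split: nat.split)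
      then have "t dvd fdet (Suc r) (\<lambda>a b. X (f' a) (g' b)) * X (f' 0) (g' 0) ^ r" by simp
      then have "t dvd ?a * fdet r (\<lambda>a b. ?Y (f a) (g b))"
        unfolding fdet_border_eliminate[of r "\<lambda>a b. X (f' a) (g' b)"] by (simp add: f'_def g'_def)
      then show "t dvd fdet r (\<lambda>a b. ?Y (f a) (g b))" by (rule unit)
    qed
  next
    assume "minors_dvd t A B r ?Y"
    then have Y: "minors_dvd t A B (Suc r) (\<lambda>i j. ?Y i j + X i j0 * X i0 j)"
      by (rule minors_dvd_rank_one_update)
    show "minors_dvd t A B (Suc r) X"
    proof (rule minors_dvdI)
      fix f g assume f: "\<And>a. a < Suc r \<Longrightarrow> f a \<in> A" and g: "\<And>b. b < Suc r \<Longrightarrow> g b \<in> B"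
      have "t dvd fdet (Suc r) (\<lambda>a b. ?Y (f a) (g b) + X (f a) j0 * X i0 (g b))"
        by (rule minors_dvdD[OF Y f g])
      also have "fdet (Suc r) (\<lambda>a b. ?Y (f a) (g b) + X (f a) j0 * X i0 (g b))
        = fdet (Suc r) (\<lambda>a b. ?a * X (f a) (g b))"
        by (rule fdet_cong) (rule diff_add_cancel)
      finally have "t dvd fdet (Suc r) (\<lambda>a b. ?a * X (f a) (g b))" .
      then show "t dvd fdet (Suc r) (\<lambda>a b. X (f a) (g b))"
        unfolding fdet_scale by (rule unit_pow)
    qed
  qed
qed

lemma minors_dvd_drop_zero_rows:
  assumes zero: "\<And>i j. i \<in> A - A' \<Longrightarrow> j \<in> B \<Longrightarrow> X i j = 0" and sub: "A' \<subseteq> A"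
  shows "minors_dvd t A B r X \<longleftrightarrow> minors_dvd t A' B r X"
proof
  assume X: "minors_dvd t A B r X"
  show "minors_dvd t A' B r X"
    by (rule minors_dvdI) (rule minors_dvdD[OF X], use sub in auto)
next
  assume X: "minors_dvd t A' B r X"
  show "minors_dvd t A B r X"
  proof (rule minors_dvdI)
    fix f g assume f: "\<And>a. a < r \<Longrightarrow> f a \<in> A" and g: "\<And>b. b < r \<Longrightarrow> g b \<in> B"
    show "t dvd fdet r (\<lambda>a b. X (f a) (g b))"
    proof (cases "\<forall>a<r. f a \<in> A'")
      case True
      then show ?thesis by (intro minors_dvdD[OF X] g) auto
    next
      case False
      then obtain k where "k < r" "f k \<in> A - A'" using f by blast
      then have "fdet r (\<lambda>a b. X (f a) (g b)) = 0"
        using zero g by (intro fdet_zero_row[of k]) auto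
      then show ?thesis by simp
    qed
  qed
qed

text \<open>Meant for the pivot row and column, which are zero after elimination; columns are
  treated as rows of the transpose.\<close>

lemma minors_dvd_drop_zeros:
  assumes "\<And>i j. i \<in> A - A' \<Longrightarrow> j \<in> B \<Longrightarrow> X i j = 0" "A' \<subseteq> A"
    and "\<And>i j. i \<in> A' \<Longrightarrow> j \<in> B - B' \<Longrightarrow> X i j = 0" "B' \<subseteq> B"
  shows "minors_dvd t A B r X \<longleftrightarrow> minors_dvd t A' B' r X"
proof -
  have "minors_dvd t A' B r X \<longleftrightarrow> minors_dvd t B A' r (\<lambda>i j. X j i)"
    using minors_dvd_transpose[of t A' B r X] minors_dvd_transpose[of t B A' r "\<lambda>i j. X j i"] by auto
  also have "\<dots> \<longleftrightarrow> minors_dvd t B' A' r (\<lambda>i j. X j i)"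
    by (rule minors_dvd_drop_zero_rows) (use assms in auto)
  also have "\<dots> \<longleftrightarrow> minors_dvd t A' B' r X"
    using minors_dvd_transpose[of t A' B' r X] minors_dvd_transpose[of t B' A' r "\<lambda>i j. X j i"] by auto
  finally have "minors_dvd t A' B r X \<longleftrightarrow> minors_dvd t A' B' r X" .
  moreover have "minors_dvd t A B r X \<longleftrightarrow> minors_dvd t A' B r X"
    by (rule minors_dvd_drop_zero_rows[OF assms(1,2)])
  ultimately show ?thesis by simp
qed

text \<open>Index maps may repeat values, so arbitrary preimages under \<open>\<alpha>\<close> and
  \<open>\<beta>\<close> can be chosen.\<close>

lemma minors_dvd_reindex:
  assumes \<alpha>: "\<alpha> ` A = A'" and \<beta>: "\<beta> ` B = B'"
  shows "minors_dvd t A B r (\<lambda>i j. X (\<alpha> i) (\<beta> j)) \<longleftrightarrow> minors_dvd t A' B' r X"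
proof
  assume X: "minors_dvd t A' B' r X"
  show "minors_dvd t A B r (\<lambda>i j. X (\<alpha> i) (\<beta> j))"
  proof (rule minors_dvdI)
    fix f g assume "\<And>a. a < r \<Longrightarrow> f a \<in> A" "\<And>b. b < r \<Longrightarrow> g b \<in> B"
    then show "t dvd fdet r (\<lambda>a b. X (\<alpha> (f a)) (\<beta> (g b)))"
      using \<alpha> \<beta> by (intro minors_dvdD[OF X, of "\<lambda>a. \<alpha> (f a)" "\<lambda>b. \<beta> (g b)"]) auto
  qed
next
  assume X: "minors_dvd t A B r (\<lambda>i j. X (\<alpha> i) (\<beta> j))"
  show "minors_dvd t A' B' r X"
  proof (rule minors_dvdI)
    fix f g assume f: "\<And>a. a < r \<Longrightarrow> f a \<in> A'" and g: "\<And>b. b < r \<Longrightarrow> g b \<in> B'"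
    define f' where "f' a = inv_into A \<alpha> (f a)" for a
    define g' where "g' b = inv_into B \<beta> (g b)" for b
    have f': "f' a \<in> A" "\<alpha> (f' a) = f a" if "a < r" for a
      using f[OF that] \<alpha> unfolding f'_def by (auto intro: inv_into_into f_inv_into_f)
    have g': "g' b \<in> B" "\<beta> (g' b) = g b" if "b < r" for b
      using g[OF that] \<beta> unfolding g'_def by (auto intro: inv_into_into f_inv_into_f)
    have "t dvd fdet r (\<lambda>a b. X (\<alpha> (f' a)) (\<beta> (g' b)))"
      by (rule minors_dvdD[OF X]) (simp_all add: f' g')
    also have "fdet r (\<lambda>a b. X (\<alpha> (f' a)) (\<beta> (g' b))) = fdet r (\<lambda>a b. X (f a) (g b))"
      by (rule fdet_cong) (simp add: f' g')
    finally show "t dvd fdet r (\<lambda>a b. X (f a) (g b))" .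
  qed
qed

text \<open>Minors with repeated rows vanish and permuting rows only changes the sign, so it is enough to
  consider increasing enumerations of index sets.\<close>
lemma dvd_fdet_rows_from_sorted:
  assumes "finite A"
    and sorted: "\<And>R. R \<subseteq> A \<Longrightarrow> card R = r \<Longrightarrow> t dvd fdet r (\<lambda>a b. Z (sorted_list_of_set R ! a) b)"
    and f: "\<And>a. a < r \<Longrightarrow> f a \<in> A"
  shows "t dvd fdet r (\<lambda>a b. Z (f a) b)"
proof (cases "inj_on f {..<r}")
  case False
  then obtain a b where "a < r" "b < r" "a \<noteq> b" "f a = f b" by (auto simp: inj_on_def)
  then have "fdet r (\<lambda>a b. Z (f a) b) = 0" by (intro fdet_identical_rows[of a r b]) auto
  then show ?thesis by simp
next
  case True
  define R where "R = f ` {..<r}"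
  have R: "R \<subseteq> A" "card R = r" "finite R" using f True by (auto simp: R_def card_image)
  let ?rs = "sorted_list_of_set R"
  have len: "length ?rs = r" and set: "set ?rs = R" and dist: "distinct ?rs" using R by auto
  have bij: "bij_betw (\<lambda>a. ?rs ! a) {..<r} R"
    using bij_betw_nth[OF dist, of "{..<r}" R] len set by simp
  define p where "p a = (if a < r then the_inv_into {..<r} (\<lambda>a. ?rs ! a) (f a) else a)" for a
  have "bij_betw (the_inv_into {..<r} (\<lambda>a. ?rs ! a) \<circ> f) {..<r} {..<r}"
    by (rule bij_betw_trans[OF _ bij_betw_the_inv_into[OF bij]])
      (use True in \<open>auto simp: bij_betw_def R_def\<close>)
  then have "bij_betw p {..<r} {..<r}"
    by (rule bij_betw_cong[THEN iffD1, rotated]) (simp add: p_def)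
  then have perm: "p permutes {..<r}" by (rule bij_imp_permutes) (simp add: p_def)
  have pf: "?rs ! p a = f a" if "a < r" for a
    using f_the_inv_into_f_bij_betw[OF bij, of "f a"] that by (simp add: p_def R_def)
  have "fdet r (\<lambda>a b. Z (f a) b) = fdet r (\<lambda>a. (\<lambda>a b. Z (?rs ! a) b) (p a))"
    by (rule fdet_cong) (simp add: pf)
  also have "\<dots> = of_int (sign p) * fdet r (\<lambda>a b. Z (?rs ! a) b)"
    by (rule fdet_permute_rows[OF perm])
  finally show ?thesis using sorted[OF R(1,2)] by simp
qed

text \<open>Sorting the rows and then, through the transpose, the columns connects the condition
  with the generators in \<open>jet_gens\<close>.\<close>

lemma minors_dvd_iff_sorted:
  assumes fin: "finite A" "finite B"
  shows "minors_dvd t A B r X \<longleftrightarrow> (\<forall>R C. R \<subseteq> A \<longrightarrow> card R = r \<longrightarrow> C \<subseteq> B \<longrightarrow> card C = r \<longrightarrow>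
    t dvd fdet r (\<lambda>a b. X (sorted_list_of_set R ! a) (sorted_list_of_set C ! b)))" (is "_ \<longleftrightarrow> ?R")
proof
  assume X: "minors_dvd t A B r X"
  have mem: "sorted_list_of_set S ! a \<in> T" if "S \<subseteq> T" "card S = r" "finite T" "a < r" for S T a
  proof -
    have "finite S" using that finite_subset by blast
    then show ?thesis using nth_mem[of a "sorted_list_of_set S"] that by auto
  qed
  show ?R by (intro allI impI minors_dvdD[OF X] mem) (use fin in auto)
next
  assume R: ?R
  show "minors_dvd t A B r X"
  proof (rule minors_dvdI)
    fix f g assume f: "\<And>a. a < r \<Longrightarrow> f a \<in> A" and g: "\<And>b. b < r \<Longrightarrow> g b \<in> B"
    show "t dvd fdet r (\<lambda>a b. X (f a) (g b))"
    proof (rule dvd_fdet_rows_from_sorted[OF fin(1) _ f, where Z = "\<lambda>i b. X i (g b)"])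
      fix R' assume R': "R' \<subseteq> A" "card R' = r"
      let ?rs = "sorted_list_of_set R'"
      have "t dvd fdet r (\<lambda>b a. X (?rs ! a) (g b))"
      proof (rule dvd_fdet_rows_from_sorted[OF fin(2) _ g, where Z = "\<lambda>j a. X (?rs ! a) j"])
        fix C assume "C \<subseteq> B" "card C = r"
        then have "t dvd fdet r (\<lambda>a b. X (?rs ! a) (sorted_list_of_set C ! b))" using R R' by blast
        then show "t dvd fdet r (\<lambda>b a. X (?rs ! a) (sorted_list_of_set C ! b))"
          using fdet_transpose[of r "\<lambda>a b. X (?rs ! a) (sorted_list_of_set C ! b)"] by simp
      qed
      then show "t dvd fdet r (\<lambda>a b. X (?rs ! a) (g b))"
        using fdet_transpose[of r "\<lambda>a b. X (?rs ! a) (g b)"] by simp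
    qed
  qed
qed

section \<open>Jets of matrices\<close>

lemma fps_X_power_dvd_iff:
  fixes F :: "'a::comm_ring_1 fps"
  shows "fps_X ^ k dvd F \<longleftrightarrow> (\<forall>l<k. fps_nth F l = 0)"
proof
  assume "fps_X ^ k dvd F"
  then obtain G where "F = fps_X ^ k * G" by (rule dvdE)
  then show "\<forall>l<k. fps_nth F l = 0" by (simp add: fps_X_power_mult_nth)
next
  assume F: "\<forall>l<k. fps_nth F l = 0"
  have "F = fps_X ^ k * fps_shift k F"
    by (rule fps_ext) (use F in \<open>auto simp: fps_X_power_mult_nth\<close>)
  then show "fps_X ^ k dvd F" by (rule dvdI)
qed

lemma fps_X_power_dvd_diff_iff:
  fixes F :: "'a::comm_ring_1 fps"
  shows "fps_X ^ k dvd F - G \<longleftrightarrow> (\<forall>l<k. fps_nth F l = fps_nth G l)"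
  by (simp add: fps_X_power_dvd_iff)

lemma fps_X_power_dvd_unit:
  fixes F :: "'a::field fps"
  assumes "fps_nth F 0 \<noteq> 0" "t dvd F * x"
  shows "t dvd x"
proof -
  have "t dvd inverse F * (F * x)" using assms(2) by (rule dvd_mult)
  moreover have "inverse F * (F * x) = x"
    using inverse_mult_eq_1[OF assms(1)] by (simp flip: mult.assoc)
  ultimately show ?thesis by simp
qed

text \<open>The matrix \<open>X(t)\<close> at the point \<open>p\<close>, placed in
  \<open>fps\<close>, where a series over a field with nonzero constant term has an inverse.\<close>

definition jmat :: "nat \<Rightarrow> (nat \<times> nat \<times> nat \<Rightarrow> 'a::comm_ring_1) \<Rightarrow> nat \<Rightarrow> nat \<Rightarrow> 'a fps" where
  "jmat k p i j = Abs_fps (\<lambda>l. if l < k then p (i, j, l) else 0)"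

lemma jmat_nth [simp]: "fps_nth (jmat k p i j) l = (if l < k then p (i, j, l) else 0)"
  by (simp add: jmat_def)

text \<open>Specialization at \<open>p\<close> of polynomials in \<open>t\<close> over the
  coordinate ring; a ring homomorphism, hence compatible with minors.\<close>

definition eval_fps_of_poly :: "('v \<Rightarrow> 'a::comm_ring_1) \<Rightarrow> ('v, 'a) mpoly poly \<Rightarrow> 'a fps" where
  "eval_fps_of_poly p q = Abs_fps (\<lambda>l. peval p (coeff q l))"

lemma eval_fps_of_poly_nth [simp]: "fps_nth (eval_fps_of_poly p q) l = peval p (coeff q l)"
  by (simp add: eval_fps_of_poly_def)

lemma eval_fps_of_poly_0: "eval_fps_of_poly p 0 = 0"
  by (rule fps_ext) simp

lemma eval_fps_of_poly_1: "eval_fps_of_poly p 1 = 1"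
  by (rule fps_ext) (simp add: coeff_1)

lemma eval_fps_of_poly_add: "eval_fps_of_poly p (a + b) = eval_fps_of_poly p a + eval_fps_of_poly p b"
  by (rule fps_ext) simp

lemma eval_fps_of_poly_mult: "eval_fps_of_poly p (a * b) = eval_fps_of_poly p a * eval_fps_of_poly p b"
  by (rule fps_ext) (simp add: coeff_mult fps_mult_nth atLeast0AtMost)

lemma eval_fps_of_poly_sum: "eval_fps_of_poly p (\<Sum>i\<in>A. f i) = (\<Sum>i\<in>A. eval_fps_of_poly p (f i))"
  by (induction A rule: infinite_finite_induct) (auto simp: eval_fps_of_poly_0 eval_fps_of_poly_add)

lemma eval_fps_of_poly_prod: "eval_fps_of_poly p (\<Prod>i\<in>A. f i) = (\<Prod>i\<in>A. eval_fps_of_poly p (f i))"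
  by (induction A rule: infinite_finite_induct) (auto simp: eval_fps_of_poly_1 eval_fps_of_poly_mult)

lemma eval_fps_of_poly_of_int: "eval_fps_of_poly p (of_int z) = of_int z"
  by (rule fps_ext) (simp add: of_int_poly coeff_pCons fps_of_int[symmetric] split: nat.split del: fps_of_int)

lemma coeff_xentry: "coeff (xentry k i j) l = (if l < k then mvar (i, j, l) else 0)"
  by (simp add: xentry_def coeff_sum)

lemma eval_fps_of_poly_xentry: "eval_fps_of_poly p (xentry k i j) = jmat k p i j"
  by (rule fps_ext) (simp add: coeff_xentry)

lemma eval_fps_of_poly_minor:
  assumes "card R = r"
  shows "eval_fps_of_poly p (minor k R C)
    = fdet r (\<lambda>a b. jmat k p (sorted_list_of_set R ! a) (sorted_list_of_set C ! b))"
  unfolding minor_def Let_def assms fdet_leibniz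
  by (simp add: eval_fps_of_poly_sum eval_fps_of_poly_mult eval_fps_of_poly_prod
      eval_fps_of_poly_of_int eval_fps_of_poly_xentry)

lemma coeff_polyring_prod:
  assumes "\<And>i j. i \<in> A \<Longrightarrow> coeff (f i) j \<in> polyring V"
  shows "coeff (\<Prod>i\<in>A. f i) j \<in> polyring V"
  using assms
proof (induction A arbitrary: j rule: infinite_finite_induct)
  case (insert a A)
  then show ?case using coeff_polyring_mult[of "f a" V "prod f A" j] by simp
qed (simp_all add: coeff_1)

lemma of_int_polyring: "of_int z \<in> polyring V"
  by (metis polyring_const single_of_int)

lemma jet_gens_polyring: "jet_gens m n r k \<subseteq> polyring (Idx m n k)"
proof -
  have "coeff (minor k R C) l \<in> polyring (Idx m n k)"
    if RC: "R \<subseteq> {1..m}" "card R = r" "C \<subseteq> {1..n}" "card C = r" for R C l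
  proof -
    have mem: "sorted_list_of_set S ! a \<in> S" if "card S = r" "a < r" for S a
    proof -
      have "finite S" using that by (metis card.infinite less_nat_zero_code)
      then show ?thesis using nth_mem[of a "sorted_list_of_set S"] that by simp
    qed
    have entry: "coeff (xentry k (sorted_list_of_set R ! a) (sorted_list_of_set C ! \<sigma> a)) l \<in> polyring (Idx m n k)"
      if \<sigma>: "\<sigma> permutes {..<r}" and a: "a < r" for \<sigma> a l
    proof -
      have "sorted_list_of_set R ! a \<in> R" by (rule mem[OF RC(2) a])
      moreover have "\<sigma> a < r" using permutes_in_image[OF \<sigma>, of a] a by simp
      then have "sorted_list_of_set C ! \<sigma> a \<in> C" by (rule mem[OF RC(4)])
      ultimately have "(sorted_list_of_set R ! a, sorted_list_of_set C ! \<sigma> a, l) \<in> Idx m n k" if "l < k"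
        using RC(1,3) that by (auto simp: Idx_def)
      then show ?thesis by (auto simp: coeff_xentry polyring_mvar)
    qed
    show ?thesis
      unfolding minor_def Let_def coeff_sum RC(2)
    proof (rule polyring_sum)
      fix \<sigma> assume "\<sigma> \<in> {\<sigma>. \<sigma> permutes {..<r}}"
      then have \<sigma>: "\<sigma> permutes {..<r}" by simp
      show "coeff (of_int (sign \<sigma>) * (\<Prod>a<r. xentry k (sorted_list_of_set R ! a) (sorted_list_of_set C ! \<sigma> a))) l
        \<in> polyring (Idx m n k)"
      proof (rule coeff_polyring_mult)
        show "coeff (of_int (sign \<sigma>)) i \<in> polyring (Idx m n k)" for i
          by (simp add: of_int_poly coeff_pCons of_int_polyring split: nat.split)
        show "coeff (\<Prod>a<r. xentry k (sorted_list_of_set R ! a) (sorted_list_of_set C ! \<sigma> a)) i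
          \<in> polyring (Idx m n k)" for i
          by (rule coeff_polyring_prod) (use entry[OF \<sigma>] in simp)
      qed
    qed
  qed
  then show ?thesis by (auto simp: jet_gens_def)
qed

lemma is_ideal_jetI: "is_ideal (Idx m n k) (jetI m n r k)"
  unfolding jetI_def by (rule is_ideal_ideal_gen[OF jet_gens_polyring])

lemma mem_jetZ_iff:
  "p \<in> jetZ m n r k \<longleftrightarrow> p \<in> aff (Idx m n k) \<and> minors_dvd (fps_X ^ k) {1..m} {1..n} r (jmat k p)"
proof -
  have "p \<in> jetZ m n r k \<longleftrightarrow> p \<in> zeros (Idx m n k) (jet_gens m n r k)"
    by (simp add: jetZ_def jetI_def zeros_ideal_gen[OF jet_gens_polyring])
  also have "\<dots> \<longleftrightarrow> p \<in> aff (Idx m n k) \<and> (\<forall>R C. R \<subseteq> {1..m} \<longrightarrow> card R = r \<longrightarrow> C \<subseteq> {1..n} \<longrightarrow> card C = r \<longrightarrow>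
    (\<forall>l<k. fps_nth (eval_fps_of_poly p (minor k R C)) l = 0))"
    unfolding zeros_def jet_gens_def eval_fps_of_poly_nth by blast
  also have "\<dots> \<longleftrightarrow> p \<in> aff (Idx m n k) \<and> minors_dvd (fps_X ^ k) {1..m} {1..n} r (jmat k p)"
    by (simp add: minors_dvd_iff_sorted fps_X_power_dvd_iff eval_fps_of_poly_minor)
  finally show ?thesis .
qed

lemma jetZ_subset_aff: "jetZ m n r k \<subseteq> aff (Idx m n k)"
  by (auto simp: jetZ_def zeros_def)

lemma zclosed_jetZ: "zclosed (Idx m n k) (jetZ m n r k)"
  unfolding jetZ_def by (rule zclosed_zeros) (use ideal_subset[OF is_ideal_jetI] in blast)

lemma Idx_eq: "Idx m n k = {1..m} \<times> {1..n} \<times> {..<k}"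
  by (auto simp: Idx_def)

lemma finite_Idx [simp]: "finite (Idx m n k)"
  by (simp add: Idx_eq)

lemma card_Idx: "card (Idx m n k) = m * n * k"
  by (simp add: Idx_eq card_cartesian_product)

lemma affD: "p \<in> aff V \<Longrightarrow> v \<notin> V \<Longrightarrow> p v = 0"
  by (simp add: aff_def)

subsection \<open>Density of the basic open sets\<close>

text \<open>A polynomial vanishing on \<open>Y\<close> restricts to the curve as a univariate
  \<open>q\<close> with \<open>H * q\<close> zero everywhere, so \<open>q = 0\<close> also at the
  parameter 0.\<close>

lemma curve_mem_zclosure:
  fixes c :: "'a::field \<Rightarrow> 'v \<Rightarrow> 'a"
  assumes inf: "infinite (UNIV :: 'a set)" and Y: "Y \<subseteq> aff V"
    and c: "\<And>v. v \<in> V \<Longrightarrow> \<exists>q. \<forall>s. c s v = poly q s" and c0: "c 0 \<in> aff V"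
    and H: "H \<noteq> 0" "\<And>s. poly H s \<noteq> 0 \<Longrightarrow> c s \<in> Y"
  shows "c 0 \<in> zclosure V Y"
  unfolding mem_zclosure_iff[OF Y]
proof (intro conjI ballI impI c0)
  fix f assume f: "f \<in> polyring V" "\<forall>y\<in>Y. peval y f = 0"
  obtain q where q: "\<And>s. peval (c s) f = poly q s" using peval_curve[OF f(1), of c] c by blast
  have "q = 0"
  proof (rule ccontr)
    assume "q \<noteq> 0"
    then have "H * q \<noteq> 0" using H(1) by simp
    then obtain s where "poly (H * q) s \<noteq> 0" using poly_nonzero_value[OF inf] by blast
    then show False using H(2)[of s] f(2) q[of s] by auto
  qed
  then show "peval (c 0) f = 0" using q by simp
qed

lemma jetZ_add_row:
  assumes p: "p \<in> jetZ m n r k" and "i0 \<in> {1..m}" "a0 \<in> {1..m}"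
  shows "(\<lambda>(i, j, l). if i = i0 then p (i0, j, l) + s * p (a0, j, l) else p (i, j, l)) \<in> jetZ m n r k"
    (is "?q \<in> _")
proof -
  have p': "p \<in> aff (Idx m n k)" "minors_dvd (fps_X ^ k) {1..m} {1..n} r (jmat k p)"
    using p by (simp_all add: mem_jetZ_iff)
  have "?q \<in> aff (Idx m n k)" using p'(1) assms(2,3) by (auto simp: aff_def Idx_def)
  moreover have "jmat k ?q = (\<lambda>i j. if i = i0 then jmat k p i0 j + fps_const s * jmat k p a0 j else jmat k p i j)"
    by (intro ext fps_ext) simp
  ultimately show ?thesis
    using minors_dvd_add_row[OF p'(2) assms(3), of i0 "fps_const s"] by (simp add: mem_jetZ_iff)
qed

lemma jetZ_transpose:
  assumes "p \<in> jetZ m n r k"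
  shows "(\<lambda>(i, j, l). p (j, i, l)) \<in> jetZ n m r k"
proof -
  have "jmat k (\<lambda>(i, j, l). p (j, i, l)) = (\<lambda>i j. jmat k p j i)" by (intro ext fps_ext) simp
  then show ?thesis
    using assms minors_dvd_transpose[of "fps_X ^ k" "{1..m}" "{1..n}" r "jmat k p"]
    by (auto simp: mem_jetZ_iff aff_def Idx_def)
qed

lemma jetZ_add_column:
  assumes p: "p \<in> jetZ m n r k" and "j0 \<in> {1..n}" "b0 \<in> {1..n}"
  shows "(\<lambda>(i, j, l). if j = j0 then p (i, j0, l) + s * p (i, b0, l) else p (i, j, l)) \<in> jetZ m n r k"
proof -
  let ?q = "\<lambda>(j, i, l). if j = j0 then p (i, j0, l) + s * p (i, b0, l) else p (i, j, l)"
  let ?p = "\<lambda>(i, j, l). p (j, i, l)"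
  have "(\<lambda>(j, i, l). if j = j0 then ?p (j0, i, l) + s * ?p (b0, i, l) else ?p (j, i, l)) \<in> jetZ n m r k"
    by (rule jetZ_add_row[OF jetZ_transpose[OF p] assms(2,3)])
  then have "?q \<in> jetZ n m r k" by (simp only: case_prod_conv)
  then have "(\<lambda>(i, j, l). ?q (j, i, l)) \<in> jetZ m n r k" by (rule jetZ_transpose)
  then show ?thesis by (simp only: case_prod_conv)
qed

text \<open>Sets \<open>T\<close> of several positions interpolate between a single locus
  \<open>U_ij\<close> and \<open>U\<close>, for which \<open>T\<close> contains all
  positions.\<close>

definition nonvanishing_jets :: "nat \<Rightarrow> nat \<Rightarrow> nat \<Rightarrow> nat \<Rightarrow> (nat \<times> nat) set
    \<Rightarrow> (nat \<times> nat \<times> nat \<Rightarrow> 'a::field) set" where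
  "nonvanishing_jets m n r k T = {p \<in> jetZ m n r k. \<forall>(i, j)\<in>T. p (i, j, 0) \<noteq> 0}"

lemma nonvanishing_jets_subset_aff: "nonvanishing_jets m n r k T \<subseteq> aff (Idx m n k)"
  unfolding nonvanishing_jets_def using jetZ_subset_aff[of m n r k] by blast

lemma nonvanishing_jets_curve:
  fixes c :: "'a::field \<Rightarrow> nat \<times> nat \<times> nat \<Rightarrow> 'a"
  assumes inf: "infinite (UNIV :: 'a set)" and T: "finite T"
    and c: "\<And>v. \<exists>q. \<forall>s. c s v = poly q s" and Z: "\<And>s. c s \<in> jetZ m n r k"
    and ne: "\<And>i j. (i, j) \<in> T \<Longrightarrow> \<exists>s. c s (i, j, 0) \<noteq> 0"
  shows "c 0 \<in> zclosure (Idx m n k) (nonvanishing_jets m n r k T)"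
proof -
  obtain h where h: "\<And>v s. c s v = poly (h v) s" using c by metis
  define H where "H = (\<Prod>(i, j)\<in>T. h (i, j, 0))"
  show ?thesis
  proof (rule curve_mem_zclosure[OF inf nonvanishing_jets_subset_aff c])
    show "c 0 \<in> aff (Idx m n k)" using Z jetZ_subset_aff by blast
    have "h (i, j, 0) \<noteq> 0" if "(i, j) \<in> T" for i j using ne[OF that] h by auto
    then show "H \<noteq> 0" using T unfolding H_def by (auto simp: prod_zero_iff)
    fix s assume "poly H s \<noteq> 0"
    then have "\<forall>(i, j)\<in>T. c s (i, j, 0) \<noteq> 0"
      using T by (auto simp: H_def poly_prod h case_prod_unfold)
    then show "c s \<in> nonvanishing_jets m n r k T" using Z by (simp add: nonvanishing_jets_def)
  qed
qed

text \<open>Adding \<open>s\<close> times one row to another stays inside the jet scheme and makes a further entry nonzero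
  for all but finitely many \<open>s\<close>.\<close>
lemma nonvanishing_jets_add_row:
  fixes p :: "nat \<times> nat \<times> nat \<Rightarrow> 'a::field"
  assumes inf: "infinite (UNIV :: 'a set)" and T: "finite T" "(a, b) \<in> T"
    and ai: "a \<in> {1..m}" "i \<in> {1..m}" and p: "p \<in> nonvanishing_jets m n r k T"
  shows "p \<in> zclosure (Idx m n k) (nonvanishing_jets m n r k (insert (i, b) T))"
proof (cases "i = a")
  case True
  then show ?thesis using zclosure_superset T(2) p by (metis insert_absorb subsetD)
next
  case False
  have pZ: "p \<in> jetZ m n r k" and pT: "\<And>i j. (i, j) \<in> T \<Longrightarrow> p (i, j, 0) \<noteq> 0"
    using p by (auto simp: nonvanishing_jets_def)
  define c where "c s = (\<lambda>(i', j, l). if i' = i then p (i, j, l) + s * p (a, j, l) else p (i', j, l))" for s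
  have c0: "c 0 = p" by (auto simp: c_def fun_eq_iff)
  have "c 0 \<in> zclosure (Idx m n k) (nonvanishing_jets m n r k (insert (i, b) T))"
  proof (rule nonvanishing_jets_curve[OF inf])
    show "\<exists>q. \<forall>s. c s v = poly q s" for v
      by (cases v, rename_tac i' j l, rule_tac x = "if i' = i then [:p (i, j, l), p (a, j, l):] else [:p (i', j, l):]" in exI)
        (simp add: c_def)
    show "c s \<in> jetZ m n r k" for s unfolding c_def by (rule jetZ_add_row[OF pZ ai(2,1)])
    fix i' j assume ij: "(i', j) \<in> insert (i, b) T"
    show "\<exists>s. c s (i', j, 0) \<noteq> 0"
    proof (cases "(i', j) \<in> T")
      case True
      then show ?thesis using pT c0 by (intro exI[of _ 0]) simp
    next
      case F: False
      \<comment> \<open>The parameter is chosen to turn the new entry into 1.\<close>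
      have "p (i, b, 0) + (1 - p (i, b, 0)) / p (a, b, 0) * p (a, b, 0) \<noteq> 0"
        using pT[OF T(2)] by simp
      then have "c ((1 - p (i, b, 0)) / p (a, b, 0)) (i, b, 0) \<noteq> 0"
        by (simp only: c_def case_prod_conv if_True refl not_False_eq_True)
      then show ?thesis using ij F by blast
    qed
  qed (use T in simp)
  then show ?thesis using c0 by simp
qed

lemma nonvanishing_jets_add_column:
  fixes p :: "nat \<times> nat \<times> nat \<Rightarrow> 'a::field"
  assumes inf: "infinite (UNIV :: 'a set)" and T: "finite T" "(a, b) \<in> T"
    and bj: "b \<in> {1..n}" "j \<in> {1..n}" and p: "p \<in> nonvanishing_jets m n r k T"
  shows "p \<in> zclosure (Idx m n k) (nonvanishing_jets m n r k (insert (a, j) T))"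
proof (cases "j = b")
  case True
  then show ?thesis using zclosure_superset T(2) p by (metis insert_absorb subsetD)
next
  case False
  have pZ: "p \<in> jetZ m n r k" and pT: "\<And>i j. (i, j) \<in> T \<Longrightarrow> p (i, j, 0) \<noteq> 0"
    using p by (auto simp: nonvanishing_jets_def)
  define c where "c s = (\<lambda>(i, j', l). if j' = j then p (i, j, l) + s * p (i, b, l) else p (i, j', l))" for s
  have c0: "c 0 = p" by (auto simp: c_def fun_eq_iff)
  have "c 0 \<in> zclosure (Idx m n k) (nonvanishing_jets m n r k (insert (a, j) T))"
  proof (rule nonvanishing_jets_curve[OF inf])
    show "\<exists>q. \<forall>s. c s v = poly q s" for v
      by (cases v, rename_tac i j' l, rule_tac x = "if j' = j then [:p (i, j, l), p (i, b, l):] else [:p (i, j', l):]" in exI)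
        (simp add: c_def)
    show "c s \<in> jetZ m n r k" for s unfolding c_def by (rule jetZ_add_column[OF pZ bj(2,1)])
    fix i j' assume ij: "(i, j') \<in> insert (a, j) T"
    show "\<exists>s. c s (i, j', 0) \<noteq> 0"
    proof (cases "(i, j') \<in> T")
      case True
      then show ?thesis using pT c0 by (intro exI[of _ 0]) simp
    next
      case F: False
      have "p (a, j, 0) + (1 - p (a, j, 0)) / p (a, b, 0) * p (a, b, 0) \<noteq> 0"
        using pT[OF T(2)] by simp
      then have "c ((1 - p (a, j, 0)) / p (a, b, 0)) (a, j, 0) \<noteq> 0"
        by (simp only: c_def case_prod_conv if_True refl not_False_eq_True)
      then show ?thesis using ij F by blast
    qed
  qed (use T in simp)
  then show ?thesis using c0 by simp
qed

lemma nonvanishing_jets_antimono: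
  "S \<subseteq> T \<Longrightarrow> nonvanishing_jets m n r k T \<subseteq> nonvanishing_jets m n r k S"
  by (auto simp: nonvanishing_jets_def)

text \<open>From a nonzero entry at \<open>(a, b)\<close>, a row operation reaches
  \<open>(i, b)\<close> and a column operation then \<open>(i, j)\<close>; afterwards the
  intermediate condition is dropped.\<close>

lemma zclosure_nonvanishing_jets_insert:
  assumes inf: "infinite (UNIV :: 'a::field set)" and T: "finite T" "T \<noteq> {}" "T \<subseteq> {1..m} \<times> {1..n}"
    and ij: "i \<in> {1..m}" "j \<in> {1..n}"
  shows "zclosure (Idx m n k) (nonvanishing_jets m n r k T :: (_ \<Rightarrow> 'a) set)
    \<subseteq> zclosure (Idx m n k) (nonvanishing_jets m n r k (insert (i, j) T))"
proof -
  let ?N = "\<lambda>T. nonvanishing_jets m n r k T :: (_ \<Rightarrow> 'a) set"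
  let ?c = "zclosure (Idx m n k) :: (_ \<Rightarrow> 'a) set \<Rightarrow> _"
  obtain a b where ab: "(a, b) \<in> T" using T(2) by auto
  have ab': "a \<in> {1..m}" "b \<in> {1..n}" using ab T(3) by auto
  have "?c (?N T) \<subseteq> ?c (?N (insert (i, b) T))"
    by (intro zclosure_subset_zclosure nonvanishing_jets_subset_aff subsetI
        nonvanishing_jets_add_row[OF inf T(1) ab ab'(1) ij(1)])
  also have "\<dots> \<subseteq> ?c (?N (insert (i, j) (insert (i, b) T)))"
    using nonvanishing_jets_add_column[OF inf, of "insert (i, b) T" i b n j] T(1) ab' ij
    by (intro zclosure_subset_zclosure nonvanishing_jets_subset_aff) auto
  also have "\<dots> \<subseteq> ?c (?N (insert (i, j) T))"
  proof (intro zclosure_subset_zclosure nonvanishing_jets_subset_aff)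
    have "?N (insert (i, j) (insert (i, b) T)) \<subseteq> ?N (insert (i, j) T)"
      by (rule nonvanishing_jets_antimono) auto
    then show "?N (insert (i, j) (insert (i, b) T)) \<subseteq> ?c (?N (insert (i, j) T))"
      using zclosure_superset by (rule subset_trans)
  qed
  finally show ?thesis .
qed

lemma zclosure_nonvanishing_jets:
  assumes inf: "infinite (UNIV :: 'a::field set)" and T: "T \<noteq> {}" "T \<subseteq> {1..m} \<times> {1..n}"
  shows "zclosure (Idx m n k) (nonvanishing_jets m n r k T :: (_ \<Rightarrow> 'a) set)
    = zclosure (Idx m n k) (nonvanishing_jets m n r k ({1..m} \<times> {1..n}))"
proof
  let ?N = "\<lambda>T. nonvanishing_jets m n r k T :: (_ \<Rightarrow> 'a) set"
  let ?c = "zclosure (Idx m n k) :: (_ \<Rightarrow> 'a) set \<Rightarrow> _"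
  have finT: "finite T" by (rule finite_subset[OF T(2)]) simp
  have *: "?c (?N T) \<subseteq> ?c (?N (S \<union> T))" if "finite S" "S \<subseteq> {1..m} \<times> {1..n}" for S
    using that
  proof (induction S rule: finite_induct)
    case (insert x S)
    obtain i j where x: "x = (i, j)" by (cases x)
    have "?c (?N (S \<union> T)) \<subseteq> ?c (?N (insert (i, j) (S \<union> T)))"
      by (rule zclosure_nonvanishing_jets_insert[OF inf]) (use insert T finT x in auto)
    then show ?case using insert x by simp
  qed simp
  have "({1..m} \<times> {1..n}) \<union> T = {1..m} \<times> {1..n}" using T(2) by blast
  then show "?c (?N T) \<subseteq> ?c (?N ({1..m} \<times> {1..n}))"
    using *[of "{1..m} \<times> {1..n}"] by simp
  show "?c (?N ({1..m} \<times> {1..n})) \<subseteq> ?c (?N T)"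
    by (intro zclosure_subset_zclosure nonvanishing_jets_subset_aff
        subset_trans[OF nonvanishing_jets_antimono[OF T(2)] zclosure_superset])
qed

lemma nonvanishing_jets_nonempty:
  assumes "2 \<le> r" "1 \<le> k" "T \<subseteq> {1..m} \<times> {1..n}"
  shows "nonvanishing_jets m n r k T \<noteq> {}"
proof -
  \<comment> \<open>All entries are the constant 1, so any two rows agree and minors of size at
    least 2 vanish.\<close>
  define p :: "nat \<times> nat \<times> nat \<Rightarrow> 'a" where
    "p = (\<lambda>(i, j, l). if i \<in> {1..m} \<and> j \<in> {1..n} \<and> l = 0 then 1 else 0)"
  have "minors_dvd (fps_X ^ k) {1..m} {1..n} r (jmat k p)"
  proof (rule minors_dvdI)
    fix f g assume f: "\<And>a. a < r \<Longrightarrow> f a \<in> {1..m}"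
    have eq: "jmat k p i b = jmat k p i' b" if "i \<in> {1..m}" "i' \<in> {1..m}" for i i' b
      using that by (intro fps_ext) (simp add: p_def)
    have r: "0 < r" "1 < r" using assms(1) by simp_all
    have "fdet r (\<lambda>a b. jmat k p (f a) (g b)) = 0"
      by (rule fdet_identical_rows[OF r zero_neq_one]) (rule eq[OF f[OF r(1)] f[OF r(2)]])
    then show "fps_X ^ k dvd fdet r (\<lambda>a b. jmat k p (f a) (g b))" by simp
  qed
  moreover have "p \<in> aff (Idx m n k)" using assms(2) by (auto simp: p_def aff_def Idx_def)
  ultimately have "p \<in> nonvanishing_jets m n r k T"
    using assms(3) by (auto simp: nonvanishing_jets_def mem_jetZ_iff p_def)
  then show ?thesis by blast
qed

section \<open>Rational functions\<close>

text \<open>One fraction valid on all of \<open>U\<close>: it gives regularity with a single chart,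
  and such functions are closed under sums and products, and under inverses where they have no
  zeros.\<close>

definition ratfun :: "'v set \<Rightarrow> ('v \<Rightarrow> 'a::field) set \<Rightarrow> (('v \<Rightarrow> 'a) \<Rightarrow> 'a) \<Rightarrow> bool" where
  "ratfun V U h \<longleftrightarrow> (\<exists>f\<in>polyring V. \<exists>g\<in>polyring V. \<forall>q\<in>U. peval q g \<noteq> 0 \<and> h q = peval q f / peval q g)"

lemma ratfun_polyfun: "polyfun V h \<Longrightarrow> ratfun V U h"
  unfolding ratfun_def polyfun_def by (metis div_by_1 peval_1 polyring_1 zero_neq_one)

lemma ratfun_const [intro, simp]: "ratfun V U (\<lambda>q. c)"
  by (rule ratfun_polyfun) simp

lemma ratfun_add [intro]:
  assumes "ratfun V U h" "ratfun V U h'"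
  shows "ratfun V U (\<lambda>q. h q + h' q)"
proof -
  obtain f g f' g' where *: "f \<in> polyring V" "g \<in> polyring V" "f' \<in> polyring V" "g' \<in> polyring V"
    "\<forall>q\<in>U. peval q g \<noteq> 0 \<and> h q = peval q f / peval q g"
    "\<forall>q\<in>U. peval q g' \<noteq> 0 \<and> h' q = peval q f' / peval q g'"
    using assms unfolding ratfun_def by blast
  have "\<forall>q\<in>U. peval q (g * g') \<noteq> 0 \<and> h q + h' q = peval q (f * g' + f' * g) / peval q (g * g')"
    using *(5,6) by (simp add: add_frac_eq)
  moreover have "f * g' + f' * g \<in> polyring V" "g * g' \<in> polyring V" using *(1-4) by auto
  ultimately show ?thesis unfolding ratfun_def by blast
qed

lemma ratfun_mult [intro]:
  assumes "ratfun V U h" "ratfun V U h'"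
  shows "ratfun V U (\<lambda>q. h q * h' q)"
proof -
  obtain f g f' g' where *: "f \<in> polyring V" "g \<in> polyring V" "f' \<in> polyring V" "g' \<in> polyring V"
    "\<forall>q\<in>U. peval q g \<noteq> 0 \<and> h q = peval q f / peval q g"
    "\<forall>q\<in>U. peval q g' \<noteq> 0 \<and> h' q = peval q f' / peval q g'"
    using assms unfolding ratfun_def by blast
  have "\<forall>q\<in>U. peval q (g * g') \<noteq> 0 \<and> h q * h' q = peval q (f * f') / peval q (g * g')"
    using *(5,6) by simp
  moreover have "f * f' \<in> polyring V" "g * g' \<in> polyring V" using *(1-4) by auto
  ultimately show ?thesis unfolding ratfun_def by blast
qed

lemma ratfun_inverse:
  assumes "ratfun V U h" "\<And>q. q \<in> U \<Longrightarrow> h q \<noteq> 0"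
  shows "ratfun V U (\<lambda>q. inverse (h q))"
proof -
  obtain f g where *: "f \<in> polyring V" "g \<in> polyring V"
    "\<forall>q\<in>U. peval q g \<noteq> 0 \<and> h q = peval q f / peval q g"
    using assms unfolding ratfun_def by blast
  have "\<forall>q\<in>U. peval q f \<noteq> 0 \<and> inverse (h q) = peval q g / peval q f"
    using *(3) assms(2) by (metis div_0 inverse_divide)
  then show ?thesis unfolding ratfun_def using *(1,2) by blast
qed

lemma ratfun_uminus [intro]: "ratfun V U h \<Longrightarrow> ratfun V U (\<lambda>q. - h q)"
  using ratfun_mult[of V U "\<lambda>q. - 1" h] by simp

lemma ratfun_sum [intro]: "(\<And>i. i \<in> A \<Longrightarrow> ratfun V U (h i)) \<Longrightarrow> ratfun V U (\<lambda>q. \<Sum>i\<in>A. h i q)"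
  by (induction A rule: infinite_finite_induct) auto

lemma ratfun_peval:
  assumes "f \<in> polyring V" "\<And>v. v \<in> V \<Longrightarrow> ratfun W U (\<lambda>b. h b v)"
  shows "ratfun W U (\<lambda>b. peval (h b) f)"
  using peval_in_algebra[OF assms(1), of "Collect (ratfun W U)" h] assms(2) by auto

lemma regular_on_ratfun:
  assumes "ratfun V U h" "U \<subseteq> aff V"
  shows "regular_on V U h"
proof -
  have "zeros V {1} = ({} :: ('a \<Rightarrow> 'b) set)" by (simp add: zeros_def)
  then have "zclosed V ({} :: ('a \<Rightarrow> 'b) set)" by (metis empty_subsetI insert_subset polyring_1 zclosed_zeros)
  then have op: "zopen_in V (aff V) (aff V :: ('a \<Rightarrow> 'b) set)" by (force simp: zopen_in_def)
  obtain f g where *: "f \<in> polyring V" "g \<in> polyring V"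
    "\<forall>q\<in>U. peval q g \<noteq> 0 \<and> h q = peval q f / peval q g"
    using assms unfolding ratfun_def by blast
  show ?thesis
    unfolding regular_on_def
  proof
    fix p assume "p \<in> U"
    then show "\<exists>Op f g. zopen_in V (aff V) Op \<and> p \<in> Op \<and> f \<in> polyring V \<and> g \<in> polyring V \<and>
      (\<forall>q\<in>U \<inter> Op. peval q g \<noteq> 0 \<and> h q = peval q f / peval q g)"
      using * op assms(2) by (intro exI[of _ "aff V"] exI[of _ f] exI[of _ g]) auto
  qed
qed

lemma ratfun_fps_mult:
  assumes "\<And>l. ratfun W U (\<lambda>b. fps_nth (F b) l)" "\<And>l. ratfun W U (\<lambda>b. fps_nth (G b) l)"
  shows "ratfun W U (\<lambda>b. fps_nth (F b * G b) l)"
  unfolding fps_mult_nth using assms by (intro ratfun_sum ratfun_mult)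

text \<open>The coefficients of the inverse satisfy a recursion that divides only by the constant
  term, so induction on \<open>l\<close> keeps them rational.\<close>

lemma ratfun_fps_inverse:
  assumes F: "\<And>l. ratfun W U (\<lambda>b. fps_nth (F b) l)" and F0: "\<And>b. b \<in> U \<Longrightarrow> fps_nth (F b) 0 \<noteq> 0"
  shows "ratfun W U (\<lambda>b. fps_nth (inverse (F b)) l)"
proof (induction l rule: less_induct)
  case (less l)
  show ?case
  proof (cases l)
    case 0
    then show ?thesis using ratfun_inverse[OF F F0] by simp
  next
    case (Suc l')
    let ?s = "\<lambda>b. inverse (fps_nth (F b) 0) * - (\<Sum>i = 1..l. fps_nth (F b) i * fps_nth (inverse (F b)) (l - i))"
    have "ratfun W U ?s"
      by (intro ratfun_mult ratfun_inverse[OF F F0] ratfun_uminus ratfun_sum F less) (auto simp: Suc)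
    moreover have "fps_nth (inverse (F b)) l = ?s b" if b: "b \<in> U" for b
    proof -
      have "F b * inverse (F b) = 1" using inverse_mult_eq_1'[OF F0[OF b]] .
      then have "fps_nth (F b * inverse (F b)) l = 0" using Suc by simp
      then have "fps_nth (F b) 0 * fps_nth (inverse (F b)) l
        + (\<Sum>i = 1..l. fps_nth (F b) i * fps_nth (inverse (F b)) (l - i)) = 0"
        unfolding fps_mult_nth by (simp add: sum.atLeast_Suc_atMost)
      then have "fps_nth (F b) 0 * fps_nth (inverse (F b)) l
        = - (\<Sum>i = 1..l. fps_nth (F b) i * fps_nth (inverse (F b)) (l - i))"
        by (simp only: eq_neg_iff_add_eq_0)
      then have "inverse (fps_nth (F b) 0) * (fps_nth (F b) 0 * fps_nth (inverse (F b)) l) = ?s b"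
        by (rule arg_cong)
      moreover have "inverse (fps_nth (F b) 0) * (fps_nth (F b) 0 * x) = x" for x
        using F0[OF b] by (simp flip: mult.assoc)
      ultimately show ?thesis by simp
    qed
    ultimately show ?thesis unfolding ratfun_def by (metis (no_types, lifting))
  qed
qed

lemma polyfun_fps_mult:
  assumes "\<And>l. polyfun W (\<lambda>b. fps_nth (F b) l)" "\<And>l. polyfun W (\<lambda>b. fps_nth (G b) l)"
  shows "polyfun W (\<lambda>b. fps_nth (F b * G b) l)"
  unfolding fps_mult_nth using assms by (intro polyfun_sum polyfun_mult)

section \<open>Elimination with the pivot in position (1,1)\<close>

text \<open>The entries \<open>x\<^sub>1\<^sub>1 x\<^sub>i\<^sub>j - x\<^sub>i\<^sub>1 x\<^sub>1\<^sub>j\<close> are those of the Schur complement multiplied by the pivot, which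
  keeps the map polynomial; only its inverse needs the pivot to be invertible.\<close>
definition elim_jet :: "nat \<Rightarrow> (nat \<times> nat \<times> nat \<Rightarrow> 'a::comm_ring_1) \<Rightarrow> nat \<times> nat \<times> nat \<Rightarrow> 'a" where
  "elim_jet k p = (\<lambda>(i, j, l). if i \<le> 1 \<or> j \<le> 1 then p (i, j, l) else if l < k then
    fps_nth (jmat k p 1 1 * jmat k p i j - jmat k p i 1 * jmat k p 1 j) l else 0)"

definition unelim_jet :: "nat \<Rightarrow> (nat \<times> nat \<times> nat \<Rightarrow> 'a::field) \<Rightarrow> nat \<times> nat \<times> nat \<Rightarrow> 'a" where
  "unelim_jet k q = (\<lambda>(i, j, l). if i \<le> 1 \<or> j \<le> 1 then q (i, j, l) else if l < k then
    fps_nth ((jmat k q i j + jmat k q i 1 * jmat k q 1 j) * inverse (jmat k q 1 1)) l else 0)"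

text \<open>The block without first row and column, renumbered to match the coordinates of the
  smaller jet variety.\<close>

definition inner_jet :: "nat \<Rightarrow> nat \<Rightarrow> nat \<Rightarrow> (nat \<times> nat \<times> nat \<Rightarrow> 'a::zero) \<Rightarrow> nat \<times> nat \<times> nat \<Rightarrow> 'a" where
  "inner_jet m n k q = (\<lambda>(i, j, l). if (i, j, l) \<in> Idx (m - 1) (n - 1) k then q (i + 1, j + 1, l) else 0)"

lemma jmat_eq_0:
  assumes "p \<in> aff (Idx m n k)" "m < i \<or> n < j"
  shows "jmat k p i j = 0"
proof (rule fps_ext)
  fix l
  have "(i, j, l) \<notin> Idx m n k" using assms(2) by (auto simp: Idx_def)
  then show "fps_nth (jmat k p i j) l = fps_nth 0 l" using affD[OF assms(1)] by simp
qed

lemma elim_jet_aff: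
  assumes "p \<in> aff (Idx m n k)"
  shows "elim_jet k p \<in> aff (Idx m n k)"
  unfolding aff_def
proof (intro CollectI allI impI)
  fix v assume v: "v \<notin> Idx m n k"
  obtain i j l where ijl: "v = (i, j, l)" by (cases v)
  show "elim_jet k p v = 0"
  proof (cases "i \<le> 1 \<or> j \<le> 1 \<or> k \<le> l")
    case True
    then show ?thesis using affD[OF assms v] by (auto simp: elim_jet_def ijl)
  next
    case False
    then have "m < i \<or> n < j" using v by (auto simp: ijl Idx_def)
    then have "jmat k p i j = 0 \<and> (jmat k p i 1 = 0 \<or> jmat k p 1 j = 0)"
      using jmat_eq_0[OF assms] by blast
    then show ?thesis using False by (auto simp: elim_jet_def ijl)
  qed
qed

lemma unelim_jet_aff:
  assumes "p \<in> aff (Idx m n k)"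
  shows "unelim_jet k p \<in> aff (Idx m n k)"
  unfolding aff_def
proof (intro CollectI allI impI)
  fix v assume v: "v \<notin> Idx m n k"
  obtain i j l where ijl: "v = (i, j, l)" by (cases v)
  show "unelim_jet k p v = 0"
  proof (cases "i \<le> 1 \<or> j \<le> 1 \<or> k \<le> l")
    case True
    then show ?thesis using affD[OF assms v] by (auto simp: unelim_jet_def ijl)
  next
    case False
    then have "m < i \<or> n < j" using v by (auto simp: ijl Idx_def)
    then have "jmat k p i j = 0 \<and> (jmat k p i 1 = 0 \<or> jmat k p 1 j = 0)"
      using jmat_eq_0[OF assms] by blast
    then show ?thesis using False by (auto simp: unelim_jet_def ijl)
  qed
qed

lemma inner_jet_aff: "inner_jet m n k q \<in> aff (Idx (m - 1) (n - 1) k)"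
  by (auto simp: inner_jet_def aff_def)

lemma elim_jet_pivot [simp]: "elim_jet k p (1, 1, 0) = p (1, 1, 0)" "elim_jet k p (Suc 0, Suc 0, 0) = p (1, 1, 0)"
  by (simp_all add: elim_jet_def)

lemma unelim_jet_pivot [simp]: "unelim_jet k p (1, 1, 0) = p (1, 1, 0)" "unelim_jet k p (Suc 0, Suc 0, 0) = p (1, 1, 0)"
  by (simp_all add: unelim_jet_def)

lemma jmat_elim_jet_border: "i \<le> 1 \<or> j \<le> 1 \<Longrightarrow> jmat k (elim_jet k p) i j = jmat k p i j"
  by (rule fps_ext) (auto simp: elim_jet_def)

lemma jmat_unelim_jet_border: "i \<le> 1 \<or> j \<le> 1 \<Longrightarrow> jmat k (unelim_jet k p) i j = jmat k p i j"
  by (rule fps_ext) (auto simp: unelim_jet_def)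

lemma jmat_elim_jet:
  assumes "1 < i" "1 < j"
  shows "fps_X ^ k dvd jmat k (elim_jet k p) i j - (jmat k p 1 1 * jmat k p i j - jmat k p i 1 * jmat k p 1 j)"
  unfolding fps_X_power_dvd_diff_iff using assms by (auto simp: elim_jet_def)

lemma jmat_unelim_jet:
  assumes "1 < i" "1 < j"
  shows "fps_X ^ k dvd jmat k (unelim_jet k q) i j
    - (jmat k q i j + jmat k q i 1 * jmat k q 1 j) * inverse (jmat k q 1 1)"
  unfolding fps_X_power_dvd_diff_iff using assms by (auto simp: unelim_jet_def)

lemma unelim_elim_jet:
  assumes p: "p \<in> aff (Idx m n k)" "p (1, 1, 0) \<noteq> 0" and k: "1 \<le> k"
  shows "unelim_jet k (elim_jet k p) = p"
proof
  fix v :: "nat \<times> nat \<times> nat"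
  obtain i j l where v: "v = (i, j, l)" by (cases v)
  show "unelim_jet k (elim_jet k p) v = p v"
  proof (cases "i \<le> 1 \<or> j \<le> 1 \<or> k \<le> l")
    case True
    moreover have "p (i, j, l) = 0" if "k \<le> l" using affD[OF p(1), of "(i, j, l)"] that by (simp add: Idx_def)
    ultimately show ?thesis by (auto simp: v unelim_jet_def elim_jet_def)
  next
    case False
    let ?a = "jmat k p 1 1" and ?x = "jmat k p i j" and ?uv = "jmat k p i 1 * jmat k p 1 j"
    let ?y = "jmat k (elim_jet k p) i j"
    have "?a * inverse ?a = 1" using p(2) k by (intro inverse_mult_eq_1') simp
    \<comment> \<open>The error of the reconstructed entry is a multiple of the truncation error of
      \<open>elim_jet\<close>, hence divisible by \<open>fps_X ^ k\<close>.\<close>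
    then have "(?y + ?uv) * inverse ?a - ?x = (?y - (?a * ?x - ?uv)) * inverse ?a"
      by (simp add: algebra_simps)
    then have "fps_X ^ k dvd (?y + ?uv) * inverse ?a - ?x"
      using jmat_elim_jet[of i j k p] False by (simp add: dvd_mult2)
    then have "fps_nth ((?y + ?uv) * inverse ?a) l = fps_nth ?x l"
      using False by (simp only: fps_X_power_dvd_diff_iff) simp
    then show ?thesis using False
      by (simp add: v unelim_jet_def jmat_elim_jet_border del: One_nat_def)
  qed
qed

lemma elim_unelim_jet:
  assumes p: "p \<in> aff (Idx m n k)" "p (1, 1, 0) \<noteq> 0" and k: "1 \<le> k"
  shows "elim_jet k (unelim_jet k p) = p"
proof
  fix v :: "nat \<times> nat \<times> nat"
  obtain i j l where v: "v = (i, j, l)" by (cases v)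
  show "elim_jet k (unelim_jet k p) v = p v"
  proof (cases "i \<le> 1 \<or> j \<le> 1 \<or> k \<le> l")
    case True
    moreover have "p (i, j, l) = 0" if "k \<le> l" using affD[OF p(1), of "(i, j, l)"] that by (simp add: Idx_def)
    ultimately show ?thesis by (auto simp: v unelim_jet_def elim_jet_def)
  next
    case False
    let ?a = "jmat k p 1 1" and ?y = "jmat k p i j" and ?uv = "jmat k p i 1 * jmat k p 1 j"
    let ?x = "jmat k (unelim_jet k p) i j"
    have "?a * inverse ?a = 1" using p(2) k by (intro inverse_mult_eq_1') simp
    then have "?a * ((?y + ?uv) * inverse ?a) = ?y + ?uv" by (metis mult.left_commute mult.right_neutral)
    then have "?a * ?x - ?uv - ?y = ?a * (?x - (?y + ?uv) * inverse ?a)"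
      unfolding right_diff_distrib by (simp only: diff_diff_eq add.commute)
    then have "fps_X ^ k dvd ?a * ?x - ?uv - ?y"
      using jmat_unelim_jet[of i j k p] False by (simp add: dvd_mult)
    then have "fps_nth (?a * ?x - ?uv) l = fps_nth ?y l"
      using False by (simp only: fps_X_power_dvd_diff_iff) simp
    then show ?thesis using False
      by (simp add: v elim_jet_def jmat_unelim_jet_border del: One_nat_def fps_sub_nth)
  qed
qed

text \<open>The pivot is a unit, so elimination trades \<open>Suc r\<close> for \<open>r\<close>.
  Row and column 1 of the eliminated matrix are zero, and cutting the inner block off at
  \<open>k\<close> changes it only by multiples of \<open>fps_X ^ k\<close>.\<close>

theorem mem_jetZ_iff_inner_elim:
  fixes p :: "nat \<times> nat \<times> nat \<Rightarrow> 'a::field"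
  assumes p: "p \<in> aff (Idx m n k)" "p (1, 1, 0) \<noteq> 0" and k: "1 \<le> k" and mn: "1 \<le> m" "1 \<le> n"
  shows "p \<in> jetZ m n (Suc r) k \<longleftrightarrow> inner_jet m n k (elim_jet k p) \<in> jetZ (m - 1) (n - 1) r k"
proof -
  let ?X = "jmat k p" and ?t = "fps_X ^ k :: 'a fps"
  let ?Y = "\<lambda>i j. ?X 1 1 * ?X i j - ?X i 1 * ?X 1 j"
  have "p \<in> jetZ m n (Suc r) k \<longleftrightarrow> minors_dvd ?t {1..m} {1..n} (Suc r) ?X"
    using p(1) by (simp add: mem_jetZ_iff)
  also have "\<dots> \<longleftrightarrow> minors_dvd ?t {1..m} {1..n} r ?Y"
  proof (rule minors_dvd_eliminate)
    fix x assume "?t dvd ?X 1 1 * x"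
    then show "?t dvd x" by (rule fps_X_power_dvd_unit[rotated]) (use p(2) k in simp)
  qed (use mn in auto)
  also have "\<dots> \<longleftrightarrow> minors_dvd ?t {2..m} {2..n} r ?Y"
  proof (rule minors_dvd_drop_zeros)
    show "?Y i j = 0" if "i \<in> {1..m} - {2..m}" for i j
    proof -
      have "i = 1" using that by auto
      then show ?thesis by simp
    qed
    show "?Y i j = 0" if "j \<in> {1..n} - {2..n}" for i j
    proof -
      have "j = 1" using that by auto
      then show ?thesis by simp
    qed
  qed auto
  also have "\<dots> \<longleftrightarrow> minors_dvd ?t {1..m - 1} {1..n - 1} r (\<lambda>i j. ?Y (Suc i) (Suc j))"
  proof (rule minors_dvd_reindex[symmetric])
    show "Suc ` {1..m - 1} = {2..m}" "Suc ` {1..n - 1} = {2..n}" using mn by (auto simp: image_Suc_atLeastAtMost)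
  qed
  also have "\<dots> \<longleftrightarrow> minors_dvd ?t {1..m - 1} {1..n - 1} r (jmat k (inner_jet m n k (elim_jet k p)))"
  proof (rule minors_dvd_cong)
    fix i j assume ij: "i \<in> {1..m - 1}" "j \<in> {1..n - 1}"
    have "jmat k (inner_jet m n k (elim_jet k p)) i j = jmat k (elim_jet k p) (Suc i) (Suc j)"
      by (rule fps_ext) (use ij in \<open>auto simp: inner_jet_def Idx_def\<close>)
    then have "?t dvd jmat k (inner_jet m n k (elim_jet k p)) i j - ?Y (Suc i) (Suc j)"
      using jmat_elim_jet[of "Suc i" "Suc j" k p] ij by simp
    then show "?t dvd ?Y (Suc i) (Suc j) - jmat k (inner_jet m n k (elim_jet k p)) i j"
      by (simp only: dvd_diff_commute)
  qed
  also have "\<dots> \<longleftrightarrow> inner_jet m n k (elim_jet k p) \<in> jetZ (m - 1) (n - 1) r k"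
    using inner_jet_aff[of m n k "elim_jet k p"] by (simp only: mem_jetZ_iff simp_thms)
  finally show ?thesis .
qed

section \<open>Elimination is polynomial, its inverse rational\<close>

lemma polyfun_jmat:
  assumes "i \<in> {1..m}" "j \<in> {1..n}"
  shows "polyfun (Idx m n k) (\<lambda>p. fps_nth (jmat k p i j) l)"
proof (cases "l < k")
  case True
  then have "(i, j, l) \<in> Idx m n k" using assms by (auto simp: Idx_def)
  then show ?thesis using True by (auto intro: polyfun_var)
qed simp

lemma polyfun_elim_jet:
  assumes "v \<in> Idx m n k"
  shows "polyfun (Idx m n k) (\<lambda>p. elim_jet k p v)"
proof -
  obtain i j l where v: "v = (i, j, l)" by (cases v)
  then have ij: "i \<in> {1..m}" "j \<in> {1..n}" "1 \<in> {1..m}" "1 \<in> {1..n}" "l < k"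
    using assms by (auto simp: Idx_def)
  show ?thesis
  proof (cases "i \<le> 1 \<or> j \<le> 1")
    case True
    then show ?thesis using assms by (simp add: v elim_jet_def polyfun_var)
  next
    case False
    have "polyfun (Idx m n k) (\<lambda>p. fps_nth (jmat k p 1 1 * jmat k p i j) l - fps_nth (jmat k p i 1 * jmat k p 1 j) l)"
      by (intro polyfun_diff polyfun_fps_mult polyfun_jmat ij)
    then show ?thesis using False ij by (simp add: v elim_jet_def del: One_nat_def)
  qed
qed

lemma polyfun_inner_elim_jet:
  assumes "v \<in> Idx (m - 1) (n - 1) k"
  shows "polyfun (Idx m n k) (\<lambda>p. inner_jet m n k (elim_jet k p) v)"
proof -
  obtain i j l where v: "v = (i, j, l)" by (cases v)
  have "(i + 1, j + 1, l) \<in> Idx m n k" using assms by (auto simp: v Idx_def)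
  then show ?thesis using polyfun_elim_jet assms by (auto simp: v inner_jet_def)
qed

lemma ratfun_unelim_jet:
  assumes h: "\<And>v. ratfun W U (\<lambda>b. h b v)" and h0: "\<And>b. b \<in> U \<Longrightarrow> h b (1, 1, 0) \<noteq> 0" and k: "1 \<le> k"
  shows "ratfun W U (\<lambda>b. unelim_jet k (h b) v)"
proof -
  obtain i j l where v: "v = (i, j, l)" by (cases v)
  have jm: "ratfun W U (\<lambda>b. fps_nth (jmat k (h b) i j) l)" for i j l
    using h by (cases "l < k") auto
  show ?thesis
  proof (cases "i \<le> 1 \<or> j \<le> 1 \<or> k \<le> l")
    case True
    then show ?thesis using h by (cases "i \<le> 1 \<or> j \<le> 1") (auto simp: v unelim_jet_def)
  next
    case False
    have "ratfun W U (\<lambda>b. fps_nth ((jmat k (h b) i j + jmat k (h b) i 1 * jmat k (h b) 1 j)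
      * inverse (jmat k (h b) 1 1)) l)"
    proof (rule ratfun_fps_mult)
      show "ratfun W U (\<lambda>b. fps_nth (jmat k (h b) i j + jmat k (h b) i 1 * jmat k (h b) 1 j) l)" for l
        unfolding fps_add_nth by (intro ratfun_add ratfun_fps_mult jm)
      show "ratfun W U (\<lambda>b. fps_nth (inverse (jmat k (h b) 1 1)) l)" for l
        by (rule ratfun_fps_inverse[OF jm]) (use h0 k in simp)
    qed
    then show ?thesis using False by (simp add: v unelim_jet_def del: One_nat_def)
  qed
qed

section \<open>Lifting irreducible sets through the elimination\<close>

definition shift_idx :: "nat \<times> nat \<times> nat \<Rightarrow> nat \<times> nat \<times> nat" where
  "shift_idx = (\<lambda>(i, j, l). (i + 1, j + 1, l))"

lemma inj_shift_idx: "inj shift_idx"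
  by (auto simp: shift_idx_def inj_def)

lemma inner_jet_alt:
  "inner_jet m n k q v = (if v \<in> Idx (m - 1) (n - 1) k then q (shift_idx v) else 0)"
  by (cases v) (simp add: inner_jet_def shift_idx_def)

lemma shift_idx_Idx: "v \<in> Idx (m - 1) (n - 1) k \<Longrightarrow> shift_idx v \<in> Idx m n k"
  by (cases v) (auto simp: shift_idx_def Idx_def)

lemma pivot_not_shift_idx: "(1, 1, l) \<notin> shift_idx ` Idx m n k"
  by (auto simp: shift_idx_def Idx_def)

text \<open>The inner block comes from \<open>d\<close>, the first row and column from
  \<open>a\<close>: a parametrization of the product in which \<open>a\<close> ranges over a whole
  affine space.\<close>

definition glue_jet :: "nat \<Rightarrow> nat \<Rightarrow> nat \<Rightarrow> (nat \<times> nat \<times> nat \<Rightarrow> 'a::zero) \<Rightarrow>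
    (nat \<times> nat \<times> nat \<Rightarrow> 'a) \<Rightarrow> nat \<times> nat \<times> nat \<Rightarrow> 'a" where
  "glue_jet m n k d a v = (if v \<in> shift_idx ` Idx (m - 1) (n - 1) k then d (the_inv shift_idx v)
    else if v \<in> Idx m n k then a v else 0)"

lemma glue_jet_aff: "glue_jet m n k d a \<in> aff (Idx m n k)"
  unfolding aff_def
proof (intro CollectI allI impI)
  fix v assume v: "v \<notin> Idx m n k"
  then have "v \<notin> shift_idx ` Idx (m - 1) (n - 1) k" using shift_idx_Idx by blast
  then show "glue_jet m n k d a v = 0" using v by (simp add: glue_jet_def del: One_nat_def)
qed

lemma the_inv_shift_idx [simp]: "the_inv shift_idx (shift_idx v) = v"
  by (rule the_inv_f_f[OF inj_shift_idx])

lemma glue_jet_shift [simp]: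
  "v \<in> Idx (m - 1) (n - 1) k \<Longrightarrow> glue_jet m n k d a (shift_idx v) = d v"
  by (simp add: glue_jet_def)

lemma inner_glue_jet:
  assumes "d \<in> aff (Idx (m - 1) (n - 1) k)"
  shows "inner_jet m n k (glue_jet m n k d a) = d"
  using affD[OF assms] by (intro ext) (simp add: inner_jet_alt)

lemma glue_inner_jet:
  assumes "q \<in> aff (Idx m n k)"
  shows "glue_jet m n k (inner_jet m n k q) q = q"
proof
  fix v
  show "glue_jet m n k (inner_jet m n k q) q v = q v"
  proof (cases "v \<in> shift_idx ` Idx (m - 1) (n - 1) k")
    case True
    then obtain w where "w \<in> Idx (m - 1) (n - 1) k" "v = shift_idx w" by blast
    then show ?thesis by (simp add: inner_jet_alt del: One_nat_def)
  next
    case False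
    then show ?thesis using affD[OF assms] by (simp add: glue_jet_def del: One_nat_def)
  qed
qed

text \<open>The product of \<open>D\<close> with the affine space of the first row and
  column.\<close>

definition jet_cylinder :: "nat \<Rightarrow> nat \<Rightarrow> nat \<Rightarrow> (nat \<times> nat \<times> nat \<Rightarrow> 'a::zero) set \<Rightarrow> (nat \<times> nat \<times> nat \<Rightarrow> 'a) set" where
  "jet_cylinder m n k D = {q \<in> aff (Idx m n k). inner_jet m n k q \<in> D}"

lemma firr_jet_cylinder:
  fixes D :: "(nat \<times> nat \<times> nat \<Rightarrow> 'a::field) set"
  assumes inf: "infinite (UNIV :: 'a set)" and D: "firr (Idx (m - 1) (n - 1) k) D"
    "D \<subseteq> aff (Idx (m - 1) (n - 1) k)"
  shows "firr (Idx m n k) (jet_cylinder m n k D)"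
proof (rule firr_image_product[OF inf D(1), where \<mu> = "glue_jet m n k" and T = "Idx m n k"])
  show "polyfun (Idx (m - 1) (n - 1) k) (\<lambda>d. glue_jet m n k d a v)" for a v
    by (cases "v \<in> shift_idx ` Idx (m - 1) (n - 1) k") (auto simp: glue_jet_def intro: polyfun_var)
  show "polyfun (Idx m n k) (\<lambda>a. glue_jet m n k d a v)" if "v \<in> Idx m n k" for d v
    using that by (cases "v \<in> shift_idx ` Idx (m - 1) (n - 1) k") (auto simp: glue_jet_def intro: polyfun_var)
  show "glue_jet m n k d a \<in> jet_cylinder m n k D" if "d \<in> D" for d a
  proof -
    have "inner_jet m n k (glue_jet m n k d a) = d" by (rule inner_glue_jet) (use that D(2) in blast)
    then show ?thesis using that by (simp add: jet_cylinder_def glue_jet_aff)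
  qed
  show "\<exists>d\<in>D. \<exists>a. y = glue_jet m n k d a" if "y \<in> jet_cylinder m n k D" for y
    using that glue_inner_jet[of y m n k]
    by (intro bexI[of _ "inner_jet m n k y"] exI[of _ y]) (auto simp: jet_cylinder_def)
qed

text \<open>The preimage of \<open>D\<close> under elimination in the locus of nonzero pivot. Over a
  field and for \<open>1 \<le> k\<close>, elimination identifies it with an open part of
  \<open>jet_cylinder m n k D\<close>.\<close>

definition jet_slice :: "nat \<Rightarrow> nat \<Rightarrow> nat \<Rightarrow> (nat \<times> nat \<times> nat \<Rightarrow> 'a::comm_ring_1) set \<Rightarrow> (nat \<times> nat \<times> nat \<Rightarrow> 'a) set" where
  "jet_slice m n k D = {p \<in> aff (Idx m n k). p (1, 1, 0) \<noteq> 0 \<and> inner_jet m n k (elim_jet k p) \<in> D}"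

lemma jet_slice_subset_aff: "jet_slice m n k D \<subseteq> aff (Idx m n k)"
  by (auto simp: jet_slice_def)

lemma elim_jet_slice:
  "p \<in> jet_slice m n k D \<Longrightarrow> elim_jet k p \<in> jet_cylinder m n k D"
  by (simp add: jet_slice_def jet_cylinder_def elim_jet_aff)

lemma unelim_jet_cylinder:
  fixes D :: "(nat \<times> nat \<times> nat \<Rightarrow> 'a::field) set"
  assumes "q \<in> jet_cylinder m n k D" "q (1, 1, 0) \<noteq> 0" "1 \<le> k"
  shows "unelim_jet k q \<in> jet_slice m n k D"
  using assms elim_unelim_jet[of q m n k] unelim_jet_aff[of q m n k]
  by (simp add: jet_slice_def jet_cylinder_def del: One_nat_def)

locale jet_pivot =
  fixes m n k :: nat and TYP :: "'a::field itself"
  assumes inf: "infinite (UNIV :: 'a set)" and m: "1 \<le> m" and n: "1 \<le> n" and k: "1 \<le> k"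
begin

abbreviation "V \<equiv> Idx m n k"
abbreviation "V' \<equiv> Idx (m - 1) (n - 1) k"
abbreviation "pivot \<equiv> (mvar (1, 1, 0) :: (nat \<times> nat \<times> nat, 'a) mpoly)"

lemma pivot_in_V: "(1, 1, 0) \<in> V"
  using m n k by (simp add: Idx_def)

lemma pivot_polyring: "pivot \<in> polyring V"
  by (rule polyring_mvar[OF pivot_in_V])

lemma cylinder_pivot_point:
  fixes D :: "(nat \<times> nat \<times> nat \<Rightarrow> 'a) set"
  assumes "d \<in> D" "D \<subseteq> aff V'"
  shows "\<exists>q\<in>jet_cylinder m n k D. q (1, 1, 0) = 1 \<and> inner_jet m n k q = d"
proof (intro bexI conjI)
  let ?q = "glue_jet m n k d (\<lambda>_. 1)"
  show "inner_jet m n k ?q = d" by (rule inner_glue_jet) (use assms in blast)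
  then show "?q \<in> jet_cylinder m n k D" using assms(1) by (simp add: jet_cylinder_def glue_jet_aff)
  show "?q (1, 1, 0) = 1" using pivot_not_shift_idx[of 0 "m - 1" "n - 1" k] pivot_in_V
    by (simp add: glue_jet_def del: One_nat_def)
qed

lemma slice_point:
  fixes D :: "(nat \<times> nat \<times> nat \<Rightarrow> 'a) set"
  assumes "d \<in> D" "D \<subseteq> aff V'"
  shows "\<exists>p\<in>jet_slice m n k D. inner_jet m n k (elim_jet k p) = d"
proof -
  obtain q where q: "q \<in> jet_cylinder m n k D" "q (1, 1, 0) = 1" "inner_jet m n k q = d"
    using cylinder_pivot_point[OF assms] by blast
  have "elim_jet k (unelim_jet k q) = q"
    by (rule elim_unelim_jet[OF _ _ k]) (use q in \<open>auto simp: jet_cylinder_def\<close>)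
  moreover have "unelim_jet k q \<in> jet_slice m n k D"
    by (rule unelim_jet_cylinder[OF q(1) _ k]) (use q(2) in simp)
  ultimately show ?thesis using q(3) by (intro bexI[of _ "unelim_jet k q"]) simp_all
qed

text \<open>Composition with \<open>unelim_jet\<close> makes \<open>f\<close> and \<open>g\<close>
  fractions on the open part of the cylinder. The product of their numerators and the pivot vanishes
  on the whole cylinder, which is irreducible and has points with nonzero pivot.\<close>

lemma firr_slice:
  fixes D :: "(nat \<times> nat \<times> nat \<Rightarrow> 'a) set"
  assumes D: "firr V' D" "D \<subseteq> aff V'"
  shows "firr V (jet_slice m n k D)"
  unfolding firr_def
proof (intro conjI ballI impI)
  obtain d where d: "d \<in> D" using D(1) by (auto simp: firr_def)
  show "jet_slice m n k D \<noteq> {}" using slice_point[OF d D(2)] by blast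
  fix f g :: "(nat \<times> nat \<times> nat, 'a) mpoly"
  assume fg: "f \<in> polyring V" "g \<in> polyring V"
    "\<forall>y\<in>jet_slice m n k D. peval y f * peval y g = 0"
  let ?C = "jet_cylinder m n k D"
  let ?U = "{q \<in> aff V. q (1, 1, 0) \<noteq> (0::'a)}"
  have rat: "ratfun V ?U (\<lambda>q. q v)" if "v \<in> V" for v
    by (rule ratfun_polyfun) (rule polyfun_var[OF that])
  have ratU: "ratfun V ?U (\<lambda>q. q v)" for v
  proof (cases "v \<in> V")
    case False
    then have "q v = 0" if "q \<in> ?U" for q using that affD[of q V v] by simp
    then show ?thesis unfolding ratfun_def
      by (intro bexI[of _ 0] bexI[of _ 1]) simp_all
  qed (rule rat)
  have un: "ratfun V ?U (\<lambda>q. unelim_jet k q v)" for v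
    by (rule ratfun_unelim_jet[OF ratU _ k]) simp
  obtain f1 f2 where f: "f1 \<in> polyring V" "f2 \<in> polyring V"
    "\<And>q. q \<in> ?U \<Longrightarrow> peval q f2 \<noteq> 0 \<and> peval (unelim_jet k q) f = peval q f1 / peval q f2"
  proof -
    have "ratfun V ?U (\<lambda>q. peval (unelim_jet k q) f)" by (rule ratfun_peval[OF fg(1) un])
    then show ?thesis using that unfolding ratfun_def by blast
  qed
  obtain g1 g2 where g: "g1 \<in> polyring V" "g2 \<in> polyring V"
    "\<And>q. q \<in> ?U \<Longrightarrow> peval q g2 \<noteq> 0 \<and> peval (unelim_jet k q) g = peval q g1 / peval q g2"
  proof -
    have "ratfun V ?U (\<lambda>q. peval (unelim_jet k q) g)" by (rule ratfun_peval[OF fg(2) un])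
    then show ?thesis using that unfolding ratfun_def by blast
  qed
  have CU: "q \<in> ?U" if "q \<in> ?C" "q (1, 1, 0) \<noteq> 0" for q
    using that by (simp add: jet_cylinder_def)
  have irr: "firr V ?C" by (rule firr_jet_cylinder[OF inf D])
  have "(\<forall>q\<in>?C. peval q f1 = 0) \<or> (\<forall>q\<in>?C. peval q (g1 * pivot) = 0)"
  proof (rule firrD[OF irr f(1)])
    show "g1 * pivot \<in> polyring V" using g(1) pivot_polyring by auto
    fix q assume q: "q \<in> ?C"
    show "peval q f1 = 0 \<or> peval q (g1 * pivot) = 0"
    proof (cases "q (1, 1, 0) = 0")
      case False
      have "peval (unelim_jet k q) f * peval (unelim_jet k q) g = 0"
        using fg(3) unelim_jet_cylinder[OF q False k] by blast
      then show ?thesis using f(3)[OF CU[OF q False]] g(3)[OF CU[OF q False]] by auto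
    qed simp
  qed
  moreover have "(\<forall>q\<in>?C. peval q g1 = 0) \<or> (\<forall>q\<in>?C. peval q pivot = 0)"
    if "\<forall>q\<in>?C. peval q (g1 * pivot) = 0"
    by (rule firrD[OF irr g(1) pivot_polyring]) (use that in auto)
  moreover have "\<not> (\<forall>q\<in>?C. peval q pivot = 0)"
    using cylinder_pivot_point[OF d D(2)] by force
  ultimately consider "\<forall>q\<in>?C. peval q f1 = 0" | "\<forall>q\<in>?C. peval q g1 = 0" by blast
  moreover have un_el: "unelim_jet k (elim_jet k p) = p" "elim_jet k p \<in> ?C" "elim_jet k p \<in> ?U"
    if "p \<in> jet_slice m n k D" for p
  proof -
    show "unelim_jet k (elim_jet k p) = p"
      by (rule unelim_elim_jet[OF _ _ k]) (use that in \<open>auto simp: jet_slice_def\<close>)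
    show "elim_jet k p \<in> ?C" by (rule elim_jet_slice[OF that])
    then show "elim_jet k p \<in> ?U" using that by (simp add: jet_slice_def jet_cylinder_def)
  qed
  ultimately show "(\<forall>y\<in>jet_slice m n k D. peval y f = 0) \<or> (\<forall>y\<in>jet_slice m n k D. peval y g = 0)"
  proof cases
    case 1
    then have "peval p f = 0" if "p \<in> jet_slice m n k D" for p
      using f(3)[OF un_el(3)[OF that]] un_el(1,2)[OF that] by simp
    then show ?thesis by blast
  next
    case 2
    then have "peval p g = 0" if "p \<in> jet_slice m n k D" for p
      using g(3)[OF un_el(3)[OF that]] un_el(1,2)[OF that] by simp
    then show ?thesis by blast
  qed
qed

text \<open>On components this is the inverse of the bijection to the smaller jet variety.\<close>

definition lift_jets :: "(nat \<times> nat \<times> nat \<Rightarrow> 'a) set \<Rightarrow> (nat \<times> nat \<times> nat \<Rightarrow> 'a) set" where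
  "lift_jets D = zclosure V (jet_slice m n k D)"

lemma zirred_lift: 
  assumes "zirred V' D"
  shows "zirred V (lift_jets D)"
  unfolding lift_jets_def
  by (rule zirred_zclosure[OF jet_slice_subset_aff firr_slice])
    (use assms zclosed_subset_aff in \<open>auto simp: zirred_iff\<close>)

lemma polyfun_inner_elim:
  assumes "f \<in> polyring V'"
  obtains g :: "(nat \<times> nat \<times> nat, 'a) mpoly"
  where "g \<in> polyring V" "\<And>p. peval (inner_jet m n k (elim_jet k p)) f = peval p g"
proof -
  have "polyfun V (\<lambda>p. peval (inner_jet m n k (elim_jet k p)) f)"
    by (rule polyfun_comp[OF assms]) (rule polyfun_inner_elim_jet)
  then show ?thesis using that unfolding polyfun_def by blast
qed

text \<open>Equations of \<open>D\<close> pull back along the polynomial map to equations of the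
  slice, which persist on the closure; so the closure adds only points with zero pivot.\<close>

lemma lift_pivot_nonzero:
  assumes D: "zclosed V' D" and p: "p \<in> lift_jets D" "p (1, 1, 0) \<noteq> 0"
  shows "p \<in> jet_slice m n k D"
proof -
  have "p \<in> aff V" using p(1) zclosure_subset_aff[OF jet_slice_subset_aff] unfolding lift_jets_def by blast
  moreover have "peval (inner_jet m n k (elim_jet k p)) f = 0"
    if f: "f \<in> polyring V'" "\<forall>y\<in>D. peval y f = 0" for f
  proof -
    obtain g where g: "g \<in> polyring V" "\<And>p. peval (inner_jet m n k (elim_jet k p)) f = peval p g"
      using polyfun_inner_elim[OF f(1)] by blast
    have "\<forall>y\<in>jet_slice m n k D. peval y g = 0" using f(2) by (simp add: jet_slice_def g(2)[symmetric])
    then show ?thesis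
      using zclosure_vanish[OF jet_slice_subset_aff g(1)] p(1) g(2) unfolding lift_jets_def by simp
  qed
  then have "inner_jet m n k (elim_jet k p) \<in> D"
    using D inner_jet_aff unfolding zclosed_iff by blast
  ultimately show ?thesis using p(2) by (simp add: jet_slice_def)
qed

lemma lift_mono: "D \<subseteq> D2 \<Longrightarrow> lift_jets D \<subseteq> lift_jets D2"
  unfolding lift_jets_def
  by (rule zclosure_subset[OF zclosed_zclosure[OF jet_slice_subset_aff]])
    (rule subset_trans[OF _ zclosure_superset], auto simp: jet_slice_def)

text \<open>Each point of \<open>D\<close> is the image of a slice point, where the pivot is
  nonzero, so \<open>D\<close> can be recovered from its lift.\<close>

lemma lift_subset_iff:
  assumes "zclosed V' D" "zclosed V' D2"
  shows "lift_jets D \<subseteq> lift_jets D2 \<longleftrightarrow> D \<subseteq> D2"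
proof
  assume sub: "lift_jets D \<subseteq> lift_jets D2"
  show "D \<subseteq> D2"
  proof
    fix d assume d: "d \<in> D"
    obtain p where p: "p \<in> jet_slice m n k D" "inner_jet m n k (elim_jet k p) = d"
      using slice_point[OF d zclosed_subset_aff[OF assms(1)]] by blast
    have "p \<in> lift_jets D2" using p(1) sub zclosure_superset unfolding lift_jets_def by blast
    then have "p \<in> jet_slice m n k D2"
      using lift_pivot_nonzero[OF assms(2)] p(1) by (simp add: jet_slice_def)
    then show "d \<in> D2" using p(2) by (simp add: jet_slice_def)
  qed
qed (rule lift_mono)

lemma lift_strict_mono:
  assumes "zclosed V' D" "zclosed V' D2" "D \<subset> D2"
  shows "lift_jets D \<subset> lift_jets D2"
  using assms lift_subset_iff by blast

lemma codim_lift_ge: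
  assumes D: "zirred V' D"
  shows "codim V' D \<le> codim V (lift_jets D)"
  unfolding codim_def[of V']
proof (rule Sup_least)
  fix x assume "x \<in> {enat n |n. \<exists>c. c 0 = D \<and> (\<forall>i<n. c i \<subset> c (Suc i)) \<and> (\<forall>i\<le>n. zirred V' (c i))}"
  then obtain e c where c: "x = enat e" "c 0 = D" "\<forall>i<e. c i \<subset> c (Suc i)" "\<forall>i\<le>e. zirred V' (c i)"
    by blast
  have "enat e \<le> codim V (lift_jets D)"
  proof (rule codim_ge_chain[where c = "\<lambda>i. lift_jets (c i)"])
    show "lift_jets (c i) \<subset> lift_jets (c (Suc i))" if "i < e" for i
      by (rule lift_strict_mono) (use c(3,4) that in \<open>auto simp: zirred_iff\<close>)
  qed (use c in \<open>auto intro: zirred_lift\<close>)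
  then show "x \<le> codim V (lift_jets D)" using c(1) by simp
qed

text \<open>A relation on the lift, transported by \<open>unelim_jet\<close>, holds on the cylinder
  where the pivot is nonzero and so on all of it. Freezing the first row and column at the values of
  \<open>a\<close> leaves a relation between the coordinates in \<open>B\<close> on
  \<open>D\<close>, which is trivial by independence.\<close>

lemma fun_indep_lift:
  assumes D: "zirred V' D" and B: "B \<subseteq> V'" "fun_indep D B (\<lambda>p. p)"
  shows "fun_indep (lift_jets D) (shift_idx ` B \<union> (V - shift_idx ` V')) (elim_jet k)"
  unfolding fun_indep_def
proof (intro ballI impI allI)
  let ?J = "shift_idx ` B \<union> (V - shift_idx ` V')"
  fix G :: "(nat \<times> nat \<times> nat, 'a) mpoly" and a :: "nat \<times> nat \<times> nat \<Rightarrow> 'a"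
  assume G: "G \<in> polyring ?J" "\<forall>p\<in>lift_jets D. peval (elim_jet k p) G = 0"
  have cl: "zclosed V' D" "firr V' D" using D by (simp_all add: zirred_iff)
  note Daff = zclosed_subset_aff[OF cl(1)]
  let ?C = "jet_cylinder m n k D"
  have GV: "G \<in> polyring V" by (rule polyring_mono[OF _ G(1)]) (use B(1) shift_idx_Idx in auto)
  have "(\<forall>q\<in>?C. peval q G = 0) \<or> (\<forall>q\<in>?C. peval q pivot = 0)"
  proof (rule firrD[OF firr_jet_cylinder[OF inf cl(2) Daff] GV pivot_polyring])
    fix q assume q: "q \<in> ?C"
    show "peval q G = 0 \<or> peval q pivot = 0"
    proof (cases "q (1, 1, 0) = 0")
      case False
      have "elim_jet k (unelim_jet k q) = q"
        by (rule elim_unelim_jet[where m = m and n = n, OF _ _ k])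
          (use q False in \<open>simp_all add: jet_cylinder_def\<close>)
      moreover have "unelim_jet k q \<in> lift_jets D"
        using unelim_jet_cylinder[OF q False k] zclosure_superset unfolding lift_jets_def by blast
      ultimately show ?thesis using G(2) by metis
    qed simp
  qed
  moreover obtain d0 where "d0 \<in> D" using cl(2) by (auto simp: firr_def)
  then have "\<not> (\<forall>q\<in>?C. peval q pivot = 0)" using cylinder_pivot_point[OF _ Daff] by force
  ultimately have C0: "\<forall>q\<in>?C. peval q G = 0" by blast
  have "polyfun B (\<lambda>d. glue_jet m n k d a v)" if "v \<in> ?J" for v
  proof (cases "v \<in> shift_idx ` B")
    case True
    then obtain b where b: "b \<in> B" "v = shift_idx b" by blast
    then have "b \<in> V'" using B(1) by blast
    then have "(\<lambda>d. glue_jet m n k d a v) = (\<lambda>d. d b)" unfolding b(2) by (intro ext glue_jet_shift)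
    then show ?thesis by (simp only: polyfun_var[OF b(1)])
  next
    case False
    then have "v \<in> V" "v \<notin> shift_idx ` V'" using that by blast+
    then show ?thesis by (simp add: glue_jet_def)
  qed
  then obtain H where H: "H \<in> polyring B" "\<And>d. peval (glue_jet m n k d a) G = peval d H"
    using polyfun_comp[OF G(1), of B "\<lambda>d. glue_jet m n k d a"] unfolding polyfun_def by metis
  have "peval d H = 0" if "d \<in> D" for d
  proof -
    have "inner_jet m n k (glue_jet m n k d a) = d" by (rule inner_glue_jet) (use that Daff in blast)
    then have "glue_jet m n k d a \<in> ?C" using that by (simp add: jet_cylinder_def glue_jet_aff)
    then show ?thesis using C0 by (simp add: H(2)[symmetric])
  qed
  then have "peval (\<lambda>b. a (shift_idx b)) H = 0" using B(2) H(1) by (simp add: fun_indep_def)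
  then have "peval (glue_jet m n k (\<lambda>b. a (shift_idx b)) a) G = 0" by (simp only: H(2))
  moreover have "peval (glue_jet m n k (\<lambda>b. a (shift_idx b)) a) G = peval a G"
  proof (rule peval_cong[OF G(1)])
    fix v assume "v \<in> ?J"
    then show "glue_jet m n k (\<lambda>b. a (shift_idx b)) a v = a v"
      using B(1) by (auto simp: glue_jet_def)
  qed
  ultimately show "peval a G = 0" by simp
qed

lemma card_shift_idx: "card (shift_idx ` B) = card B"
  by (rule card_image) (rule inj_on_subset[OF inj_shift_idx subset_UNIV])

text \<open>The lift gains \<open>card V - card V'\<close> variables and as many independent
  functions, so its upper bound equals the lower bound that the coordinates in \<open>B\<close> give
  for \<open>D\<close>. Lifted chains give the other inequality.\<close>

theorem codim_lift:
  assumes D: "zirred V' D"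
  shows "codim V (lift_jets D) = codim V' D"
proof (rule antisym[OF _ codim_lift_ge[OF D]])
  obtain B where B: "B \<subseteq> V'" "fun_indep D B (\<lambda>p. p)" "enat (card V' - card B) \<le> codim V' D"
    using codim_ge_independent_coordinates[OF inf finite_Idx D] by blast
  let ?J = "shift_idx ` B \<union> (V - shift_idx ` V')"
  have finB: "finite B" by (rule finite_subset[OF B(1) finite_Idx])
  have sub: "shift_idx ` V' \<subseteq> V" using shift_idx_Idx by blast
  have "card ?J = card (shift_idx ` B) + card (V - shift_idx ` V')"
    using B(1) finB by (intro card_Un_disjoint) auto
  also have "\<dots> = card B + (card V - card V')"
    using card_Diff_subset[OF _ sub] by (simp add: card_shift_idx)
  finally have cJ: "card ?J = card B + (card V - card V')" .
  have "card V' \<le> card V" using card_mono[OF finite_Idx sub] by (simp only: card_shift_idx)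
  moreover have "card B \<le> card V'" using card_mono[OF finite_Idx B(1)] .
  ultimately have "card V - card ?J = card V' - card B" using cJ by simp
  moreover have "codim V (lift_jets D) \<le> enat (card V - card ?J)"
  proof (rule codim_le_if_fun_indep[OF inf _ finite_Idx])
    show "infinite (UNIV :: (nat \<times> nat \<times> nat) set)" by (simp add: finite_prod)
    show "finite ?J" using finB by simp
    show "polyfun V (\<lambda>p. elim_jet k p j)" if "j \<in> ?J" for j
      by (rule polyfun_elim_jet) (use that B(1) sub in blast)
    show "fun_indep (lift_jets D) ?J (elim_jet k)" by (rule fun_indep_lift[OF D B(1,2)])
  qed
  ultimately show "codim V (lift_jets D) \<le> codim V' D" using B(3) by simp
qed

end

section \<open>Isomorphisms permuting coordinates\<close>

text \<open>The sets may lie in coordinate subspaces \<open>A\<close> and \<open>B\<close> of larger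
  ambient spaces, all other coordinates being zero. This covers \<open>prod_vars V d\<close> in the
  case \<open>r < k\<close>, whose variables range over \<open>Idx m n k\<close> although the jets
  are truncated at \<open>k - r\<close>.\<close>

lemma var_iso_reindex:
  fixes X :: "('v \<Rightarrow> 'a::field) set" and Y :: "('w \<Rightarrow> 'a) set"
  assumes A: "A \<subseteq> V" and B: "B \<subseteq> W" and \<beta>: "bij_betw \<beta> B A"
    and X: "X \<subseteq> aff A" and Y: "Y \<subseteq> aff B"
    and XY: "\<And>p. p \<in> aff A \<Longrightarrow> p \<in> X \<longleftrightarrow> (\<lambda>w. if w \<in> B then p (\<beta> w) else 0) \<in> Y"
  shows "var_iso V X W Y"
proof -
  define \<phi> where "\<phi> p = (\<lambda>w. if w \<in> B then p (\<beta> w) else (0::'a))" for p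
  define \<gamma> where "\<gamma> = the_inv_into B \<beta>"
  define \<psi> where "\<psi> q = (\<lambda>v. if v \<in> A then q (\<gamma> v) else (0::'a))" for q
  have \<beta>A: "\<beta> w \<in> A" "\<gamma> (\<beta> w) = w" if "w \<in> B" for w
    using \<beta> that by (auto simp: \<gamma>_def bij_betw_def the_inv_into_f_f)
  have \<gamma>B: "\<gamma> v \<in> B" "\<beta> (\<gamma> v) = v" if "v \<in> A" for v
    using \<beta> that by (auto simp: \<gamma>_def bij_betw_def the_inv_into_into f_the_inv_into_f)
  have XV: "X \<subseteq> aff V" using X A unfolding aff_def by blast
  have YW: "Y \<subseteq> aff W" using Y B unfolding aff_def by blast
  have \<psi>aff: "\<psi> q \<in> aff A" for q by (simp add: \<psi>_def aff_def)
  have \<phi>\<psi>: "\<phi> (\<psi> q) = q" if "q \<in> Y" for q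
  proof
    fix w show "\<phi> (\<psi> q) w = q w"
      using \<beta>A[of w] Y that by (auto simp: \<phi>_def \<psi>_def aff_def)
  qed
  have \<psi>\<phi>: "\<psi> (\<phi> p) = p" if "p \<in> X" for p
  proof
    fix v show "\<psi> (\<phi> p) v = p v"
      using \<gamma>B[of v] X that by (auto simp: \<phi>_def \<psi>_def aff_def)
  qed
  have "morphism V X W Y \<phi>"
    unfolding morphism_def
  proof (intro conjI ballI)
    show "\<phi> p \<in> Y" if "p \<in> X" for p using XY[of p] X that by (auto simp: \<phi>_def)
    show "regular_on V X (\<lambda>p. \<phi> p w)" for w
      by (rule regular_on_ratfun[OF ratfun_polyfun XV])
        (cases "w \<in> B", use \<beta>A A in \<open>auto simp: \<phi>_def intro: polyfun_var\<close>)
  qed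
  moreover have "morphism W Y V X \<psi>"
    unfolding morphism_def
  proof (intro conjI ballI)
    show "\<psi> q \<in> X" if "q \<in> Y" for q
      using XY[OF \<psi>aff[of q]] \<phi>\<psi>[OF that] that by (simp add: \<phi>_def)
    show "regular_on W Y (\<lambda>q. \<psi> q v)" for v
      by (rule regular_on_ratfun[OF ratfun_polyfun YW])
        (cases "v \<in> A", use \<gamma>B B in \<open>auto simp: \<psi>_def intro: polyfun_var\<close>)
  qed
  ultimately show ?thesis
    unfolding var_iso_def using \<phi>\<psi> \<psi>\<phi> by blast
qed

section \<open>Jets vanishing at the origin\<close>

lemma fps_X_power_dvd_cancel:
  fixes d :: "'a::field fps"
  assumes "r \<le> k"
  shows "fps_X ^ k dvd fps_X ^ r * d \<longleftrightarrow> fps_X ^ (k - r) dvd d"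
proof -
  have "fps_X ^ k = (fps_X ^ r * fps_X ^ (k - r) :: 'a fps)" using assms by (simp flip: power_add)
  then show ?thesis by simp
qed

lemma jmat_constant_term_0:
  fixes p :: "nat \<times> nat \<times> nat \<Rightarrow> 'a::comm_ring_1"
  assumes "p (i, j, 0) = 0"
  shows "jmat k p i j = fps_X * fps_shift 1 (jmat k p i j)"
proof (rule fps_ext)
  fix l show "fps_nth (jmat k p i j) l = fps_nth (fps_X * fps_shift 1 (jmat k p i j)) l"
    using assms by (cases l) auto
qed

text \<open>Each entry is \<open>fps_X\<close> times its shift, so a minor of size \<open>r\<close>
  acquires the factor \<open>fps_X ^ r\<close>. This already suffices if \<open>k \<le> r\<close>;
  otherwise cancelling it leaves the precision \<open>k - r\<close>.\<close>

lemma minors_dvd_jmat_constant_term_0: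
  fixes p :: "nat \<times> nat \<times> nat \<Rightarrow> 'a::field"
  assumes p: "\<And>i j. i \<in> {1..m} \<Longrightarrow> j \<in> {1..n} \<Longrightarrow> p (i, j, 0) = 0"
  shows "k \<le> r \<Longrightarrow> minors_dvd (fps_X ^ k) {1..m} {1..n} r (jmat k p)"
    and "r < k \<Longrightarrow> 1 \<le> r \<Longrightarrow> minors_dvd (fps_X ^ k) {1..m} {1..n} r (jmat k p) \<longleftrightarrow>
      minors_dvd (fps_X ^ (k - r)) {1..m} {1..n} r
        (jmat (k - r) (\<lambda>(i, j, l). if l < k - r then p (i, j, l + 1) else 0))"
proof -
  let ?Y = "\<lambda>i j. fps_shift 1 (jmat k p i j)"
  have det: "fdet r (\<lambda>a b. jmat k p (f a) (g b)) = fps_X ^ r * fdet r (\<lambda>a b. ?Y (f a) (g b))"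
    if "\<And>a. a < r \<Longrightarrow> f a \<in> {1..m}" "\<And>b. b < r \<Longrightarrow> g b \<in> {1..n}" for f g
  proof -
    have "fdet r (\<lambda>a b. jmat k p (f a) (g b)) = fdet r (\<lambda>a b. fps_X * ?Y (f a) (g b))"
      by (rule fdet_cong) (rule jmat_constant_term_0, rule p, rule that, assumption, rule that)
    then show ?thesis by (simp only: fdet_scale)
  qed
  {
    assume kr: "k \<le> r"
    show "minors_dvd (fps_X ^ k) {1..m} {1..n} r (jmat k p)"
    proof (rule minors_dvdI)
      fix f g assume "\<And>a. a < r \<Longrightarrow> f a \<in> {1..m}" "\<And>b. b < r \<Longrightarrow> g b \<in> {1..n}"
      then have "fdet r (\<lambda>a b. jmat k p (f a) (g b)) = fps_X ^ r * fdet r (\<lambda>a b. ?Y (f a) (g b))" by (rule det)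
      then show "fps_X ^ k dvd fdet r (\<lambda>a b. jmat k p (f a) (g b))"
        using le_imp_power_dvd[OF kr, of "fps_X :: 'a fps"] by simp
    qed
  next
    assume rk: "r < k" "1 \<le> r"
    have "minors_dvd (fps_X ^ k) {1..m} {1..n} r (jmat k p) \<longleftrightarrow> minors_dvd (fps_X ^ (k - r)) {1..m} {1..n} r ?Y"
    proof -
      have "fps_X ^ k dvd fdet r (\<lambda>a b. jmat k p (f a) (g b)) \<longleftrightarrow>
        fps_X ^ (k - r) dvd fdet r (\<lambda>a b. ?Y (f a) (g b))"
        if "\<forall>a<r. f a \<in> {1..m}" "\<forall>b<r. g b \<in> {1..n}" for f g
      proof -
        have "fdet r (\<lambda>a b. jmat k p (f a) (g b)) = fps_X ^ r * fdet r (\<lambda>a b. ?Y (f a) (g b))"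
          by (rule det) (use that in blast)+
        then show ?thesis using fps_X_power_dvd_cancel[of r k] rk(1) by simp
      qed
      then show ?thesis unfolding minors_dvd_def by blast
    qed
    also have "\<dots> \<longleftrightarrow> minors_dvd (fps_X ^ (k - r)) {1..m} {1..n} r
        (jmat (k - r) (\<lambda>(i, j, l). if l < k - r then p (i, j, l + 1) else 0))"
      by (rule minors_dvd_cong) (use rk in \<open>auto simp: fps_X_power_dvd_diff_iff\<close>)
    finally show "minors_dvd (fps_X ^ k) {1..m} {1..n} r (jmat k p) \<longleftrightarrow>
      minors_dvd (fps_X ^ (k - r)) {1..m} {1..n} r
        (jmat (k - r) (\<lambda>(i, j, l). if l < k - r then p (i, j, l + 1) else 0))" .
  }
qed

definition jets_at_origin :: "nat \<Rightarrow> nat \<Rightarrow> nat \<Rightarrow> nat \<Rightarrow> (nat \<times> nat \<times> nat \<Rightarrow> 'a::comm_ring_1) set" where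
  "jets_at_origin m n r k = {p \<in> jetZ m n r k. \<forall>i j. 1 \<le> i \<and> i \<le> m \<and> 1 \<le> j \<and> j \<le> n \<longrightarrow> p (i, j, 0) = 0}"

definition posIdx :: "nat \<Rightarrow> nat \<Rightarrow> nat \<Rightarrow> (nat \<times> nat \<times> nat) set" where
  "posIdx m n k = {1..m} \<times> {1..n} \<times> {1..<k}"

lemma aff_posIdx_iff:
  assumes "1 \<le> k"
  shows "p \<in> aff (posIdx m n k) \<longleftrightarrow>
    p \<in> aff (Idx m n k) \<and> (\<forall>i j. 1 \<le> i \<and> i \<le> m \<and> 1 \<le> j \<and> j \<le> n \<longrightarrow> p (i, j, 0) = 0)"
proof
  assume "p \<in> aff (posIdx m n k)"
  then show "p \<in> aff (Idx m n k) \<and> (\<forall>i j. 1 \<le> i \<and> i \<le> m \<and> 1 \<le> j \<and> j \<le> n \<longrightarrow> p (i, j, 0) = 0)"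
    using assms by (auto simp: aff_def posIdx_def Idx_def)
next
  assume p: "p \<in> aff (Idx m n k) \<and> (\<forall>i j. 1 \<le> i \<and> i \<le> m \<and> 1 \<le> j \<and> j \<le> n \<longrightarrow> p (i, j, 0) = 0)"
  show "p \<in> aff (posIdx m n k)"
    unfolding aff_def
  proof (intro CollectI allI impI)
    fix v assume v: "v \<notin> posIdx m n k"
    obtain i j l where ijl: "v = (i, j, l)" by (cases v)
    show "p v = 0"
    proof (cases "v \<in> Idx m n k")
      case True
      then have "l = 0" "1 \<le> i \<and> i \<le> m \<and> 1 \<le> j \<and> j \<le> n"
        using v by (auto simp: ijl posIdx_def Idx_def)
      then show ?thesis using p ijl by blast
    next
      case False
      then show ?thesis using p affD[of p "Idx m n k" v] by simp
    qed
  qed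
qed

lemma jets_at_origin_iso_affine:
  assumes "k \<le> r" "1 \<le> k"
  shows "var_iso (Idx m n k) (jets_at_origin m n r k :: (_ \<Rightarrow> 'a::field) set)
    {..<m * n * (k - 1)} (aff {..<m * n * (k - 1)})"
proof -
  have "card (posIdx m n k) = m * n * (k - 1)" "finite (posIdx m n k)"
    by (simp_all add: posIdx_def card_cartesian_product)
  then obtain e where e: "bij_betw e {..<m * n * (k - 1)} (posIdx m n k)"
    using ex_bij_betw_nat_finite[of "posIdx m n k"] unfolding atLeast0LessThan by metis
  have eq: "jets_at_origin m n r k = (aff (posIdx m n k) :: (_ \<Rightarrow> 'a) set)"
  proof (rule Set.set_eqI)
    fix p :: "nat \<times> nat \<times> nat \<Rightarrow> 'a"
    show "p \<in> jets_at_origin m n r k \<longleftrightarrow> p \<in> aff (posIdx m n k)"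
      using minors_dvd_jmat_constant_term_0(1)[of m n p k r] assms(1)
      unfolding aff_posIdx_iff[OF assms(2)] jets_at_origin_def mem_jetZ_iff by auto
  qed
  show ?thesis
    unfolding eq
  proof (rule var_iso_reindex[OF _ _ e])
    show "posIdx m n k \<subseteq> Idx m n k" by (auto simp: posIdx_def Idx_def)
  qed (auto simp: aff_def)
qed

text \<open>After division by \<open>t\<close> only the coefficients of \<open>t ^ 1\<close> to
  \<open>t ^ (k - r)\<close> of the original matrix enter the equations. The orders
  \<open>k - r + 1\<close> to \<open>k - 1\<close> are free, which accounts for \<open>r - 1\<close>
  parameters per entry.\<close>

lemma jets_at_origin_iso_product:
  assumes "r < k" "1 \<le> r"
  shows "var_iso (Idx m n k) (jets_at_origin m n r k :: (_ \<Rightarrow> 'a::field) set)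
    (prod_vars (Idx m n k) (m * n * (r - 1))) (prod_aff (jetZ m n r (k - r)) (m * n * (r - 1)))"
proof -
  let ?d = "m * n * (r - 1)" and ?E = "{1..m} \<times> {1..n} \<times> {k - r + 1..<k}"
  let ?K = "Idx m n (k - r)"
  have k: "1 \<le> k" using assms by simp
  have "k - (k - r + 1) = r - 1" using assms by simp
  then have "card ?E = ?d" by (simp add: card_cartesian_product)
  moreover have "finite ?E" by simp
  ultimately obtain e where e: "bij_betw e {..<?d} ?E"
    using ex_bij_betw_nat_finite[of ?E] unfolding atLeast0LessThan by metis
  define s where "s = (\<lambda>(i, j, l). (i, j, l + 1) :: nat \<times> nat \<times> nat)"
  define \<beta> where "\<beta> = case_sum s e"
  define B where "B = Inl ` ?K \<union> Inr ` {..<?d}"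
  have s_img: "s ` ?K = {1..m} \<times> {1..n} \<times> {1..k - r}"
  proof
    show "s ` ?K \<subseteq> {1..m} \<times> {1..n} \<times> {1..k - r}" by (auto simp: s_def Idx_def)
    show "{1..m} \<times> {1..n} \<times> {1..k - r} \<subseteq> s ` ?K"
    proof
      fix v assume "v \<in> {1..m} \<times> {1..n} \<times> {1..k - r}"
      then obtain i j l where v: "v = (i, j, l)" "i \<in> {1..m}" "j \<in> {1..n}" "l \<in> {1..k - r}" by auto
      then have "(i, j, l - 1) \<in> ?K" "s (i, j, l - 1) = v" by (auto simp: Idx_def s_def)
      then show "v \<in> s ` ?K" by (metis imageI)
    qed
  qed
  have "inj_on s ?K" by (auto simp: inj_on_def s_def)
  have pos: "posIdx m n k = s ` ?K \<union> ?E" unfolding s_img using assms by (auto simp: posIdx_def)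
  have "bij_betw \<beta> B (posIdx m n k)"
    unfolding B_def pos
  proof (rule bij_betw_combine)
    have "bij_betw (s \<circ> (\<lambda>x. case x of Inl v \<Rightarrow> v | Inr _ \<Rightarrow> undefined)) (Inl ` ?K) (s ` ?K)"
      using \<open>inj_on s ?K\<close> by (auto simp: bij_betw_def inj_on_def image_image)
    then show "bij_betw \<beta> (Inl ` ?K) (s ` ?K)"
      by (rule bij_betw_cong[THEN iffD1, rotated]) (auto simp: \<beta>_def)
    show "bij_betw \<beta> (Inr ` {..<?d}) ?E"
      using e by (auto simp: bij_betw_def inj_on_def image_image \<beta>_def)
    show "s ` ?K \<inter> ?E = {}" unfolding s_img by auto
  qed
  then show ?thesis
  proof (rule var_iso_reindex[rotated 2])
    show "posIdx m n k \<subseteq> Idx m n k" by (auto simp: posIdx_def Idx_def)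
    show "B \<subseteq> prod_vars (Idx m n k) ?d" by (auto simp: B_def prod_vars_def Idx_def)
    show "jets_at_origin m n r k \<subseteq> (aff (posIdx m n k) :: (_ \<Rightarrow> 'a) set)"
      unfolding jets_at_origin_def mem_jetZ_iff using aff_posIdx_iff[OF k] by blast
    show "prod_aff (jetZ m n r (k - r)) ?d \<subseteq> (aff B :: (_ \<Rightarrow> 'a) set)"
    proof
      fix q :: "nat \<times> nat \<times> nat + nat \<Rightarrow> 'a"
      assume q: "q \<in> prod_aff (jetZ m n r (k - r)) ?d"
      then have inl: "(\<lambda>v. q (Inl v)) \<in> aff ?K" and inr: "\<forall>i. ?d \<le> i \<longrightarrow> q (Inr i) = 0"
        using jetZ_subset_aff[of m n r "k - r"] by (auto simp: prod_aff_def)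
      show "q \<in> aff B"
        unfolding aff_def
      proof (intro CollectI allI impI)
        fix w assume w: "w \<notin> B"
        show "q w = 0"
        proof (cases w)
          case (Inl v)
          then have "v \<notin> ?K" using w unfolding B_def by blast
          then show ?thesis using affD[OF inl] Inl by simp
        next
          case (Inr i)
          then have "?d \<le> i" using w unfolding B_def by (metis UnI2 imageI lessThan_iff not_less)
          then show ?thesis using inr Inr by simp
        qed
      qed
    qed
    fix p :: "nat \<times> nat \<times> nat \<Rightarrow> 'a" assume p: "p \<in> aff (posIdx m n k)"
    let ?q = "\<lambda>w. if w \<in> B then p (\<beta> w) else 0"
    let ?p' = "\<lambda>(i, j, l). if l < k - r then p (i, j, l + 1) else 0"
    note p' = p[unfolded aff_posIdx_iff[OF k]]
    have "(\<lambda>v. ?q (Inl v)) = ?p'"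
    proof
      fix v :: "nat \<times> nat \<times> nat"
      obtain i j l where v: "v = (i, j, l)" by (cases v)
      show "?q (Inl v) = ?p' v"
      proof (cases "l < k - r")
        case True
        show ?thesis
        proof (cases "v \<in> ?K")
          case False
          then have "(i, j, l + 1) \<notin> posIdx m n k" using True by (auto simp: v posIdx_def Idx_def)
          then show ?thesis using True False affD[OF p] by (auto simp: v B_def)
        qed (use True in \<open>simp add: B_def \<beta>_def s_def v\<close>)
      next
        case False
        then show ?thesis by (auto simp: v B_def Idx_def)
      qed
    qed
    moreover have "?p' \<in> aff ?K"
      using p' by (auto simp: aff_def Idx_def)
    ultimately have "?q \<in> prod_aff (jetZ m n r (k - r)) ?d \<longleftrightarrow>
      minors_dvd (fps_X ^ (k - r)) {1..m} {1..n} r (jmat (k - r) ?p')"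
      by (auto simp: prod_aff_def mem_jetZ_iff B_def)
    also have "\<dots> \<longleftrightarrow> minors_dvd (fps_X ^ k) {1..m} {1..n} r (jmat k p)"
      by (rule minors_dvd_jmat_constant_term_0(2)[symmetric]) (use p' assms in auto)
    also have "\<dots> \<longleftrightarrow> p \<in> jets_at_origin m n r k"
      using p' by (auto simp: jets_at_origin_def mem_jetZ_iff)
    finally show "p \<in> jets_at_origin m n r k \<longleftrightarrow> ?q \<in> prod_aff (jetZ m n r (k - r)) ?d" by simp
  qed
qed

section \<open>Components of jet schemes of determinantal varieties\<close>

locale jet_components = jet_pivot m n k TYP for m n k and TYP :: "'a::field itself" +
  fixes r :: nat
  assumes F: "alg_closed TYPE('a)" and r: "2 \<le> r" "r \<le> m" "m \<le> n"
begin

abbreviation "I \<equiv> (jetI m n r k :: (nat \<times> nat \<times> nat, 'a) mpoly set)"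
abbreviation "Z \<equiv> (jetZ m n r k :: (nat \<times> nat \<times> nat \<Rightarrow> 'a) set)"
abbreviation "Z' \<equiv> (jetZ (m - 1) (n - 1) (r - 1) k :: (nat \<times> nat \<times> nat \<Rightarrow> 'a) set)"
abbreviation "valid i j \<equiv> 1 \<le> i \<and> i \<le> m \<and> 1 \<le> j \<and> j \<le> n"
abbreviation "x0 i j \<equiv> (mvar (i, j, 0) :: (nat \<times> nat \<times> nat, 'a) mpoly)"

text \<open>The closure of \<open>U\<close>; \<open>main_jets_union\<close> identifies it with the
  union of zero sets by which \<open>Z0\<close> is given.\<close>

definition "main_jets = zclosure V (nonvanishing_jets m n r k ({1..m} \<times> {1..n}) :: (_ \<Rightarrow> 'a) set)"

lemma Z_eq: "Z = zeros V I"
  by (simp add: jetZ_def)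

lemma x0_polyring: "valid i j \<Longrightarrow> x0 i j \<in> polyring V"
  using k by (auto simp: Idx_def intro!: polyring_mvar)

lemma valid_11: "valid 1 1"
  using m n by simp

lemma main_jets_eq:
  assumes "valid i j"
  shows "main_jets = zclosure V {p \<in> Z. p (i, j, 0) \<noteq> 0}"
  using zclosure_nonvanishing_jets[OF inf, of "{(i, j)}" m n k r] assms
  by (simp add: main_jets_def nonvanishing_jets_def)

lemma mem_main_jets_iff:
  assumes "valid i j"
  shows "p \<in> main_jets \<longleftrightarrow> (\<exists>P. minimal_prime V I P \<and> x0 i j \<notin> P \<and> p \<in> zeros V P)"
  using mem_zclosure_basic_open_iff[OF F finite_Idx is_ideal_jetI x0_polyring[OF assms], of p r]
  by (simp add: main_jets_eq[OF assms] Z_eq)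

lemma zclosed_main_jets: "zclosed V main_jets"
  unfolding main_jets_def by (rule zclosed_zclosure[OF nonvanishing_jets_subset_aff])

lemma main_jets_subset: "main_jets \<subseteq> Z"
  unfolding main_jets_def
  by (rule zclosure_subset[OF zclosed_jetZ]) (simp add: nonvanishing_jets_def)

lemma zeros_subset_Z: "minimal_prime V I P \<Longrightarrow> zeros V P \<subseteq> Z"
  unfolding Z_eq by (rule zeros_mono) (rule minimal_primeD(2))

text \<open>If \<open>P\<close> omitted \<open>x0 i j\<close>, its zeros would lie in
  \<open>main_jets\<close>, which is also the closure of the locus where \<open>x0 i' j'\<close> is
  nonzero. A function outside \<open>P\<close> that vanishes on this locus would vanish on the zeros
  of \<open>P\<close>, against the Nullstellensatz.\<close>

lemma minimal_prime_x0_all: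
  assumes P: "minimal_prime V I P" and ij: "valid i j" "valid i' j'" and x: "x0 i' j' \<in> P"
  shows "x0 i j \<in> P"
proof (rule ccontr)
  assume "x0 i j \<notin> P"
  then have sub: "zeros V P \<subseteq> main_jets" using mem_main_jets_iff[OF ij(1)] P by blast
  obtain g where g: "g \<in> polyring V" "g \<notin> P" "\<And>p. p \<in> zeros V I \<Longrightarrow> peval p (x0 i' j') \<noteq> 0 \<Longrightarrow> peval p g = 0"
    using minimal_prime_generically_nilpotent[OF is_ideal_jetI P x] by blast
  have "{p \<in> Z. p (i', j', 0) \<noteq> 0} \<subseteq> aff V" using jetZ_subset_aff[of m n r k] by blast
  moreover have "\<forall>p\<in>{p \<in> Z. p (i', j', 0) \<noteq> 0}. peval p g = 0" using g(3) by (simp add: Z_eq)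
  ultimately have "peval p g = 0" if "p \<in> main_jets" for p
    using zclosure_vanish[OF _ g(1)] that unfolding main_jets_eq[OF ij(2)] by blast
  then have "g \<in> vid V (zeros V P)" using sub g(1) by (auto simp: vid_def)
  then show False using g(2) vid_zeros_prime[OF F finite_Idx minimal_primeD(1)[OF P]] by simp
qed

lemma Z_eq_union: "Z = main_jets \<union> jets_at_origin m n r k"
proof
  show "Z \<subseteq> main_jets \<union> jets_at_origin m n r k"
  proof
    fix p assume p: "p \<in> Z"
    then obtain P where P: "minimal_prime V I P" "p \<in> zeros V P"
      using zeros_covered_by_minimal_primes[OF is_ideal_jetI] unfolding Z_eq by blast
    show "p \<in> main_jets \<union> jets_at_origin m n r k"
    proof (cases "\<exists>i j. valid i j \<and> x0 i j \<notin> P")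
      case True
      then show ?thesis using mem_main_jets_iff P by blast
    next
      case False
      then have "p (i, j, 0) = 0" if "valid i j" for i j
        using P(2) that peval_mvar[of p "(i, j, 0)"] unfolding zeros_def by fastforce
      then show ?thesis using p by (simp add: jets_at_origin_def)
    qed
  qed
  show "main_jets \<union> jets_at_origin m n r k \<subseteq> Z"
    using main_jets_subset by (auto simp: jets_at_origin_def)
qed

lemma main_jets_nonempty: "main_jets \<noteq> {}"
  using nonvanishing_jets_nonempty[OF r(1) k order.refl] zclosure_superset
  unfolding main_jets_def by blast

lemma irr_comp_main_jets:
  assumes C: "irr_comp V main_jets C"
  obtains P where "minimal_prime V I P" "x0 1 1 \<notin> P" "C = zeros V P"
  using irr_comp_zclosure_basic_open[OF F finite_Idx is_ideal_jetI x0_polyring[OF valid_11], of r C] C that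
  unfolding main_jets_eq[OF valid_11] Z_eq peval_mvar by blast

lemma irr_comp_main_jets_Z:
  assumes "irr_comp V main_jets C"
  shows "irr_comp V Z C"
proof -
  obtain P where P: "minimal_prime V I P" "C = zeros V P" by (rule irr_comp_main_jets[OF assms])
  show ?thesis
    unfolding P(2) Z_eq
    by (rule irr_comp_zeros_minimal_prime[OF F finite_Idx P(1)]) (use zeros_subset_Z[OF P(1)] Z_eq in auto)
qed

lemma zeros_at_origin:
  assumes P: "minimal_prime V I P" and ij: "valid i j" and x: "x0 i j \<in> P"
  shows "zeros V P \<subseteq> jets_at_origin m n r k"
proof
  fix p assume p: "p \<in> zeros V P"
  have "p (i', j', 0) = 0" if ij': "valid i' j'" for i' j'
  proof -
    have "x0 i' j' \<in> P" by (rule minimal_prime_x0_all[OF P ij' ij x])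
    then have "peval p (x0 i' j') = 0" using p unfolding zeros_def by blast
    then show ?thesis by simp
  qed
  then show "p \<in> jets_at_origin m n r k"
    using p zeros_subset_Z[OF P] by (auto simp: jets_at_origin_def)
qed

lemma irr_comps_at_origin:
  assumes P: "minimal_prime V I P" and ij: "valid i j" and x: "x0 i j \<in> P"
  shows "irr_comp V (jets_at_origin m n r k) (zeros V P)" "irr_comp V Z (zeros V P)"
proof -
  have sub: "(jets_at_origin m n r k :: (_ \<Rightarrow> 'a) set) \<subseteq> zeros V I"
    unfolding Z_eq[symmetric] by (auto simp: jets_at_origin_def)
  show "irr_comp V (jets_at_origin m n r k) (zeros V P)"
    by (rule irr_comp_zeros_minimal_prime[OF F finite_Idx P zeros_at_origin[OF P ij x] sub])
  show "irr_comp V Z (zeros V P)"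
    unfolding Z_eq
    by (rule irr_comp_zeros_minimal_prime[OF F finite_Idx P]) (use zeros_subset_Z[OF P] Z_eq in auto)
qed

text \<open>If the origin part lies in \<open>main_jets\<close>, the zeros of a minimal prime
  containing some \<open>x0 i j\<close> form a component of \<open>main_jets\<close>. Such
  components come from primes omitting \<open>x0 1 1\<close>, and the Nullstellensatz identifies the
  two primes.\<close>

lemma origin_subset_main_iff:
  "jets_at_origin m n r k \<subseteq> main_jets \<longleftrightarrow>
    \<not> (\<exists>P i j. minimal_prime V I P \<and> 1 \<le> i \<and> i \<le> m \<and> 1 \<le> j \<and> j \<le> n \<and> x0 i j \<in> P)"
proof
  assume sub: "jets_at_origin m n r k \<subseteq> main_jets"
  show "\<not> (\<exists>P i j. minimal_prime V I P \<and> 1 \<le> i \<and> i \<le> m \<and> 1 \<le> j \<and> j \<le> n \<and> x0 i j \<in> P)"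
  proof
    assume "\<exists>P i j. minimal_prime V I P \<and> 1 \<le> i \<and> i \<le> m \<and> 1 \<le> j \<and> j \<le> n \<and> x0 i j \<in> P"
    then obtain P i j where P: "minimal_prime V I P" "valid i j" "x0 i j \<in> P" by blast
    have "irr_comp V main_jets (zeros V P)"
      by (rule irr_comp_zeros_minimal_prime[OF F finite_Idx P(1)])
        (use zeros_at_origin[OF P] sub main_jets_subset Z_eq in auto)
    then obtain Q where Q: "minimal_prime V I Q" "x0 1 1 \<notin> Q" "zeros V P = zeros V Q"
      by (rule irr_comp_main_jets)
    have "P = vid V (zeros V P)"
      by (rule vid_zeros_prime[OF F finite_Idx minimal_primeD(1)[OF P(1)], symmetric])
    also have "\<dots> = Q"
      unfolding Q(3) by (rule vid_zeros_prime[OF F finite_Idx minimal_primeD(1)[OF Q(1)]])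
    finally show False using minimal_prime_x0_all[OF P(1) valid_11 P(2,3)] Q(2) by simp
  qed
next
  assume none: "\<not> (\<exists>P i j. minimal_prime V I P \<and> 1 \<le> i \<and> i \<le> m \<and> 1 \<le> j \<and> j \<le> n \<and> x0 i j \<in> P)"
  show "jets_at_origin m n r k \<subseteq> main_jets"
  proof
    fix p :: "nat \<times> nat \<times> nat \<Rightarrow> 'a" assume "p \<in> jets_at_origin m n r k"
    then have "p \<in> zeros V I" unfolding Z_eq[symmetric] by (simp add: jets_at_origin_def)
    then obtain P where P: "minimal_prime V I P" "p \<in> zeros V P"
      using zeros_covered_by_minimal_primes[OF is_ideal_jetI] by blast
    then show "p \<in> main_jets" using none mem_main_jets_iff[OF valid_11] valid_11 by blast
  qed
qed

text \<open>\<open>mem_main_jets_iff\<close> describes the same set for every position, so the union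
  over positions collapses.\<close>

lemma main_jets_union:
  "main_jets = \<Union> {zeros V P | P. minimal_prime V I P \<and>
    (\<exists>i j. 1 \<le> i \<and> i \<le> m \<and> 1 \<le> j \<and> j \<le> n \<and> x0 i j \<notin> P)}" (is "_ = ?R")
proof (rule Set.set_eqI)
  fix p
  have "p \<in> ?R \<longleftrightarrow> (\<exists>P i j. minimal_prime V I P \<and> valid i j \<and> x0 i j \<notin> P \<and> p \<in> zeros V P)"
    by blast
  also have "\<dots> \<longleftrightarrow> (\<exists>i j. valid i j \<and> p \<in> main_jets)"
  proof
    assume "\<exists>P i j. minimal_prime V I P \<and> valid i j \<and> x0 i j \<notin> P \<and> p \<in> zeros V P"
    then obtain P i j where P: "minimal_prime V I P" "valid i j" "x0 i j \<notin> P" "p \<in> zeros V P" by blast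
    then have "p \<in> main_jets" unfolding mem_main_jets_iff[OF P(2)] by (intro exI[of _ P] conjI)
    then show "\<exists>i j. valid i j \<and> p \<in> main_jets" using P(2) by blast
  next
    assume "\<exists>i j. valid i j \<and> p \<in> main_jets"
    then obtain i j where ij: "valid i j" "p \<in> main_jets" by blast
    then obtain P where "minimal_prime V I P" "x0 i j \<notin> P" "p \<in> zeros V P"
      unfolding mem_main_jets_iff[OF ij(1)] by (elim exE conjE)
    then show "\<exists>P i j. minimal_prime V I P \<and> valid i j \<and> x0 i j \<notin> P \<and> p \<in> zeros V P"
      using ij(1) by (intro exI[of _ P] exI[of _ i] exI[of _ j] conjI) simp_all
  qed
  also have "\<dots> \<longleftrightarrow> p \<in> main_jets" using valid_11 by (intro iffI exI[of _ 1]) (elim exE conjE, simp_all)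
  finally show "p \<in> main_jets \<longleftrightarrow> p \<in> ?R" ..
qed

subsection \<open>Comparison with the smaller matrices\<close>

lemma slice_Z': "jet_slice m n k Z' = {p \<in> Z. p (1, 1, 0) \<noteq> 0}"
proof (rule Set.set_eqI)
  fix p
  have Suc: "Suc (r - 1) = r" using r(1) by simp
  show "p \<in> jet_slice m n k Z' \<longleftrightarrow> p \<in> {p \<in> Z. p (1, 1, 0) \<noteq> 0}"
    using mem_jetZ_iff_inner_elim[OF _ _ k m n, of p "r - 1"] jetZ_subset_aff[of m n r k]
    unfolding jet_slice_def Suc by blast
qed

lemma lift_Z': "lift_jets Z' = main_jets"
  unfolding lift_jets_def slice_Z' main_jets_eq[OF valid_11] ..

lemma lift_subset_main: "D \<subseteq> Z' \<Longrightarrow> lift_jets D \<subseteq> main_jets"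
  unfolding lift_Z'[symmetric] by (rule lift_mono)

text \<open>An image under elimination need not be closed, so \<open>D\<close> is the closure of the
  image of the part of \<open>C\<close> with nonzero pivot. That part is dense in \<open>C\<close>
  and lies in the slice of \<open>D\<close>, so \<open>C\<close> lies in the lift.\<close>

lemma project_component:
  assumes C: "zirred V C" "C \<subseteq> main_jets" and p: "p \<in> C" "p (1, 1, 0) \<noteq> 0"
  obtains D where "zirred V' D" "D \<subseteq> Z'" "C \<subseteq> lift_jets D"
proof -
  let ?\<pi> = "\<lambda>p. inner_jet m n k (elim_jet k p)"
  let ?C = "{p \<in> C. peval p pivot \<noteq> 0}"
  let ?D = "zclosure V' (?\<pi> ` ?C)"
  have cl: "zclosed V C" "firr V C" using C(1) by (simp_all add: zirred_iff)
  have irrC: "firr V ?C"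
    by (rule firr_basic_open[OF cl(2) pivot_polyring p(1)]) (use p(2) in simp)
  have aff: "?\<pi> ` ?C \<subseteq> aff V'" using inner_jet_aff by blast
  have "firr V' (?\<pi> ` ?C)"
    unfolding firr_def
  proof (intro conjI ballI impI)
    show "?\<pi> ` ?C \<noteq> {}" using irrC by (simp add: firr_def)
    fix f g :: "(nat \<times> nat \<times> nat, 'a) mpoly"
    assume fg: "f \<in> polyring V'" "g \<in> polyring V'" "\<forall>y\<in>?\<pi> ` ?C. peval y f * peval y g = 0"
    obtain f' where f': "f' \<in> polyring V" "\<And>p. peval (?\<pi> p) f = peval p f'"
      using polyfun_inner_elim[OF fg(1)] by blast
    obtain g' where g': "g' \<in> polyring V" "\<And>p. peval (?\<pi> p) g = peval p g'"
      using polyfun_inner_elim[OF fg(2)] by blast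
    have "(\<forall>y\<in>?C. peval y f' = 0) \<or> (\<forall>y\<in>?C. peval y g' = 0)"
    proof (rule firrD[OF irrC f'(1) g'(1)])
      fix y assume "y \<in> ?C"
      then have "peval (?\<pi> y) f * peval (?\<pi> y) g = 0" using fg(3) by blast
      then show "peval y f' = 0 \<or> peval y g' = 0" by (simp only: f'(2) g'(2) mult_eq_0_iff)
    qed
    then show "(\<forall>y\<in>?\<pi> ` ?C. peval y f = 0) \<or> (\<forall>y\<in>?\<pi> ` ?C. peval y g = 0)"
      by (simp only: ball_simps f'(2) g'(2))
  qed
  then have "zirred V' ?D" by (rule zirred_zclosure[OF aff])
  moreover have "?D \<subseteq> Z'"
  proof (rule zclosure_subset[OF zclosed_jetZ])
    have "?C \<subseteq> jet_slice m n k Z'" using C(2) main_jets_subset unfolding slice_Z' by auto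
    then show "?\<pi> ` ?C \<subseteq> Z'" by (auto simp: jet_slice_def)
  qed
  moreover have "C \<subseteq> lift_jets ?D"
  proof -
    have "?C \<subseteq> jet_slice m n k ?D"
    proof
      fix q assume q: "q \<in> ?C"
      then have "?\<pi> q \<in> ?D" using zclosure_superset[of "?\<pi> ` ?C" V'] by blast
      then show "q \<in> jet_slice m n k ?D"
        using q zclosed_subset_aff[OF cl(1)] by (auto simp: jet_slice_def)
    qed
    then have "zclosure V ?C \<subseteq> lift_jets ?D"
      unfolding lift_jets_def
      by (rule zclosure_subset[OF zclosed_zclosure[OF jet_slice_subset_aff] subset_trans[OF _ zclosure_superset]])
    then show ?thesis
      using zirred_eq_closure_basic_open[OF C(1) pivot_polyring p(1)] p(2) by simp
  qed
  ultimately show ?thesis by (rule that)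
qed

text \<open>A larger irreducible set in \<open>main_jets\<close> still contains a point with nonzero
  pivot, so it lies in the lift of some irreducible \<open>E\<close>; comparing lifts gives
  \<open>D \<subseteq> E\<close>.\<close>

lemma irr_comp_lift:
  assumes D: "irr_comp V' Z' D"
  shows "irr_comp V main_jets (lift_jets D)"
proof -
  have Dz: "zirred V' D" "D \<subseteq> Z'" and max: "\<And>E. zirred V' E \<Longrightarrow> E \<subseteq> Z' \<Longrightarrow> \<not> D \<subset> E"
    using D by (auto simp: irr_comp_def)
  have cl: "zclosed V' D" "firr V' D" using Dz(1) by (simp_all add: zirred_iff)
  obtain p where p: "p \<in> jet_slice m n k D"
    using firr_slice[OF cl(2) zclosed_subset_aff[OF cl(1)]] by (auto simp: firr_def)
  have "\<not> lift_jets D \<subset> C" if C: "zirred V C" "C \<subseteq> main_jets" for C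
  proof
    assume DC: "lift_jets D \<subset> C"
    have "p \<in> C" using p DC zclosure_superset unfolding lift_jets_def by blast
    moreover have "p (1, 1, 0) \<noteq> 0" using p by (simp add: jet_slice_def)
    ultimately obtain E where E: "zirred V' E" "E \<subseteq> Z'" "C \<subseteq> lift_jets E"
      using project_component[OF C] by metis
    have "zclosed V' E" using E(1) by (simp add: zirred_iff)
    then have "D \<subseteq> E" using lift_subset_iff[OF cl(1)] DC E(3) by blast
    then have "D = E" using max[OF E(1,2)] by blast
    then show False using DC E(3) by blast
  qed
  then show ?thesis
    unfolding irr_comp_def using zirred_lift[OF Dz(1)] lift_subset_main[OF Dz(2)] by blast
qed

text \<open>The prime of \<open>C\<close> omits \<open>x0 1 1\<close>, which gives the point with
  nonzero pivot required for the projection; maximality turns the inclusion into an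
  equality.\<close>

lemma irr_comp_unlift:
  assumes C: "irr_comp V main_jets C"
  shows "\<exists>D. irr_comp V' Z' D \<and> lift_jets D = C"
proof -
  have Cz: "zirred V C" "C \<subseteq> main_jets" and max: "\<And>E. zirred V E \<Longrightarrow> E \<subseteq> main_jets \<Longrightarrow> \<not> C \<subset> E"
    using C by (auto simp: irr_comp_def)
  obtain P where P: "minimal_prime V I P" "x0 1 1 \<notin> P" "C = zeros V P" by (rule irr_comp_main_jets[OF C])
  obtain p where p: "p \<in> C" "p (1, 1, 0) \<noteq> 0"
    using nullstellensatz_prime[OF F finite_Idx minimal_primeD(1)[OF P(1)] x0_polyring[OF valid_11] P(2)] P(3)
    unfolding peval_mvar by blast
  obtain D where D: "zirred V' D" "D \<subseteq> Z'" "C \<subseteq> lift_jets D"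
    by (rule project_component[OF Cz p])
  have eq: "lift_jets D = C"
    using max[OF zirred_lift[OF D(1)] lift_subset_main[OF D(2)]] D(3) by blast
  have "\<not> D \<subset> E" if E: "zirred V' E" "E \<subseteq> Z'" for E
  proof
    assume "D \<subset> E"
    then have "lift_jets D \<subset> lift_jets E"
      using lift_strict_mono D(1) E(1) by (simp add: zirred_iff)
    then show False using max[OF zirred_lift[OF E(1)] lift_subset_main[OF E(2)]] eq by blast
  qed
  then have "irr_comp V' Z' D" using D by (auto simp: irr_comp_def)
  then show ?thesis using eq by blast
qed

lemma component_bijection:
  "\<exists>f. bij_betw f {C. irr_comp V main_jets C} {D. irr_comp V' Z' D} \<and>
    (\<forall>C. irr_comp V main_jets C \<longrightarrow> codim V C = codim V' (f C))"
proof -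
  let ?A = "{D. irr_comp V' Z' D}" and ?B = "{C. irr_comp V main_jets C}"
  have closed: "zclosed V' D" "zirred V' D" if "D \<in> ?A" for D
    using that by (simp_all add: irr_comp_def zirred_iff)
  have "inj_on lift_jets ?A"
  proof (rule inj_onI)
    fix D E assume DE: "D \<in> ?A" "E \<in> ?A" "lift_jets D = lift_jets E"
    show "D = E"
      using lift_subset_iff[OF closed(1)[OF DE(1)] closed(1)[OF DE(2)]]
        lift_subset_iff[OF closed(1)[OF DE(2)] closed(1)[OF DE(1)]] DE(3) by simp
  qed
  moreover have "lift_jets ` ?A = ?B" using irr_comp_lift irr_comp_unlift by blast
  ultimately have bij: "bij_betw lift_jets ?A ?B" by (simp add: bij_betw_def)
  let ?f = "the_inv_into ?A lift_jets"
  have "codim V C = codim V' (?f C)" if "irr_comp V main_jets C" for C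
  proof -
    have C: "C \<in> ?B" using that by simp
    have "lift_jets (?f C) = C" by (rule f_the_inv_into_f_bij_betw[OF bij]) (use C in simp)
    moreover have "?f C \<in> ?A" using bij_betw_the_inv_into[OF bij] C by (auto simp: bij_betw_def)
    ultimately show ?thesis using codim_lift[OF closed(2)[of "?f C"]] by simp
  qed
  then show ?thesis using bij_betw_the_inv_into[OF bij] by blast
qed

section \<open>A birational model of the main part\<close>

lemma card_border: "card (V - shift_idx ` V') = (m + n - 1) * k"
proof -
  have sub: "shift_idx ` V' \<subseteq> V" using shift_idx_Idx by blast
  have "card (V - shift_idx ` V') = m * n * k - (m - 1) * (n - 1) * k"
    by (simp only: card_Diff_subset[OF finite_imageI[OF finite_Idx] sub] card_shift_idx card_Idx)
  moreover obtain m' n' where "m = Suc m'" "n = Suc n'" using m n by (metis Suc_le_D One_nat_def)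
  ultimately show ?thesis by (simp add: algebra_simps)
qed

text \<open>Elimination maps the dense locus of nonzero pivot isomorphically onto the part of the
  product where the coordinate holding the pivot is nonzero.\<close>

theorem birational_main_jets:
  "birational V main_jets (prod_vars V' ((m + n - 1) * k)) (prod_aff Z' ((m + n - 1) * k))"
proof -
  let ?d = "(m + n - 1) * k"
  let ?W = "prod_vars V' ?d" and ?Y = "prod_aff Z' ?d"
  let ?E = "V - shift_idx ` V'"
  obtain e where e: "bij_betw e {..<?d} ?E"
    using ex_bij_betw_nat_finite[of ?E] unfolding card_border atLeast0LessThan by auto
  define \<epsilon> where "\<epsilon> = the_inv_into {..<?d} e"
  have eE: "e i \<in> ?E" "\<epsilon> (e i) = i" if "i < ?d" for i
    using e that by (auto simp: \<epsilon>_def bij_betw_def the_inv_into_f_f)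
  have \<epsilon>E: "\<epsilon> v < ?d" "e (\<epsilon> v) = v" if "v \<in> ?E" for v
  proof -
    show "e (\<epsilon> v) = v" unfolding \<epsilon>_def by (rule f_the_inv_into_f_bij_betw[OF e]) (use that in blast)
    show "\<epsilon> v < ?d" using bij_betw_the_inv_into[OF e] that by (auto simp: \<epsilon>_def bij_betw_def)
  qed
  have piv: "(1, 1, 0) \<in> ?E" using pivot_in_V pivot_not_shift_idx by blast
  \<comment> \<open>The number of the pivot in the enumeration of border coordinates; its coordinate
    cuts out \<open>U2\<close>.\<close>
  define i0 where "i0 = \<epsilon> (1, 1, 0)"
  have i0: "i0 < ?d" "e i0 = (1, 1, 0)" using \<epsilon>E[OF piv] by (simp_all add: i0_def)
  have YW: "?Y \<subseteq> aff ?W"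
  proof
    fix q assume "q \<in> ?Y"
    then have inl: "(\<lambda>v. q (Inl v)) \<in> aff V'" and inr: "\<forall>i. ?d \<le> i \<longrightarrow> q (Inr i) = 0"
      using jetZ_subset_aff[of "m - 1" "n - 1" "r - 1" k] by (auto simp: prod_aff_def)
    show "q \<in> aff ?W"
      unfolding aff_def
    proof (intro CollectI allI impI)
      fix w assume w: "w \<notin> ?W"
      show "q w = 0"
      proof (cases w)
        case (Inl v)
        then have "v \<notin> V'" using w unfolding prod_vars_def by blast
        then show ?thesis using affD[OF inl] Inl by simp
      next
        case (Inr i)
        then have "\<not> i < ?d" using w unfolding prod_vars_def by blast
        then show ?thesis using inr Inr by simp
      qed
    qed
  qed
  define U1 where "U1 = {p \<in> Z. p (1, 1, 0) \<noteq> 0}"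
  define U2 where "U2 = {q \<in> ?Y. q (Inr i0) \<noteq> 0}"
  have U1aff: "U1 \<subseteq> aff V" using jetZ_subset_aff[of m n r k] unfolding U1_def by blast
  have U2aff: "U2 \<subseteq> aff ?W" using YW unfolding U2_def by blast
  have clU1: "zclosure V U1 = main_jets" by (simp only: U1_def main_jets_eq[OF valid_11])
  have open1: "zopen_in V main_jets U1"
  proof -
    have "U1 \<subseteq> main_jets" using zclosure_superset[of U1 V] clU1 by simp
    then have "U1 = main_jets - zeros V {pivot}"
      using main_jets_subset zclosed_subset_aff[OF zclosed_main_jets] by (auto simp: U1_def zeros_def)
    moreover have "zclosed V (zeros V {pivot})" by (rule zclosed_zeros) (simp only: empty_subsetI insert_subset pivot_polyring simp_thms)
    ultimately show ?thesis unfolding zopen_in_def by blast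
  qed
  have i0W: "Inr i0 \<in> ?W" using i0(1) by (simp add: prod_vars_def)
  have open2: "zopen_in ?W ?Y U2"
  proof -
    have "U2 = ?Y - zeros ?W {mvar (Inr i0)}" using YW by (auto simp: U2_def zeros_def)
    moreover have "zclosed ?W (zeros ?W {mvar (Inr i0) :: (_, 'a) mpoly})"
      by (rule zclosed_zeros) (use polyring_mvar[OF i0W] in simp)
    ultimately show ?thesis unfolding zopen_in_def by blast
  qed
  have clU2: "zclosure ?W U2 = zclosure ?W ?Y"
  proof
    show "zclosure ?W U2 \<subseteq> zclosure ?W ?Y"
      by (intro zclosure_subset_zclosure YW subset_trans[OF _ zclosure_superset]) (auto simp: U2_def)
    show "zclosure ?W ?Y \<subseteq> zclosure ?W U2"
    proof (rule zclosure_subset_zclosure[OF _ U2aff], rule subsetI)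
      fix q assume q: "q \<in> ?Y"
      \<comment> \<open>The pivot coordinate is a free affine factor, so a line in its direction
        lies in \<open>U2\<close> for all but one parameter.\<close>
      define c where "c s = q(Inr i0 := q (Inr i0) + s)" for s
      have "c 0 \<in> zclosure ?W U2"
      proof (rule curve_mem_zclosure[OF inf U2aff, where H = "[:q (Inr i0), 1:]"])
        show "\<exists>p. \<forall>s. c s w = poly p s" for w
          by (rule exI[of _ "if w = Inr i0 then [:q (Inr i0), 1:] else [:q w:]"]) (simp add: c_def)
        show "c 0 \<in> aff ?W" using q YW by (auto simp: c_def)
        fix s assume "poly [:q (Inr i0), 1:] s \<noteq> 0"
        then show "c s \<in> U2" using q i0(1) by (auto simp: U2_def c_def prod_aff_def)
      qed simp
      then show "q \<in> zclosure ?W U2" by (simp add: c_def)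
    qed
  qed
  define \<phi> where "\<phi> p = case_sum (inner_jet m n k (elim_jet k p)) (\<lambda>i. if i < ?d then elim_jet k p (e i) else 0)"
    for p :: "nat \<times> nat \<times> nat \<Rightarrow> 'a"
  \<comment> \<open>Reassembles the matrix from its inner block and the enumerated border, undoing
    the splitting in \<open>\<phi>\<close>.\<close>
  define \<tau> where "\<tau> q = glue_jet m n k (\<lambda>v. q (Inl v)) (\<lambda>v. q (Inr (\<epsilon> v)))"
    for q :: "nat \<times> nat \<times> nat + nat \<Rightarrow> 'a"
  define \<psi> where "\<psi> q = unelim_jet k (\<tau> q)" for q :: "nat \<times> nat \<times> nat + nat \<Rightarrow> 'a"
  have U1_slice: "U1 = jet_slice m n k Z'" by (simp only: U1_def slice_Z')
  have \<tau>_piv: "\<tau> q (1, 1, 0) = q (Inr i0)" for q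
    using piv by (simp add: \<tau>_def glue_jet_def i0_def del: One_nat_def)
  have \<tau>_inner: "inner_jet m n k (\<tau> q) = (\<lambda>v. q (Inl v))" if "q \<in> ?Y" for q
    unfolding \<tau>_def
    by (rule inner_glue_jet) (use that jetZ_subset_aff[of "m - 1" "n - 1" "r - 1" k] in \<open>auto simp: prod_aff_def\<close>)
  have \<tau>_cyl: "\<tau> q \<in> jet_cylinder m n k Z'" if "q \<in> ?Y" for q
  proof -
    have "(\<lambda>v. q (Inl v)) \<in> Z'" using that by (simp add: prod_aff_def)
    then show ?thesis using \<tau>_inner[OF that] by (simp add: jet_cylinder_def \<tau>_def glue_jet_aff)
  qed
  have elim_\<psi>: "elim_jet k (\<psi> q) = \<tau> q" if "q \<in> U2" for q
    unfolding \<psi>_def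
    by (rule elim_unelim_jet[where m = m and n = n, OF _ _ k])
      (use that \<tau>_piv in \<open>simp_all add: U2_def \<tau>_def glue_jet_aff\<close>)
  have mor1: "morphism V U1 ?W U2 \<phi>"
    unfolding morphism_def
  proof (intro conjI ballI)
    fix p assume p: "p \<in> U1"
    then have "inner_jet m n k (elim_jet k p) \<in> Z'" unfolding U1_slice by (simp add: jet_slice_def)
    then have "\<phi> p \<in> ?Y" by (simp add: \<phi>_def prod_aff_def)
    moreover have "\<phi> p (Inr i0) = p (1, 1, 0)" using i0 by (simp add: \<phi>_def)
    ultimately show "\<phi> p \<in> U2" using p by (simp add: U1_def U2_def)
  next
    fix w assume "w \<in> ?W"
    have "polyfun V (\<lambda>p. \<phi> p w)"
    proof (cases w)
      case (Inl v)
      then have "v \<in> V'" using \<open>w \<in> ?W\<close> by (auto simp: prod_vars_def)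
      then show ?thesis using polyfun_inner_elim_jet by (simp add: \<phi>_def Inl)
    next
      case (Inr i)
      then have "i < ?d" using \<open>w \<in> ?W\<close> by (auto simp: prod_vars_def)
      moreover have "polyfun V (\<lambda>p. elim_jet k p (e i))"
        by (rule polyfun_elim_jet) (use eE(1)[OF \<open>i < ?d\<close>] in blast)
      ultimately show ?thesis by (simp add: \<phi>_def Inr)
    qed
    then show "regular_on V U1 (\<lambda>p. \<phi> p w)" by (rule regular_on_ratfun[OF ratfun_polyfun U1aff])
  qed
  have mor2: "morphism ?W U2 V U1 \<psi>"
    unfolding morphism_def
  proof (intro conjI ballI)
    fix q assume q: "q \<in> U2"
    then have "q \<in> ?Y" "\<tau> q (1, 1, 0) \<noteq> 0" by (simp_all add: U2_def \<tau>_piv del: One_nat_def)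
    then show "\<psi> q \<in> U1" unfolding U1_slice \<psi>_def using unelim_jet_cylinder[OF \<tau>_cyl _ k] by blast
  next
    fix v
    have "polyfun ?W (\<lambda>q. \<tau> q u)" for u
    proof (cases "u \<in> shift_idx ` V'")
      case True
      then obtain w where w: "w \<in> V'" "u = shift_idx w" by blast
      then have "Inl w \<in> ?W" by (simp add: prod_vars_def)
      then show ?thesis unfolding w(2) \<tau>_def glue_jet_shift[OF w(1)] by (rule polyfun_var)
    next
      case False
      show ?thesis
      proof (cases "u \<in> V")
        case True
        then have "Inr (\<epsilon> u) \<in> ?W" using \<epsilon>E(1)[of u] False by (simp add: prod_vars_def)
        then show ?thesis using False True by (simp add: \<tau>_def glue_jet_def polyfun_var del: One_nat_def)
      next
        case F2: False
        then show ?thesis using False by (simp add: \<tau>_def glue_jet_def del: One_nat_def)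
      qed
    qed
    then have "ratfun ?W U2 (\<lambda>q. \<psi> q v)"
      unfolding \<psi>_def
      by (intro ratfun_unelim_jet[OF ratfun_polyfun _ k]) (simp_all add: \<tau>_piv U2_def del: One_nat_def)
    then show "regular_on ?W U2 (\<lambda>q. \<psi> q v)" by (rule regular_on_ratfun[OF _ U2aff])
  qed
  have \<psi>\<phi>: "\<psi> (\<phi> p) = p" if p: "p \<in> U1" for p
  proof -
    have paff: "p \<in> aff V" using p U1aff by blast
    have "\<tau> (\<phi> p) = glue_jet m n k (inner_jet m n k (elim_jet k p)) (elim_jet k p)"
    proof
      fix v show "\<tau> (\<phi> p) v = glue_jet m n k (inner_jet m n k (elim_jet k p)) (elim_jet k p) v"
        using \<epsilon>E[of v] by (simp add: \<tau>_def \<phi>_def glue_jet_def del: One_nat_def)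
    qed
    also have "\<dots> = elim_jet k p" by (rule glue_inner_jet[OF elim_jet_aff[OF paff]])
    finally show ?thesis
      using unelim_elim_jet[OF paff _ k] p by (simp add: \<psi>_def U1_def)
  qed
  have \<phi>\<psi>: "\<phi> (\<psi> q) = q" if q: "q \<in> U2" for q
  proof
    have qY: "q \<in> ?Y" using q by (simp add: U2_def)
    fix w show "\<phi> (\<psi> q) w = q w"
    proof (cases w)
      case (Inl v)
      then show ?thesis by (simp add: \<phi>_def elim_\<psi>[OF q] \<tau>_inner[OF qY])
    next
      case (Inr i)
      show ?thesis
      proof (cases "i < ?d")
        case True
        have "\<tau> q (e i) = q (Inr i)"
          using eE[OF True] by (simp add: \<tau>_def glue_jet_def del: One_nat_def)
        then show ?thesis using True by (simp add: \<phi>_def elim_\<psi>[OF q] Inr)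
      next
        case False
        then have "q (Inr i) = 0" using qY by (simp add: prod_aff_def)
        then show ?thesis using False by (simp add: \<phi>_def Inr)
      qed
    qed
  qed
  have "var_iso V U1 ?W U2" unfolding var_iso_def using mor1 mor2 \<psi>\<phi> \<phi>\<psi> by blast
  moreover have "zclosure V U1 = zclosure V main_jets"
    using clU1 zclosure_closed[OF zclosed_main_jets] by simp
  ultimately show ?thesis unfolding birational_def using open1 open2 clU2 by blast
qed

end

theorem theorem2p8:
  fixes m n r k :: nat
    and Z0 Z1 U :: "(nat \<times> nat \<times> nat \<Rightarrow> 'a::field) set"
    and Uij :: "nat \<Rightarrow> nat \<Rightarrow> (nat \<times> nat \<times> nat \<Rightarrow> 'a) set"
  assumes F: "alg_closed TYPE('a)"
    and r: "2 \<le> r" "r \<le> m" "m \<le> n" and k: "1 \<le> k"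
  defines "V \<equiv> Idx m n k"
    and "V' \<equiv> Idx (m - 1) (n - 1) k"
    and "I \<equiv> (jetI m n r k :: (nat \<times> nat \<times> nat, 'a) mpoly set)"
    and "Z \<equiv> (jetZ m n r k :: (nat \<times> nat \<times> nat \<Rightarrow> 'a) set)"
    and "Z' \<equiv> (jetZ (m - 1) (n - 1) (r - 1) k :: (nat \<times> nat \<times> nat \<Rightarrow> 'a) set)"
  assumes Z0_def: "Z0 = \<Union> {zeros V P | P. minimal_prime V I P \<and>
                      (\<exists>i j. 1 \<le> i \<and> i \<le> m \<and> 1 \<le> j \<and> j \<le> n \<and> mvar (i, j, 0) \<notin> P)}"
    and Z1_def: "Z1 = {p \<in> Z. \<forall>i j. 1 \<le> i \<and> i \<le> m \<and> 1 \<le> j \<and> j \<le> n \<longrightarrow> p (i, j, 0) = 0}"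
    and Uij_def: "\<And>i j. Uij i j = {p \<in> Z. p (i, j, 0) \<noteq> 0}"
    and U_def: "U = {p \<in> Z. \<forall>i j. 1 \<le> i \<and> i \<le> m \<and> 1 \<le> j \<and> j \<le> n \<longrightarrow> p (i, j, 0) \<noteq> 0}"
  shows
    \<comment> \<open>(1)\<close>
    "Z = Z0 \<union> Z1
     \<comment> \<open>(2)\<close>
     \<and> Z0 \<noteq> {}
     \<and> (\<forall>i j. 1 \<le> i \<and> i \<le> m \<and> 1 \<le> j \<and> j \<le> n \<longrightarrow> Z0 = zclosure V (Uij i j))
     \<and> Z0 = zclosure V U
     \<comment> \<open>(3)\<close>
     \<and> (\<forall>C. irr_comp V Z0 C \<longrightarrow> irr_comp V Z C)
     \<and> (\<exists>f. bij_betw f {C. irr_comp V Z0 C} {D. irr_comp V' Z' D}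
            \<and> (\<forall>C. irr_comp V Z0 C \<longrightarrow> codim V C = codim V' (f C)))
     \<comment> \<open>(4)\<close>
     \<and> birational V Z0 (prod_vars V' ((m + n - 1) * k)) (prod_aff Z' ((m + n - 1) * k))
     \<comment> \<open>(5)\<close>
     \<and> (r < k \<longrightarrow> var_iso V Z1 (prod_vars V (m * n * (r - 1)))
                     (prod_aff (jetZ m n r (k - r)) (m * n * (r - 1))))
     \<and> (k \<le> r \<longrightarrow> var_iso V Z1 {..<m * n * (k - 1)} (aff {..<m * n * (k - 1)}))
     \<comment> \<open>(6)\<close>
     \<and> (Z1 \<subseteq> Z0 \<longleftrightarrow> \<not> (\<exists>P i j. minimal_prime V I P \<and> 1 \<le> i \<and> i \<le> m \<and> 1 \<le> j \<and> j \<le> n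
                                 \<and> mvar (i, j, 0) \<in> P))
     \<and> (\<forall>P. minimal_prime V I P \<and>
            (\<exists>i j. 1 \<le> i \<and> i \<le> m \<and> 1 \<le> j \<and> j \<le> n \<and> mvar (i, j, 0) \<in> P) \<longrightarrow>
            (\<forall>i j. 1 \<le> i \<and> i \<le> m \<and> 1 \<le> j \<and> j \<le> n \<longrightarrow> mvar (i, j, 0) \<in> P)
            \<and> irr_comp V Z1 (zeros V P) \<and> irr_comp V Z (zeros V P))"
proof -
  interpret jc: jet_components m n k "TYPE('a)" r
    using F infinite_UNIV_alg_closed[OF F] r k by unfold_locales simp_all
  have Z0: "Z0 = jc.main_jets" unfolding Z0_def V_def I_def by (rule jc.main_jets_union[symmetric])
  have Z1: "Z1 = jets_at_origin m n r k" unfolding Z1_def Z_def jets_at_origin_def ..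
  have U: "U = nonvanishing_jets m n r k ({1..m} \<times> {1..n})"
    unfolding U_def Z_def nonvanishing_jets_def by auto
  have "Z = Z0 \<union> Z1" unfolding Z_def Z0 Z1 by (rule jc.Z_eq_union)
  moreover have "Z0 \<noteq> {}" unfolding Z0 by (rule jc.main_jets_nonempty)
  moreover have "\<forall>i j. 1 \<le> i \<and> i \<le> m \<and> 1 \<le> j \<and> j \<le> n \<longrightarrow> Z0 = zclosure V (Uij i j)"
    unfolding Z0 V_def Uij_def Z_def using jc.main_jets_eq by blast
  moreover have "Z0 = zclosure V U" unfolding Z0 V_def U by (rule jc.main_jets_def)
  moreover have "\<forall>C. irr_comp V Z0 C \<longrightarrow> irr_comp V Z C"
    unfolding Z0 V_def Z_def using jc.irr_comp_main_jets_Z by blast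
  moreover have "\<exists>f. bij_betw f {C. irr_comp V Z0 C} {D. irr_comp V' Z' D}
      \<and> (\<forall>C. irr_comp V Z0 C \<longrightarrow> codim V C = codim V' (f C))"
    unfolding Z0 V_def V'_def Z'_def by (rule jc.component_bijection)
  moreover have "birational V Z0 (prod_vars V' ((m + n - 1) * k)) (prod_aff Z' ((m + n - 1) * k))"
    unfolding Z0 V_def V'_def Z'_def by (rule jc.birational_main_jets)
  moreover have "r < k \<longrightarrow> var_iso V Z1 (prod_vars V (m * n * (r - 1)))
      (prod_aff (jetZ m n r (k - r)) (m * n * (r - 1)))"
    unfolding Z1 V_def by (intro impI jets_at_origin_iso_product) (use r(1) in simp_all)
  moreover have "k \<le> r \<longrightarrow> var_iso V Z1 {..<m * n * (k - 1)} (aff {..<m * n * (k - 1)})"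
    unfolding Z1 V_def using jets_at_origin_iso_affine k by blast
  moreover have "Z1 \<subseteq> Z0 \<longleftrightarrow> \<not> (\<exists>P i j. minimal_prime V I P \<and> 1 \<le> i \<and> i \<le> m \<and> 1 \<le> j \<and> j \<le> n
      \<and> mvar (i, j, 0) \<in> P)"
    unfolding Z0 Z1 V_def I_def by (rule jc.origin_subset_main_iff)
  moreover have "(\<forall>i j. 1 \<le> i \<and> i \<le> m \<and> 1 \<le> j \<and> j \<le> n \<longrightarrow> mvar (i, j, 0) \<in> P)
      \<and> irr_comp V Z1 (zeros V P) \<and> irr_comp V Z (zeros V P)"
    if P: "minimal_prime V I P" and ij: "1 \<le> i \<and> i \<le> m \<and> 1 \<le> j \<and> j \<le> n" and x: "mvar (i, j, 0) \<in> P"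
    for P i j
    using jc.minimal_prime_x0_all[OF P[unfolded V_def I_def] _ ij x]
      jc.irr_comps_at_origin[OF P[unfolded V_def I_def] ij x]
    unfolding Z1 V_def Z_def by blast
  ultimately show ?thesis by blast
qed

end
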